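(* Let $H$ be a weak Hopf algebra over a commutative ring $k$ with bijective antipode $S$. Then $(H^{\rm op}\otimes H,H,H)$ is a (left-right) weak Doi-Hopf datum, where $A=H$ is the right $H^{\rm op}\otimes H$-comodule algebra with coaction $\rho(h)=h_{(2)}\otimes S^{-1}(h_{(1)})\otimes h_{(3)}$ and $C=H$ is the left $H^{\rm op}\otimes H$-module coalgebra with action $(k\otimes h)\triangleright c=hck$. Moreover, the categories ${}_H\mathcal{M}(H^{\rm op}\otimes H)^H$ of weak Doi-Hopf modules over this datum and ${}_H\mathcal{YD}^H$ of left-right Yetter-Drinfeld modules over $H$ are isomorphic.
   Context: All modules are over the commutative ring $k$, $\otimes=\otimes_k$. A weak $k$-bialgebra is a $k$-module $H$ with a unital associative algebra structure and a coassociative counital coalgebra structure $(\Delta,\varepsilon)$, $\Delta(h)=h_{(1)}\otimes h_{(2)}$, such that $\Delta(hk)=\Delta(h)\Delta(k)$, $(\Delta\otimes H)\Delta(1)=1_{(1)}\otimes 1_{(2)}1_{(1')}\otimes 1_{(2')}=1_{(1)}\otimes 1_{(1')}1_{(2)}\otimes 1_{(2')}$, $\varepsilon(hkl)=\varepsilon(hk_{(1)})\varepsilon(k_{(2)}l)=\varepsilon(hk_{(2)})\varepsilon(k_{(1)}l)$. Put $\varepsilon_t(h)=\varepsilon(1_{(1)}h)1_{(2)}$ and $\varepsilon_s(h)=1_{(1)}\varepsilon(h1_{(2)})$. A weak Hopf algebra is a weak bialgebra with a $k$-linear antipode $S$ such that $S(h_{(1)})h_{(2)}=\varepsilon_s(h)$,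 $h_{(1)}S(h_{(2)})=\varepsilon_t(h)$, $S(h_{(1)})h_{(2)}S(h_{(3)})=S(h)$. $H^{\rm op}$ is $H$ with opposite multiplication and the same coalgebra structure; $H^{\rm op}\otimes H$ is the tensor product weak bialgebra. Let $B$ be a weak bialgebra. A right $B$-comodule algebra is a unital algebra $A$ that is a right $B$-comodule via $\rho(a)=a_{[0]}\otimes a_{[1]}$ with $\rho(a)\rho(b)=\rho(ab)$ and $1_{[0]}\otimes\varepsilon_t(1_{[1]})=\rho(1)$ ($\varepsilon_t$ of $B$). A left $B$-module coalgebra is a counital coalgebra $C$ that is a left $B$-module with $\Delta_C(bc)=\Delta_B(b)\Delta_C(c)$ and $\varepsilon_C(bb'c)=\varepsilon_B(bb'_{(2)})\varepsilon_C(b'_{(1)}c)$. Then $(B,A,C)$ is called a left-right weak Doi-Hopf datum. A weak Doi-Hopf module over $(B,A,C)$ is a $k$-module $M$ with a left $A$-action and a (coassociative, counital) right $C$-coaction such that $\rho(am)=a_{[0]}m_{[0]}\otimes a_{[1]}m_{[1]}$ for all $a\in A$, $m\in M$; with left $A$-linear right $C$-colinear maps they form the category ${}_A\mathcal{M}(B)^C$. For a left $H$-module $M$, $M\otimes_tH=\Delta(1)(M\otimes H)$. A left-right Yetter-Drinfeld module is a $k$-module $M$ with a left $H$-action and a right $H$-coaction $\rho(m)=m_{[0]}\otimes m_{[1]}$ such that $\rho(m)\in M\otimes_tH$ and $h_{(1)}m_{[0]}\otimes h_{(2)}m_{[1]}=(h_{(2)}m)_{[0]}\otimes(h_{(2)}m)_{[1]}h_{(1)}$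 for all $h\in H$, $m\in M$; morphisms are left $H$-linear right $H$-colinear maps. *)

theory Defs
  imports "HOL-Algebra.Module" "HOL-Algebra.Free_Abelian_Groups"
begin

section \<open>Tensor products of modules over a commutative ring\<close>

text \<open>
  All modules are over a commutative ring \<open>R\<close>.  The tensor product of \<open>M\<close> and \<open>N\<close> is the free
  abelian group on \<open>carrier M \<times> carrier N\<close> modulo the subgroup generated by the biadditivity and
  balancedness relations.  Its elements are cosets.
\<close>

type_synonym ('m, 'n) tens = "(('m \<times> 'n) \<Rightarrow>\<^sub>0 int) set"

definition tensor_relations ::
  "('k, 'r) ring_scheme \<Rightarrow> ('k, 'm, 'x) module_scheme \<Rightarrow> ('k, 'n, 'y) module_scheme
    \<Rightarrow> (('m \<times> 'n) \<Rightarrow>\<^sub>0 int) set" where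
  "tensor_relations R M N =
     {frag_of (x \<oplus>\<^bsub>M\<^esub> y, n) - frag_of (x, n) - frag_of (y, n) | x y n.
        x \<in> carrier M \<and> y \<in> carrier M \<and> n \<in> carrier N}
   \<union> {frag_of (m, x \<oplus>\<^bsub>N\<^esub> y) - frag_of (m, x) - frag_of (m, y) | m x y.
        m \<in> carrier M \<and> x \<in> carrier N \<and> y \<in> carrier N}
   \<union> {frag_of (r \<odot>\<^bsub>M\<^esub> m, n) - frag_of (m, r \<odot>\<^bsub>N\<^esub> n) | r m n.
        r \<in> carrier R \<and> m \<in> carrier M \<and> n \<in> carrier N}"

definition tensor_kernel ::
  "('k, 'r) ring_scheme \<Rightarrow> ('k, 'm, 'x) module_scheme \<Rightarrow> ('k, 'n, 'y) module_scheme
    \<Rightarrow> (('m \<times> 'n) \<Rightarrow>\<^sub>0 int) set" where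
  "tensor_kernel R M N =
     generate (free_Abelian_group (carrier M \<times> carrier N)) (tensor_relations R M N)"

definition tensor_group ::
  "('k, 'r) ring_scheme \<Rightarrow> ('k, 'm, 'x) module_scheme \<Rightarrow> ('k, 'n, 'y) module_scheme
    \<Rightarrow> ('m, 'n) tens monoid" where
  "tensor_group R M N =
     free_Abelian_group (carrier M \<times> carrier N) Mod tensor_kernel R M N"

definition pure_tensor ::
  "('k, 'r) ring_scheme \<Rightarrow> ('k, 'm, 'x) module_scheme \<Rightarrow> ('k, 'n, 'y) module_scheme
    \<Rightarrow> 'm \<Rightarrow> 'n \<Rightarrow> ('m, 'n) tens" where
  "pure_tensor R M N m n =
     tensor_kernel R M N #>\<^bsub>free_Abelian_group (carrier M \<times> carrier N)\<^esub> frag_of (m, n)"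

text \<open>
  The homomorphism out of the tensor product induced by a balanced biadditive map \<open>f\<close> into an abelian
  group \<open>G\<close> (written multiplicatively).  Existence and uniqueness are shown in
  \<open>tensor_group_lift_ex1\<close> below.
\<close>

definition tensor_group_lift ::
  "('k, 'r) ring_scheme \<Rightarrow> ('k, 'm, 'x) module_scheme \<Rightarrow> ('k, 'n, 'y) module_scheme
    \<Rightarrow> ('g, 'z) monoid_scheme \<Rightarrow> ('m \<Rightarrow> 'n \<Rightarrow> 'g) \<Rightarrow> ('m, 'n) tens \<Rightarrow> 'g" where
  "tensor_group_lift R M N G f =
     (THE g. g \<in> hom (tensor_group R M N) G
           \<and> g \<in> extensional (carrier (tensor_group R M N))
           \<and> (\<forall>m\<in>carrier M. \<forall>n\<in>carrier N. g (pure_tensor R M N m n) = f m n))"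

lemma tensor_relations_subset:
  assumes "module R M" and "module R N"
  shows "tensor_relations R M N \<subseteq> carrier (free_Abelian_group (carrier M \<times> carrier N))"
proof -
  interpret M: module R M by fact
  interpret N: module R N by fact
  let ?F = "free_Abelian_group (carrier M \<times> carrier N)"
  have diff: "a - b \<in> carrier ?F" if "a \<in> carrier ?F" "b \<in> carrier ?F" for a b
    using that keys_diff[of a b] by auto
  show ?thesis
    unfolding tensor_relations_def
    by (auto intro!: diff simp del: carrier_free_Abelian_group_iff)
qed

lemma tensor_kernel_normal:
  assumes "module R M" and "module R N"
  shows "tensor_kernel R M N \<lhd> free_Abelian_group (carrier M \<times> carrier N)"
proof -
  interpret F: comm_group "free_Abelian_group (carrier M \<times> carrier N)"
    by (rule abelian_free_Abelian_group)
  show ?thesis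
    unfolding tensor_kernel_def
    by (intro F.subgroup_imp_normal F.generate_is_subgroup tensor_relations_subset assms)
qed

lemma tensor_group_lift_ex1:
  assumes M: "module R M" and N: "module R N" and G: "comm_group G"
    and closed: "\<And>m n. \<lbrakk>m \<in> carrier M; n \<in> carrier N\<rbrakk> \<Longrightarrow> f m n \<in> carrier G"
    and add_l: "\<And>x y n. \<lbrakk>x \<in> carrier M; y \<in> carrier M; n \<in> carrier N\<rbrakk>
                  \<Longrightarrow> f (x \<oplus>\<^bsub>M\<^esub> y) n = f x n \<otimes>\<^bsub>G\<^esub> f y n"
    and add_r: "\<And>m x y. \<lbrakk>m \<in> carrier M; x \<in> carrier N; y \<in> carrier N\<rbrakk>
                  \<Longrightarrow> f m (x \<oplus>\<^bsub>N\<^esub> y) = f m x \<otimes>\<^bsub>G\<^esub> f m y"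
    and balanced: "\<And>r m n. \<lbrakk>r \<in> carrier R; m \<in> carrier M; n \<in> carrier N\<rbrakk>
                  \<Longrightarrow> f (r \<odot>\<^bsub>M\<^esub> m) n = f m (r \<odot>\<^bsub>N\<^esub> n)"
  shows "\<exists>!g. g \<in> hom (tensor_group R M N) G
            \<and> g \<in> extensional (carrier (tensor_group R M N))
            \<and> (\<forall>m\<in>carrier M. \<forall>n\<in>carrier N. g (pure_tensor R M N m n) = f m n)"
proof -
  interpret M: module R M by (rule M)
  interpret N: module R N by (rule N)
  interpret G: comm_group G by (rule G)
  define F where "F = free_Abelian_group (carrier M \<times> carrier N)"
  define K where "K = tensor_kernel R M N"
  interpret F: comm_group F
    unfolding F_def by (rule abelian_free_Abelian_group)
  have K: "K \<lhd> F" unfolding K_def F_def by (rule tensor_kernel_normal[OF M N])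
  interpret K: normal K F by (rule K)
  have T: "tensor_group R M N = F Mod K"
    by (simp add: tensor_group_def F_def K_def)
  have P: "pure_tensor R M N m n = K #>\<^bsub>F\<^esub> frag_of (m, n)" for m n
    by (simp add: pure_tensor_def F_def K_def)
  have gen: "frag_of (m, n) \<in> carrier F" if "m \<in> carrier M" "n \<in> carrier N" for m n
    using that by (simp add: F_def)
  obtain h where h: "h \<in> hom F G"
    and hf: "\<And>x. x \<in> carrier M \<times> carrier N \<Longrightarrow> h (frag_of x) = f (fst x) (snd x)"
    using G.free_Abelian_group_universal[of "\<lambda>x. f (fst x) (snd x)" "carrier M \<times> carrier N"]
      closed unfolding F_def by (auto simp: image_subset_iff)
  interpret h: group_hom F G h
    by (unfold_locales) (rule h)
  have minus: "h (a - b) = h a \<otimes>\<^bsub>G\<^esub> inv\<^bsub>G\<^esub> h b" if a: "a \<in> carrier F" and b: "b \<in> carrier F" for a b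
  proof -
    have i: "inv\<^bsub>F\<^esub> b = - b" using b by (simp add: F_def)
    have "a - b = a \<otimes>\<^bsub>F\<^esub> inv\<^bsub>F\<^esub> b" unfolding i by (simp add: F_def)
    then show ?thesis using a b by simp
  qed
  have diff: "a - b \<in> carrier F" if "a \<in> carrier F" "b \<in> carrier F" for a b
    using that keys_diff[of a b] by (auto simp: F_def)
  have rel: "tensor_relations R M N \<subseteq> kernel F G h"
  proof -
    have "frag_of (x \<oplus>\<^bsub>M\<^esub> y, n) - frag_of (x, n) - frag_of (y, n) \<in> kernel F G h"
      if "x \<in> carrier M" "y \<in> carrier M" "n \<in> carrier N" for x y n
      using that by (simp add: kernel_def minus diff gen hf add_l closed G.m_comm G.inv_mult
          G.m_assoc[symmetric])
    moreover have "frag_of (m, x \<oplus>\<^bsub>N\<^esub> y) - frag_of (m, x) - frag_of (m, y) \<in> kernel F G h"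
      if "m \<in> carrier M" "x \<in> carrier N" "y \<in> carrier N" for m x y
      using that by (simp add: kernel_def minus diff gen hf add_r closed G.m_comm G.inv_mult
          G.m_assoc[symmetric])
    moreover have "frag_of (r \<odot>\<^bsub>M\<^esub> m, n) - frag_of (m, r \<odot>\<^bsub>N\<^esub> n) \<in> kernel F G h"
      if "r \<in> carrier R" "m \<in> carrier M" "n \<in> carrier N" for r m n
      using that by (simp add: kernel_def minus diff gen hf balanced closed)
    ultimately show ?thesis
      unfolding tensor_relations_def by (intro Un_least subsetI) auto
  qed
  have ker: "K \<subseteq> kernel F G h"
    unfolding K_def tensor_kernel_def F_def[symmetric]
    by (rule F.generate_subgroup_incl[OF rel h.subgroup_kernel])
  define g where "g = (\<lambda>X\<in>carrier (F Mod K). h (SOME x. x \<in> carrier F \<and> X = K #>\<^bsub>F\<^esub> x))"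
  have g: "g (K #>\<^bsub>F\<^esub> x) = h x" if x: "x \<in> carrier F" for x
  proof -
    define y where "y = (SOME y. y \<in> carrier F \<and> K #>\<^bsub>F\<^esub> x = K #>\<^bsub>F\<^esub> y)"
    have y: "y \<in> carrier F" "K #>\<^bsub>F\<^esub> x = K #>\<^bsub>F\<^esub> y"
      using someI[of "\<lambda>y. y \<in> carrier F \<and> K #>\<^bsub>F\<^esub> x = K #>\<^bsub>F\<^esub> y" x] x unfolding y_def by auto
    then have "x \<in> K #>\<^bsub>F\<^esub> y"
      using F.rcos_self[OF x K.subgroup_axioms] by simp
    then obtain k where k: "k \<in> K" "x = k \<otimes>\<^bsub>F\<^esub> y" by (auto simp: r_coset_def)
    then have "h k = \<one>\<^bsub>G\<^esub>" "k \<in> carrier F" using ker by (auto simp: kernel_def)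
    then have "h x = h y" using k y by simp
    moreover have "K #>\<^bsub>F\<^esub> x \<in> carrier (F Mod K)" using x by (auto simp: carrier_FactGroup)
    ultimately show ?thesis by (simp add: g_def y_def)
  qed
  show ?thesis
  proof (rule ex1I[of _ g], intro conjI ballI)
    show "g \<in> hom (tensor_group R M N) G"
      unfolding T by (rule homI) (auto simp: carrier_FactGroup g K.rcos_sum)
    show "g \<in> extensional (carrier (tensor_group R M N))"
      by (simp add: g_def T)
    show "g (pure_tensor R M N m n) = f m n" if "m \<in> carrier M" "n \<in> carrier N" for m n
      using that by (simp add: P g gen hf)
  next
    fix g'
    assume g': "g' \<in> hom (tensor_group R M N) G
            \<and> g' \<in> extensional (carrier (tensor_group R M N))
            \<and> (\<forall>m\<in>carrier M. \<forall>n\<in>carrier N. g' (pure_tensor R M N m n) = f m n)"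
    interpret FK: group "F Mod K" by (rule K.factorgroup_is_group)
    interpret q: group_hom "F Mod K" G g'
      using g' by unfold_locales (auto simp: T)
    have eq: "g' (K #>\<^bsub>F\<^esub> x) = h x" if "x \<in> carrier F" for x
    proof -
      have 0: "g' (K #>\<^bsub>F\<^esub> 0) = h 0"
        using q.hom_one h.hom_one F.coset_join2[OF F.one_closed K.subgroup_axioms K.one_closed]
        by (simp add: F_def)
      have step: "g' (K #>\<^bsub>F\<^esub> (x - y)) = h (x - y)"
        if xy: "x \<in> carrier F" "y \<in> carrier F"
          and IH: "g' (K #>\<^bsub>F\<^esub> x) = h x" "g' (K #>\<^bsub>F\<^esub> y) = h y" for x y
      proof -
        have c: "K #>\<^bsub>F\<^esub> x \<in> carrier (F Mod K)" "K #>\<^bsub>F\<^esub> y \<in> carrier (F Mod K)"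
          using xy by (auto simp: carrier_FactGroup)
        have "inv\<^bsub>F\<^esub> y = - y"
          using xy by (simp add: F_def)
        then have "K #>\<^bsub>F\<^esub> (x - y) = K #>\<^bsub>F\<^esub> (x \<otimes>\<^bsub>F\<^esub> inv\<^bsub>F\<^esub> y)"
          by (simp add: F_def)
        also have "\<dots> = (K #>\<^bsub>F\<^esub> x) \<otimes>\<^bsub>F Mod K\<^esub> inv\<^bsub>F Mod K\<^esub> (K #>\<^bsub>F\<^esub> y)"
          using xy c by (simp add: K.inv_FactGroup K.rcos_inv K.rcos_sum)
        finally show ?thesis
          using xy c IH by (simp add: minus del: mult_FactGroup)
      qed
      show ?thesis
        by (rule free_Abelian_group_induct[of x "carrier M \<times> carrier N"])
          (use that 0 step g' in \<open>auto simp: F_def P hf\<close>)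
    qed
    show "g' = g"
    proof (rule extensionalityI[of _ "carrier (F Mod K)"])
      show "g' \<in> extensional (carrier (F Mod K))" using g' by (simp add: T)
      show "g \<in> extensional (carrier (F Mod K))" by (simp add: g_def)
    qed (auto simp: carrier_FactGroup eq g)
  qed
qed

text \<open>
  The fields \<open>mult\<close> and \<open>one\<close> of a module record are irrelevant for a mere module.
\<close>

definition tensor ::
  "('k, 'r) ring_scheme \<Rightarrow> ('k, 'm, 'x) module_scheme \<Rightarrow> ('k, 'n, 'y) module_scheme
    \<Rightarrow> ('k, ('m, 'n) tens) module" where
  "tensor R M N =
     \<lparr>carrier = carrier (tensor_group R M N),
      monoid.mult = undefined,
      one = undefined,
      ring.zero = \<one>\<^bsub>tensor_group R M N\<^esub>,
      ring.add = monoid.mult (tensor_group R M N),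
      smult = (\<lambda>r. tensor_group_lift R M N (tensor_group R M N)
                     (\<lambda>m n. pure_tensor R M N (r \<odot>\<^bsub>M\<^esub> m) n))\<rparr>"

text \<open>
  \<open>tensor_lift R M N P f\<close> is the linear map \<open>\<Sum> m \<otimes> n \<mapsto> \<Sum> f m n\<close> into the additive group of \<open>P\<close>
  induced by a bilinear map \<open>f\<close>.
\<close>

definition tensor_lift ::
  "('k, 'r) ring_scheme \<Rightarrow> ('k, 'm, 'x) module_scheme \<Rightarrow> ('k, 'n, 'y) module_scheme
    \<Rightarrow> ('p, 'z) ring_scheme \<Rightarrow> ('m \<Rightarrow> 'n \<Rightarrow> 'p) \<Rightarrow> ('m, 'n) tens \<Rightarrow> 'p" where
  "tensor_lift R M N P f = tensor_group_lift R M N (add_monoid P) f"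

definition linear_maps ::
  "('k, 'r) ring_scheme \<Rightarrow> ('k, 'm, 'x) module_scheme \<Rightarrow> ('k, 'n, 'y) module_scheme
    \<Rightarrow> ('m \<Rightarrow> 'n) set" where
  "linear_maps R M N =
     {f. f \<in> hom (add_monoid M) (add_monoid N)
       \<and> (\<forall>r\<in>carrier R. \<forall>m\<in>carrier M. f (r \<odot>\<^bsub>M\<^esub> m) = r \<odot>\<^bsub>N\<^esub> f m)}"

definition tensor_map ::
  "('k, 'r) ring_scheme \<Rightarrow> ('k, 'm, 'x) module_scheme \<Rightarrow> ('k, 'n, 'y) module_scheme
    \<Rightarrow> ('k, 'p, 'z) module_scheme \<Rightarrow> ('k, 'q, 'w) module_scheme
    \<Rightarrow> ('m \<Rightarrow> 'p) \<Rightarrow> ('n \<Rightarrow> 'q) \<Rightarrow> ('m, 'n) tens \<Rightarrow> ('p, 'q) tens" where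
  "tensor_map R M N P Q f g =
     tensor_lift R M N (tensor R P Q) (\<lambda>m n. pure_tensor R P Q (f m) (g n))"

text \<open>The canonical map from \<open>(M \<otimes> N) \<otimes> P\<close> to \<open>M \<otimes> (N \<otimes> P)\<close>.\<close>

definition tensor_assoc ::
  "('k, 'r) ring_scheme \<Rightarrow> ('k, 'm, 'x) module_scheme \<Rightarrow> ('k, 'n, 'y) module_scheme
    \<Rightarrow> ('k, 'p, 'z) module_scheme \<Rightarrow> (('m, 'n) tens, 'p) tens \<Rightarrow> ('m, ('n, 'p) tens) tens" where
  "tensor_assoc R M N P =
     tensor_lift R (tensor R M N) P (tensor R M (tensor R N P))
       (\<lambda>t p. tensor_lift R M N (tensor R M (tensor R N P))
          (\<lambda>m n. pure_tensor R M (tensor R N P) m (pure_tensor R N P n p)) t)"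

definition regular_module :: "('k, 'r) ring_scheme \<Rightarrow> ('k, 'k) module" where
  "regular_module R =
     \<lparr>carrier = carrier R, monoid.mult = monoid.mult R, one = one R,
      ring.zero = ring.zero R, ring.add = ring.add R, smult = monoid.mult R\<rparr>"


section \<open>Algebras and coalgebras\<close>

text \<open>The locale \<open>algebra\<close> of HOL-Algebra requires commutativity, so it cannot be used here.\<close>

definition unital_algebra :: "('k, 'r) ring_scheme \<Rightarrow> ('k, 'a, 'x) module_scheme \<Rightarrow> bool" where
  "unital_algebra R A \<longleftrightarrow>
     module R A \<and> ring A \<and>
     (\<forall>r\<in>carrier R. \<forall>a\<in>carrier A. \<forall>b\<in>carrier A.
        (r \<odot>\<^bsub>A\<^esub> a) \<otimes>\<^bsub>A\<^esub> b = r \<odot>\<^bsub>A\<^esub> (a \<otimes>\<^bsub>A\<^esub> b) \<and>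
        a \<otimes>\<^bsub>A\<^esub> (r \<odot>\<^bsub>A\<^esub> b) = r \<odot>\<^bsub>A\<^esub> (a \<otimes>\<^bsub>A\<^esub> b))"

definition tensor_algebra ::
  "('k, 'r) ring_scheme \<Rightarrow> ('k, 'a, 'x) module_scheme \<Rightarrow> ('k, 'b, 'y) module_scheme
    \<Rightarrow> ('k, ('a, 'b) tens) module" where
  "tensor_algebra R A B =
     (tensor R A B)
       \<lparr>monoid.mult := (\<lambda>t u.
          tensor_lift R A B (tensor R A B)
            (\<lambda>a b. tensor_lift R A B (tensor R A B)
               (\<lambda>a' b'. pure_tensor R A B (a \<otimes>\<^bsub>A\<^esub> a') (b \<otimes>\<^bsub>B\<^esub> b')) u) t),
        one := pure_tensor R A B \<one>\<^bsub>A\<^esub> \<one>\<^bsub>B\<^esub>\<rparr>"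

record ('k, 'c) coalgebra = "('k, 'c) module" +
  comult :: "'c \<Rightarrow> ('c, 'c) tens"
  counit :: "'c \<Rightarrow> 'k"

text \<open>
  Sweedler notation: \<open>sweedler R C P (\<lambda>x y. f x y) c\<close> is \<open>f(c\<^sub>1, c\<^sub>2)\<close> for a bilinear map
  \<open>f\<close> with values in \<open>P\<close>.
\<close>

definition sweedler ::
  "('k, 'r) ring_scheme \<Rightarrow> ('k, 'c, 'x) coalgebra_scheme \<Rightarrow> ('p, 'z) ring_scheme
    \<Rightarrow> ('c \<Rightarrow> 'c \<Rightarrow> 'p) \<Rightarrow> 'c \<Rightarrow> 'p" where
  "sweedler R C P f c = tensor_lift R C C P f (comult C c)"

definition counital_coalgebra :: "('k, 'r) ring_scheme \<Rightarrow> ('k, 'c, 'x) coalgebra_scheme \<Rightarrow> bool" where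
  "counital_coalgebra R C \<longleftrightarrow>
     module R C \<and>
     comult C \<in> linear_maps R C (tensor R C C) \<and>
     counit C \<in> linear_maps R C (regular_module R) \<and>
     (\<forall>c\<in>carrier C.
        tensor_assoc R C C C
          (tensor_map R C C (tensor R C C) C (comult C) (\<lambda>x. x) (comult C c))
        = tensor_map R C C C (tensor R C C) (\<lambda>x. x) (comult C) (comult C c)) \<and>
     (\<forall>c\<in>carrier C. sweedler R C C (\<lambda>x y. counit C x \<odot>\<^bsub>C\<^esub> y) c = c) \<and>
     (\<forall>c\<in>carrier C. sweedler R C C (\<lambda>x y. counit C y \<odot>\<^bsub>C\<^esub> x) c = c)"


section \<open>Weak bialgebras and weak Hopf algebras\<close>

text \<open>
  In the fourth and fifth conjuncts \<open>x \<otimes> y\<close> is the first and \<open>x' \<otimes> y'\<close> the second copy of \<open>\<Delta>(1)\<close>.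
\<close>

definition weak_bialgebra :: "('k, 'r) ring_scheme \<Rightarrow> ('k, 'h, 'x) coalgebra_scheme \<Rightarrow> bool" where
  "weak_bialgebra R H \<longleftrightarrow>
     unital_algebra R H \<and>
     counital_coalgebra R H \<and>
     (\<forall>h\<in>carrier H. \<forall>k\<in>carrier H.
        comult H (h \<otimes>\<^bsub>H\<^esub> k) = comult H h \<otimes>\<^bsub>tensor_algebra R H H\<^esub> comult H k) \<and>
     tensor_map R H H (tensor R H H) H (comult H) (\<lambda>x. x) (comult H \<one>\<^bsub>H\<^esub>)
       = sweedler R H (tensor R (tensor R H H) H)
           (\<lambda>x y. sweedler R H (tensor R (tensor R H H) H)
              (\<lambda>x' y'. pure_tensor R (tensor R H H) H (pure_tensor R H H x (y \<otimes>\<^bsub>H\<^esub> x')) y') \<one>\<^bsub>H\<^esub>) \<one>\<^bsub>H\<^esub> \<and>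
     tensor_map R H H (tensor R H H) H (comult H) (\<lambda>x. x) (comult H \<one>\<^bsub>H\<^esub>)
       = sweedler R H (tensor R (tensor R H H) H)
           (\<lambda>x y. sweedler R H (tensor R (tensor R H H) H)
              (\<lambda>x' y'. pure_tensor R (tensor R H H) H (pure_tensor R H H x (x' \<otimes>\<^bsub>H\<^esub> y)) y') \<one>\<^bsub>H\<^esub>) \<one>\<^bsub>H\<^esub> \<and>
     (\<forall>h\<in>carrier H. \<forall>k\<in>carrier H. \<forall>l\<in>carrier H.
        counit H (h \<otimes>\<^bsub>H\<^esub> k \<otimes>\<^bsub>H\<^esub> l)
          = sweedler R H R (\<lambda>k1 k2. counit H (h \<otimes>\<^bsub>H\<^esub> k1) \<otimes>\<^bsub>R\<^esub> counit H (k2 \<otimes>\<^bsub>H\<^esub> l)) k \<and>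
        counit H (h \<otimes>\<^bsub>H\<^esub> k \<otimes>\<^bsub>H\<^esub> l)
          = sweedler R H R (\<lambda>k1 k2. counit H (h \<otimes>\<^bsub>H\<^esub> k2) \<otimes>\<^bsub>R\<^esub> counit H (k1 \<otimes>\<^bsub>H\<^esub> l)) k)"

definition eps_t :: "('k, 'r) ring_scheme \<Rightarrow> ('k, 'h, 'x) coalgebra_scheme \<Rightarrow> 'h \<Rightarrow> 'h" where
  "eps_t R H h = sweedler R H H (\<lambda>x y. counit H (x \<otimes>\<^bsub>H\<^esub> h) \<odot>\<^bsub>H\<^esub> y) \<one>\<^bsub>H\<^esub>"

definition eps_s :: "('k, 'r) ring_scheme \<Rightarrow> ('k, 'h, 'x) coalgebra_scheme \<Rightarrow> 'h \<Rightarrow> 'h" where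
  "eps_s R H h = sweedler R H H (\<lambda>x y. counit H (h \<otimes>\<^bsub>H\<^esub> y) \<odot>\<^bsub>H\<^esub> x) \<one>\<^bsub>H\<^esub>"

definition weak_hopf_algebra ::
  "('k, 'r) ring_scheme \<Rightarrow> ('k, 'h, 'x) coalgebra_scheme \<Rightarrow> ('h \<Rightarrow> 'h) \<Rightarrow> bool" where
  "weak_hopf_algebra R H S \<longleftrightarrow>
     weak_bialgebra R H \<and>
     S \<in> linear_maps R H H \<and>
     (\<forall>h\<in>carrier H. sweedler R H H (\<lambda>h1 h2. S h1 \<otimes>\<^bsub>H\<^esub> h2) h = eps_s R H h) \<and>
     (\<forall>h\<in>carrier H. sweedler R H H (\<lambda>h1 h2. h1 \<otimes>\<^bsub>H\<^esub> S h2) h = eps_t R H h) \<and>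
     (\<forall>h\<in>carrier H.
        sweedler R H H (\<lambda>x h3. sweedler R H H (\<lambda>h1 h2. S h1 \<otimes>\<^bsub>H\<^esub> h2 \<otimes>\<^bsub>H\<^esub> S h3) x) h = S h)"

definition opposite :: "('k, 'h) coalgebra \<Rightarrow> ('k, 'h) coalgebra" where
  "opposite H = H\<lparr>monoid.mult := (\<lambda>x y. y \<otimes>\<^bsub>H\<^esub> x)\<rparr>"

definition tensor_bialgebra ::
  "('k, 'r) ring_scheme \<Rightarrow> ('k, 'g, 'x) coalgebra_scheme \<Rightarrow> ('k, 'h, 'y) coalgebra_scheme
    \<Rightarrow> ('k, ('g, 'h) tens) coalgebra" where
  "tensor_bialgebra R G H =
     \<lparr>carrier = carrier (tensor_algebra R G H),
      monoid.mult = monoid.mult (tensor_algebra R G H),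
      one = one (tensor_algebra R G H),
      ring.zero = ring.zero (tensor_algebra R G H),
      ring.add = ring.add (tensor_algebra R G H),
      smult = smult (tensor_algebra R G H),
      comult =
        tensor_lift R G H (tensor R (tensor R G H) (tensor R G H))
          (\<lambda>g h.
             sweedler R G (tensor R (tensor R G H) (tensor R G H))
               (\<lambda>g1 g2. sweedler R H (tensor R (tensor R G H) (tensor R G H))
                  (\<lambda>h1 h2. pure_tensor R (tensor R G H) (tensor R G H)
                     (pure_tensor R G H g1 h1) (pure_tensor R G H g2 h2)) h) g),
      counit = tensor_lift R G H R (\<lambda>g h. counit G g \<otimes>\<^bsub>R\<^esub> counit H h)\<rparr>"


section \<open>Modules, comodules and weak Doi-Hopf data\<close>

definition left_module ::
  "('k, 'r) ring_scheme \<Rightarrow> ('k, 'a, 'x) module_scheme \<Rightarrow> ('k, 'm, 'y) module_scheme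
    \<Rightarrow> ('a \<Rightarrow> 'm \<Rightarrow> 'm) \<Rightarrow> bool" where
  "left_module R A M act \<longleftrightarrow>
     module R M \<and>
     (\<forall>a\<in>carrier A. act a \<in> linear_maps R M M) \<and>
     (\<forall>m\<in>carrier M. (\<lambda>a. act a m) \<in> linear_maps R A M) \<and>
     (\<forall>a\<in>carrier A. \<forall>b\<in>carrier A. \<forall>m\<in>carrier M. act (a \<otimes>\<^bsub>A\<^esub> b) m = act a (act b m)) \<and>
     (\<forall>m\<in>carrier M. act \<one>\<^bsub>A\<^esub> m = m)"

definition right_comodule ::
  "('k, 'r) ring_scheme \<Rightarrow> ('k, 'c, 'x) coalgebra_scheme \<Rightarrow> ('k, 'm, 'y) module_scheme
    \<Rightarrow> ('m \<Rightarrow> ('m, 'c) tens) \<Rightarrow> bool" where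
  "right_comodule R C M \<rho> \<longleftrightarrow>
     module R M \<and>
     \<rho> \<in> linear_maps R M (tensor R M C) \<and>
     (\<forall>m\<in>carrier M.
        tensor_assoc R M C C (tensor_map R M C (tensor R M C) C \<rho> (\<lambda>c. c) (\<rho> m))
        = tensor_map R M C M (tensor R C C) (\<lambda>m. m) (comult C) (\<rho> m)) \<and>
     (\<forall>m\<in>carrier M. tensor_lift R M C M (\<lambda>m0 m1. counit C m1 \<odot>\<^bsub>M\<^esub> m0) (\<rho> m) = m)"

definition right_comodule_algebra ::
  "('k, 'r) ring_scheme \<Rightarrow> ('k, 'b, 'x) coalgebra_scheme \<Rightarrow> ('k, 'a, 'y) module_scheme
    \<Rightarrow> ('a \<Rightarrow> ('a, 'b) tens) \<Rightarrow> bool" where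
  "right_comodule_algebra R B A \<rho> \<longleftrightarrow>
     unital_algebra R A \<and>
     right_comodule R B A \<rho> \<and>
     (\<forall>a\<in>carrier A. \<forall>b\<in>carrier A. \<rho> a \<otimes>\<^bsub>tensor_algebra R A B\<^esub> \<rho> b = \<rho> (a \<otimes>\<^bsub>A\<^esub> b)) \<and>
     tensor_map R A B A B (\<lambda>a. a) (eps_t R B) (\<rho> \<one>\<^bsub>A\<^esub>) = \<rho> \<one>\<^bsub>A\<^esub>"

definition left_module_coalgebra ::
  "('k, 'r) ring_scheme \<Rightarrow> ('k, 'b, 'x) coalgebra_scheme \<Rightarrow> ('k, 'c, 'y) coalgebra_scheme
    \<Rightarrow> ('b \<Rightarrow> 'c \<Rightarrow> 'c) \<Rightarrow> bool" where
  "left_module_coalgebra R B C act \<longleftrightarrow>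
     counital_coalgebra R C \<and>
     left_module R B C act \<and>
     (\<forall>b\<in>carrier B. \<forall>c\<in>carrier C.
        comult C (act b c)
        = sweedler R B (tensor R C C)
            (\<lambda>b1 b2. sweedler R C (tensor R C C)
               (\<lambda>c1 c2. pure_tensor R C C (act b1 c1) (act b2 c2)) c) b) \<and>
     (\<forall>b\<in>carrier B. \<forall>b'\<in>carrier B. \<forall>c\<in>carrier C.
        counit C (act (b \<otimes>\<^bsub>B\<^esub> b') c)
        = sweedler R B R (\<lambda>b1 b2. counit B (b \<otimes>\<^bsub>B\<^esub> b2) \<otimes>\<^bsub>R\<^esub> counit C (act b1 c)) b')"

definition weak_doi_hopf_datum ::
  "('k, 'r) ring_scheme \<Rightarrow> ('k, 'b, 'x) coalgebra_scheme
    \<Rightarrow> ('k, 'a, 'y) module_scheme \<Rightarrow> ('a \<Rightarrow> ('a, 'b) tens)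
    \<Rightarrow> ('k, 'c, 'z) coalgebra_scheme \<Rightarrow> ('b \<Rightarrow> 'c \<Rightarrow> 'c) \<Rightarrow> bool" where
  "weak_doi_hopf_datum R B A \<rho>\<^sub>A C act\<^sub>C \<longleftrightarrow>
     weak_bialgebra R B \<and> right_comodule_algebra R B A \<rho>\<^sub>A \<and> left_module_coalgebra R B C act\<^sub>C"


section \<open>Categories\<close>

text \<open>\<open>Comp \<C> X Y Z g f\<close> is the composite of \<open>f : X \<rightarrow> Y\<close> and \<open>g : Y \<rightarrow> Z\<close>.\<close>

record ('o, 'f) cat =
  Ob :: "'o set"
  Hom :: "'o \<Rightarrow> 'o \<Rightarrow> 'f set"
  Ident :: "'o \<Rightarrow> 'f"
  Comp :: "'o \<Rightarrow> 'o \<Rightarrow> 'o \<Rightarrow> 'f \<Rightarrow> 'f \<Rightarrow> 'f"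

definition category :: "('o, 'f) cat \<Rightarrow> bool" where
  "category \<C> \<longleftrightarrow>
     (\<forall>X\<in>Ob \<C>. Ident \<C> X \<in> Hom \<C> X X) \<and>
     (\<forall>X\<in>Ob \<C>. \<forall>Y\<in>Ob \<C>. \<forall>Z\<in>Ob \<C>. \<forall>f\<in>Hom \<C> X Y. \<forall>g\<in>Hom \<C> Y Z.
        Comp \<C> X Y Z g f \<in> Hom \<C> X Z) \<and>
     (\<forall>X\<in>Ob \<C>. \<forall>Y\<in>Ob \<C>. \<forall>f\<in>Hom \<C> X Y.
        Comp \<C> X X Y f (Ident \<C> X) = f \<and> Comp \<C> X Y Y (Ident \<C> Y) f = f) \<and>
     (\<forall>W\<in>Ob \<C>. \<forall>X\<in>Ob \<C>. \<forall>Y\<in>Ob \<C>. \<forall>Z\<in>Ob \<C>.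
        \<forall>f\<in>Hom \<C> W X. \<forall>g\<in>Hom \<C> X Y. \<forall>h\<in>Hom \<C> Y Z.
          Comp \<C> W X Z (Comp \<C> X Y Z h g) f = Comp \<C> W Y Z h (Comp \<C> W X Y g f))"

definition is_functor ::
  "('o, 'f) cat \<Rightarrow> ('p, 'g) cat \<Rightarrow> ('o \<Rightarrow> 'p) \<Rightarrow> ('o \<Rightarrow> 'o \<Rightarrow> 'f \<Rightarrow> 'g) \<Rightarrow> bool" where
  "is_functor \<C> \<D> F\<^sub>o F\<^sub>m \<longleftrightarrow>
     (\<forall>X\<in>Ob \<C>. F\<^sub>o X \<in> Ob \<D>) \<and>
     (\<forall>X\<in>Ob \<C>. \<forall>Y\<in>Ob \<C>. \<forall>f\<in>Hom \<C> X Y. F\<^sub>m X Y f \<in> Hom \<D> (F\<^sub>o X) (F\<^sub>o Y)) \<and>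
     (\<forall>X\<in>Ob \<C>. F\<^sub>m X X (Ident \<C> X) = Ident \<D> (F\<^sub>o X)) \<and>
     (\<forall>X\<in>Ob \<C>. \<forall>Y\<in>Ob \<C>. \<forall>Z\<in>Ob \<C>. \<forall>f\<in>Hom \<C> X Y. \<forall>g\<in>Hom \<C> Y Z.
        F\<^sub>m X Z (Comp \<C> X Y Z g f)
        = Comp \<D> (F\<^sub>o X) (F\<^sub>o Y) (F\<^sub>o Z) (F\<^sub>m Y Z g) (F\<^sub>m X Y f))"

definition isomorphic_categories :: "('o, 'f) cat \<Rightarrow> ('p, 'g) cat \<Rightarrow> bool" where
  "isomorphic_categories \<C> \<D> \<longleftrightarrow>
     category \<C> \<and> category \<D> \<and>
     (\<exists>F\<^sub>o F\<^sub>m G\<^sub>o G\<^sub>m.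
        is_functor \<C> \<D> F\<^sub>o F\<^sub>m \<and> is_functor \<D> \<C> G\<^sub>o G\<^sub>m \<and>
        (\<forall>X\<in>Ob \<C>. G\<^sub>o (F\<^sub>o X) = X) \<and>
        (\<forall>X\<in>Ob \<C>. \<forall>Y\<in>Ob \<C>. \<forall>f\<in>Hom \<C> X Y. G\<^sub>m (F\<^sub>o X) (F\<^sub>o Y) (F\<^sub>m X Y f) = f) \<and>
        (\<forall>X\<in>Ob \<D>. F\<^sub>o (G\<^sub>o X) = X) \<and>
        (\<forall>X\<in>Ob \<D>. \<forall>Y\<in>Ob \<D>. \<forall>f\<in>Hom \<D> X Y. F\<^sub>m (G\<^sub>o X) (G\<^sub>o Y) (G\<^sub>m X Y f) = f))"

text \<open>
  Objects are triples of a module with carrier in \<open>'m\<close>, a left action and a right coaction.  The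
  type \<open>'m\<close> plays the role of the universe of sets.
\<close>

type_synonym ('k, 'a, 'c, 'm) modcomod =
  "('k, 'm) module \<times> ('a \<Rightarrow> 'm \<Rightarrow> 'm) \<times> ('m \<Rightarrow> ('m, 'c) tens)"

text \<open>
  The operations of an object have the value \<open>undefined\<close> outside their domains, so that objects are
  equal as soon as they agree as modules with action and coaction.
\<close>

definition modcomod ::
  "('k, 'r) ring_scheme \<Rightarrow> ('k, 'a, 'x) module_scheme \<Rightarrow> ('k, 'c, 'y) coalgebra_scheme
    \<Rightarrow> ('k, 'a, 'c, 'm) modcomod set" where
  "modcomod R A C =
     {(M, act, \<rho>).
        left_module R A M act \<and> right_comodule R C M \<rho> \<and>
        monoid.mult M = undefined \<and> one M = undefined \<and>
        (\<lambda>(x, y). x \<oplus>\<^bsub>M\<^esub> y) \<in> extensional (carrier M \<times> carrier M) \<and>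
        (\<lambda>(r, x). r \<odot>\<^bsub>M\<^esub> x) \<in> extensional (carrier R \<times> carrier M) \<and>
        (\<lambda>(a, x). act a x) \<in> extensional (carrier A \<times> carrier M) \<and>
        \<rho> \<in> extensional (carrier M)}"

definition modcomod_hom ::
  "('k, 'r) ring_scheme \<Rightarrow> ('k, 'a, 'x) module_scheme \<Rightarrow> ('k, 'c, 'y) coalgebra_scheme
    \<Rightarrow> ('k, 'a, 'c, 'm) modcomod \<Rightarrow> ('k, 'a, 'c, 'm) modcomod \<Rightarrow> ('m \<Rightarrow> 'm) set" where
  "modcomod_hom R A C = (\<lambda>(M, act\<^sub>M, \<rho>\<^sub>M) (N, act\<^sub>N, \<rho>\<^sub>N).
     {f. f \<in> linear_maps R M N \<and> f \<in> extensional (carrier M) \<and>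
         (\<forall>a\<in>carrier A. \<forall>m\<in>carrier M. f (act\<^sub>M a m) = act\<^sub>N a (f m)) \<and>
         (\<forall>m\<in>carrier M. \<rho>\<^sub>N (f m) = tensor_map R M C N C f (\<lambda>c. c) (\<rho>\<^sub>M m))})"

definition modcomod_category ::
  "('k, 'r) ring_scheme \<Rightarrow> ('k, 'a, 'x) module_scheme \<Rightarrow> ('k, 'c, 'y) coalgebra_scheme
    \<Rightarrow> ('k, 'a, 'c, 'm) modcomod set \<Rightarrow> (('k, 'a, 'c, 'm) modcomod, 'm \<Rightarrow> 'm) cat" where
  "modcomod_category R A C \<O> =
     \<lparr>Ob = \<O>,
      Hom = modcomod_hom R A C,
      Ident = (\<lambda>(M, _, _). \<lambda>m\<in>carrier M. m),
      Comp = (\<lambda>(M, _, _) _ _ g f. compose (carrier M) g f)\<rparr>"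

definition doi_hopf_modules ::
  "('k, 'r) ring_scheme \<Rightarrow> ('k, 'b, 'x) coalgebra_scheme
    \<Rightarrow> ('k, 'a, 'y) module_scheme \<Rightarrow> ('a \<Rightarrow> ('a, 'b) tens)
    \<Rightarrow> ('k, 'c, 'z) coalgebra_scheme \<Rightarrow> ('b \<Rightarrow> 'c \<Rightarrow> 'c)
    \<Rightarrow> ('k, 'a, 'c, 'm) modcomod set" where
  "doi_hopf_modules R B A \<rho>\<^sub>A C act\<^sub>C =
     {(M, act, \<rho>) \<in> modcomod R A C.
        \<forall>a\<in>carrier A. \<forall>m\<in>carrier M.
          \<rho> (act a m)
          = tensor_lift R A B (tensor R M C)
              (\<lambda>a0 a1. tensor_lift R M C (tensor R M C)
                 (\<lambda>m0 m1. pure_tensor R M C (act a0 m0) (act\<^sub>C a1 m1)) (\<rho> m)) (\<rho>\<^sub>A a)}"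

definition doi_hopf_category ::
  "('k, 'r) ring_scheme \<Rightarrow> ('k, 'b, 'x) coalgebra_scheme
    \<Rightarrow> ('k, 'a, 'y) module_scheme \<Rightarrow> ('a \<Rightarrow> ('a, 'b) tens)
    \<Rightarrow> ('k, 'c, 'z) coalgebra_scheme \<Rightarrow> ('b \<Rightarrow> 'c \<Rightarrow> 'c)
    \<Rightarrow> (('k, 'a, 'c, 'm) modcomod, 'm \<Rightarrow> 'm) cat" where
  "doi_hopf_category R B A \<rho>\<^sub>A C act\<^sub>C =
     modcomod_category R A C (doi_hopf_modules R B A \<rho>\<^sub>A C act\<^sub>C)"


section \<open>Yetter-Drinfeld modules\<close>

text \<open>The submodule \<open>\<Delta>(1)(M \<otimes> H)\<close> of \<open>M \<otimes> H\<close>.\<close>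

definition tensor_t ::
  "('k, 'r) ring_scheme \<Rightarrow> ('k, 'h, 'x) coalgebra_scheme \<Rightarrow> ('k, 'm, 'y) module_scheme
    \<Rightarrow> ('h \<Rightarrow> 'm \<Rightarrow> 'm) \<Rightarrow> ('m, 'h) tens set" where
  "tensor_t R H M act =
     (\<lambda>t. sweedler R H (tensor R M H)
            (\<lambda>x y. tensor_lift R M H (tensor R M H)
               (\<lambda>m h. pure_tensor R M H (act x m) (y \<otimes>\<^bsub>H\<^esub> h)) t) \<one>\<^bsub>H\<^esub>)
     ` carrier (tensor R M H)"

definition yd_modules ::
  "('k, 'r) ring_scheme \<Rightarrow> ('k, 'h, 'x) coalgebra_scheme \<Rightarrow> ('k, 'h, 'h, 'm) modcomod set" where
  "yd_modules R H =
     {(M, act, \<rho>) \<in> modcomod R H H.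
        (\<forall>m\<in>carrier M. \<rho> m \<in> tensor_t R H M act) \<and>
        (\<forall>h\<in>carrier H. \<forall>m\<in>carrier M.
           sweedler R H (tensor R M H)
             (\<lambda>h1 h2. tensor_lift R M H (tensor R M H)
                (\<lambda>m0 m1. pure_tensor R M H (act h1 m0) (h2 \<otimes>\<^bsub>H\<^esub> m1)) (\<rho> m)) h
           = sweedler R H (tensor R M H)
             (\<lambda>h1 h2. tensor_lift R M H (tensor R M H)
                (\<lambda>n0 n1. pure_tensor R M H n0 (n1 \<otimes>\<^bsub>H\<^esub> h1)) (\<rho> (act h2 m))) h)}"

definition yd_category ::
  "('k, 'r) ring_scheme \<Rightarrow> ('k, 'h, 'x) coalgebra_scheme
    \<Rightarrow> (('k, 'h, 'h, 'm) modcomod, 'm \<Rightarrow> 'm) cat" where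
  "yd_category R H = modcomod_category R H H (yd_modules R H)"


section \<open>The datum attached to a weak Hopf algebra with bijective antipode\<close>

definition antipode_inverse :: "('k, 'h, 'x) coalgebra_scheme \<Rightarrow> ('h \<Rightarrow> 'h) \<Rightarrow> 'h \<Rightarrow> 'h" where
  "antipode_inverse H S = inv_into (carrier H) S"

text \<open>\<open>h \<mapsto> h\<^sub>2 \<otimes> (S\<^sup>-\<^sup>1(h\<^sub>1) \<otimes> h\<^sub>3)\<close>, where \<open>h\<^sub>1 \<otimes> h\<^sub>2 \<otimes> h\<^sub>3\<close> is read as \<open>(\<Delta> \<otimes> H)(\<Delta>(h))\<close>.\<close>

definition yd_coaction ::
  "('k, 'r) ring_scheme \<Rightarrow> ('k, 'h) coalgebra \<Rightarrow> ('h \<Rightarrow> 'h)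
    \<Rightarrow> 'h \<Rightarrow> ('h, ('h, 'h) tens) tens" where
  "yd_coaction R H S =
     sweedler R H (tensor R H (tensor_bialgebra R (opposite H) H))
       (\<lambda>x h3. sweedler R H (tensor R H (tensor_bialgebra R (opposite H) H))
          (\<lambda>h1 h2. pure_tensor R H (tensor_bialgebra R (opposite H) H) h2
             (pure_tensor R (opposite H) H (antipode_inverse H S h1) h3)) x)"

text \<open>\<open>(k \<otimes> h) \<triangleright> c = h c k\<close>\<close>

definition yd_action ::
  "('k, 'r) ring_scheme \<Rightarrow> ('k, 'h) coalgebra \<Rightarrow> ('h, 'h) tens \<Rightarrow> 'h \<Rightarrow> 'h" where
  "yd_action R H t c =
     tensor_lift R (opposite H) H H (\<lambda>k h. h \<otimes>\<^bsub>H\<^esub> c \<otimes>\<^bsub>H\<^esub> k) t"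

end

(*
  A linear identity in Sweedler notation is checked after applying an arbitrary multilinear map to it,
  so that each tensor becomes a finite sum over a decomposition into pure tensors.  In this form the
  classical arguments show that the antipode S reverses products and coproducts, which makes
  h \<mapsto> h_2 \<otimes> S^-1(h_1) \<otimes> h_3 a comodule algebra structure.  For a module M with a coaction, the
  Doi-Hopf condition reads rho(hm) = h_2 m_0 \<otimes> h_3 m_1 S^-1(h_1).  Taking h = 1 gives
  rho(m) \<in> \<Delta>(1)(M \<otimes> H), and S^-1(h_2) h_1 = S^-1(eps_s(h)) together with
  eps_s(h_1) \<otimes> h_2 = 1_1 \<otimes> h 1_2 gives the Yetter-Drinfeld condition.  Conversely
  h_2 S^-1(h_1) = S^-1(eps_t(h)) and S^-1(eps_t(h_1)) \<otimes> h_2 = 1_1 \<otimes> 1_2 h turn the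
  Doi-Hopf expression for rho(hm) into \<Delta>(1) rho(hm), which is rho(hm).  So the two categories
  are equal.
*)

theory Submission
  imports Defs
begin

section \<open>Linear and bilinear maps\<close>

text \<open>As \<Delta>(1) need not be 1 \<otimes> 1, the antipode is not a convolution inverse of
  the identity: the two convolution products are \<open>eps_s\<close> and \<open>eps_t\<close>.
  Uniqueness of inverses therefore cannot show that S reverses products and coproducts. Its place is
  taken by S = eps_s * S = S * eps_t (convolution), by formulas for \<Delta>(eps_s(h)) and
  \<Delta>(eps_t(h)), and by the fact that values of \<open>eps_s\<close> and \<open>eps_t\<close>
  commute. This is why a block of identities about \<Delta>(1) precedes the antipode. The two
  reversals fix the shape of the datum: S^-1 reverses products, so its values must lie in H^op for
  the coaction to be multiplicative, and it reverses coproducts, which gives coassociativity. The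
  categories coincide because both are full subcategories of the modules with a coaction: morphisms
  and composition never mention a compatibility condition. So only object sets are compared, and the
  functors are identities. H^op \<otimes> H and H \<otimes> H are different records on one module;
  statements are moved between them by comparing only the module fields.\<close>

definition lin ::
  "('k, 'r) ring_scheme \<Rightarrow> ('k, 'm, 'x) module_scheme \<Rightarrow> ('k, 'n, 'y) module_scheme
    \<Rightarrow> ('m \<Rightarrow> 'n) \<Rightarrow> bool" where
  "lin R M N f \<longleftrightarrow> module R M \<and> module R N \<and> f \<in> linear_maps R M N"

definition bil ::
  "('k, 'r) ring_scheme \<Rightarrow> ('k, 'm, 'x) module_scheme \<Rightarrow> ('k, 'n, 'y) module_scheme
    \<Rightarrow> ('k, 'p, 'z) module_scheme \<Rightarrow> ('m \<Rightarrow> 'n \<Rightarrow> 'p) \<Rightarrow> bool" where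
  "bil R M N P f \<longleftrightarrow> module R M \<and> module R N \<and> (\<forall>n\<in>carrier N. lin R M P (\<lambda>m. f m n)) \<and> (\<forall>m\<in>carrier M. lin R N P (f m))"

lemma lin_iff:
  "lin R M N f \<longleftrightarrow> module R M \<and> module R N \<and> (\<forall>x\<in>carrier M. f x \<in> carrier N)
     \<and> (\<forall>x\<in>carrier M. \<forall>y\<in>carrier M. f (x \<oplus>\<^bsub>M\<^esub> y) = f x \<oplus>\<^bsub>N\<^esub> f y)
     \<and> (\<forall>r\<in>carrier R. \<forall>x\<in>carrier M. f (r \<odot>\<^bsub>M\<^esub> x) = r \<odot>\<^bsub>N\<^esub> f x)"
  by (auto simp: lin_def linear_maps_def hom_def)

lemma linD:
  assumes "lin R M N f"
  shows lin_module1: "module R M" and lin_module2: "module R N"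
    and lin_closed: "x \<in> carrier M \<Longrightarrow> f x \<in> carrier N"
    and lin_add: "x \<in> carrier M \<Longrightarrow> y \<in> carrier M \<Longrightarrow> f (x \<oplus>\<^bsub>M\<^esub> y) = f x \<oplus>\<^bsub>N\<^esub> f y"
    and lin_smult: "r \<in> carrier R \<Longrightarrow> x \<in> carrier M \<Longrightarrow> f (r \<odot>\<^bsub>M\<^esub> x) = r \<odot>\<^bsub>N\<^esub> f x"
  using assms by (auto simp: lin_iff)

lemma lin_zero:
  assumes "lin R M N f"
  shows "f \<zero>\<^bsub>M\<^esub> = \<zero>\<^bsub>N\<^esub>"
proof -
  interpret M: module R M using assms by (rule lin_module1)
  interpret N: module R N using assms by (rule lin_module2)
  have "f \<zero>\<^bsub>M\<^esub> \<oplus>\<^bsub>N\<^esub> f \<zero>\<^bsub>M\<^esub> = f \<zero>\<^bsub>M\<^esub>"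
    using lin_add[OF assms, of "\<zero>\<^bsub>M\<^esub>" "\<zero>\<^bsub>M\<^esub>"] by simp
  then show ?thesis
    using lin_closed[OF assms, of "\<zero>\<^bsub>M\<^esub>"] by (simp add: N.add.l_cancel_one)
qed

text \<open>Sums and scalar multiples in a module stay in its carrier, so the values there decide
  linearity; if \<open>M\<close> is not a module, both sides are false.\<close>

lemma lin_cong:
  assumes "\<And>x. x \<in> carrier M \<Longrightarrow> f x = g x"
  shows "lin R M N f \<longleftrightarrow> lin R M N g"
proof (cases "module R M")
  case True
  then interpret module R M .
  show ?thesis using assms by (auto simp: lin_iff)
qed (simp add: lin_def)

lemma bilI:
  assumes "module R M" "module R N"
    and "\<And>n. n \<in> carrier N \<Longrightarrow> lin R M P (\<lambda>m. f m n)"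
    and "\<And>m. m \<in> carrier M \<Longrightarrow> lin R N P (\<lambda>n. f m n)"
  shows "bil R M N P (\<lambda>m n. f m n)"
  using assms by (simp add: bil_def)

lemma bilD:
  assumes "bil R M N P f"
  shows bil_module1: "module R M" and bil_module2: "module R N"
    and bil_lin1: "n \<in> carrier N \<Longrightarrow> lin R M P (\<lambda>m. f m n)"
    and bil_lin2: "m \<in> carrier M \<Longrightarrow> lin R N P (f m)"
    and bil_closed: "m \<in> carrier M \<Longrightarrow> n \<in> carrier N \<Longrightarrow> f m n \<in> carrier P"
  using assms by (auto simp: bil_def dest: lin_closed)

lemma module_zero_closed: "module R M \<Longrightarrow> \<zero>\<^bsub>M\<^esub> \<in> carrier M"
  by (simp add: module_def abelian_group_def abelian_monoid.zero_closed)

text \<open>The carrier of \<open>N\<close> contains zero, and the partial map at zero is a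
  \<open>lin\<close> fact, which carries the module property of its codomain.\<close>

lemma bil_module3:
  assumes "bil R M N P f"
  shows "module R P"
  using assms by (meson bil_module2 bil_lin1 lin_module2 module_zero_closed)

lemma bil_cong:
  assumes "\<And>m n. m \<in> carrier M \<Longrightarrow> n \<in> carrier N \<Longrightarrow> f m n = g m n"
  shows "bil R M N P f \<longleftrightarrow> bil R M N P g"
  unfolding bil_def using assms
  by (intro arg_cong2[of _ _ _ _ "(\<and>)"] ball_cong lin_cong refl) auto

text \<open>\<open>module\<close> reads only these four fields of the record, so an algebra, its
  opposite and a bialgebra on the same group are interchangeable as modules.\<close>

lemma module_eqI:
  assumes "carrier M' = carrier M" "ring.add M' = ring.add M" "ring.zero M' = ring.zero M" "smult M' = smult M"
  shows "module R M' = module R M"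
  unfolding module_def module_axioms_def abelian_group_def abelian_group_axioms_def
    abelian_monoid_def comm_group_def comm_monoid_def monoid_def comm_monoid_axioms_def
    group_def group_axioms_def Units_def by (simp add: assms)

section \<open>Tensor products\<close>

context
  fixes R :: "('k, 'r) ring_scheme" and M :: "('k, 'm, 'x) module_scheme"
    and N :: "('k, 'n, 'y) module_scheme"
  assumes M: "module R M" and N: "module R N"
begin

interpretation M: module R M by (rule M)
interpretation N: module R N by (rule N)
interpretation F: comm_group "free_Abelian_group (carrier M \<times> carrier N)"
  by (rule abelian_free_Abelian_group)
interpretation K: normal "tensor_kernel R M N" "free_Abelian_group (carrier M \<times> carrier N)"
  by (rule tensor_kernel_normal[OF M N])

lemma comm_group_tensor_group: "comm_group (tensor_group R M N)"
  unfolding tensor_group_def by (rule F.abelian_FactGroup) (rule K.subgroup_axioms)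

lemma pure_closed_group:
  "m \<in> carrier M \<Longrightarrow> n \<in> carrier N \<Longrightarrow> pure_tensor R M N m n \<in> carrier (tensor_group R M N)"
  by (simp add: tensor_group_def carrier_FactGroup pure_tensor_def)

lemma kernel_coset_eq:
  assumes "x \<in> carrier (free_Abelian_group (carrier M \<times> carrier N))"
    "y \<in> carrier (free_Abelian_group (carrier M \<times> carrier N))" "x - y \<in> tensor_kernel R M N"
  shows "tensor_kernel R M N #>\<^bsub>free_Abelian_group (carrier M \<times> carrier N)\<^esub> x
       = tensor_kernel R M N #>\<^bsub>free_Abelian_group (carrier M \<times> carrier N)\<^esub> y"
proof (rule F.repr_independence[OF _ assms(2) K.subgroup_axioms, symmetric])
  show "x \<in> tensor_kernel R M N #>\<^bsub>free_Abelian_group (carrier M \<times> carrier N)\<^esub> y"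
    using assms by (auto simp: r_coset_def intro!: bexI[of _ "x - y"])
qed

lemma tensor_relations_kernel: "x \<in> tensor_relations R M N \<Longrightarrow> x \<in> tensor_kernel R M N"
  unfolding tensor_kernel_def by (rule generate.incl)

lemma pure_add_left_group:
  assumes "x \<in> carrier M" "y \<in> carrier M" "n \<in> carrier N"
  shows "pure_tensor R M N (x \<oplus>\<^bsub>M\<^esub> y) n
    = pure_tensor R M N x n \<otimes>\<^bsub>tensor_group R M N\<^esub> pure_tensor R M N y n"
proof -
  have "frag_of (x \<oplus>\<^bsub>M\<^esub> y, n) - (frag_of (x, n) + frag_of (y, n)) \<in> tensor_kernel R M N"
    by (rule tensor_relations_kernel) (use assms in \<open>auto simp: tensor_relations_def algebra_simps\<close>)
  moreover have "frag_of (x, n) + frag_of (y, n) \<in> carrier (free_Abelian_group (carrier M \<times> carrier N))"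
    using assms F.m_closed[of "frag_of (x, n)" "frag_of (y, n)"] by (simp del: carrier_free_Abelian_group_iff)
  ultimately show ?thesis
    using assms K.rcos_sum[of "frag_of (x, n)" "frag_of (y, n)"]
    by (simp add: pure_tensor_def tensor_group_def kernel_coset_eq del: carrier_free_Abelian_group_iff)
qed

lemma pure_add_right_group:
  assumes "m \<in> carrier M" "x \<in> carrier N" "y \<in> carrier N"
  shows "pure_tensor R M N m (x \<oplus>\<^bsub>N\<^esub> y)
    = pure_tensor R M N m x \<otimes>\<^bsub>tensor_group R M N\<^esub> pure_tensor R M N m y"
proof -
  have "frag_of (m, x \<oplus>\<^bsub>N\<^esub> y) - (frag_of (m, x) + frag_of (m, y)) \<in> tensor_kernel R M N"
    by (rule tensor_relations_kernel) (use assms in \<open>auto simp: tensor_relations_def algebra_simps\<close>)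
  moreover have "frag_of (m, x) + frag_of (m, y) \<in> carrier (free_Abelian_group (carrier M \<times> carrier N))"
    using assms F.m_closed[of "frag_of (m, x)" "frag_of (m, y)"] by (simp del: carrier_free_Abelian_group_iff)
  ultimately show ?thesis
    using assms K.rcos_sum[of "frag_of (m, x)" "frag_of (m, y)"]
    by (simp add: pure_tensor_def tensor_group_def kernel_coset_eq del: carrier_free_Abelian_group_iff)
qed

lemma pure_balanced:
  assumes "r \<in> carrier R" "m \<in> carrier M" "n \<in> carrier N"
  shows "pure_tensor R M N (r \<odot>\<^bsub>M\<^esub> m) n = pure_tensor R M N m (r \<odot>\<^bsub>N\<^esub> n)"
  unfolding pure_tensor_def
  by (rule kernel_coset_eq)
    (use assms in \<open>auto intro!: tensor_relations_kernel simp: tensor_relations_def\<close>)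

text \<open>No case for negatives is needed: the inverse of m \<otimes> n is the pure tensor (-m)
  \<otimes> n, so sums of pure tensors exhaust the quotient.\<close>

lemma tensor_group_induct [consumes 1, case_names zero pure mult]:
  assumes t: "t \<in> carrier (tensor_group R M N)"
    and zero: "P \<one>\<^bsub>tensor_group R M N\<^esub>"
    and pure: "\<And>m n. m \<in> carrier M \<Longrightarrow> n \<in> carrier N \<Longrightarrow> P (pure_tensor R M N m n)"
    and mult: "\<And>x y. x \<in> carrier (tensor_group R M N) \<Longrightarrow> y \<in> carrier (tensor_group R M N)
      \<Longrightarrow> P x \<Longrightarrow> P y \<Longrightarrow> P (x \<otimes>\<^bsub>tensor_group R M N\<^esub> y)"
  shows "P t"
proof -
  interpret T: comm_group "tensor_group R M N" by (rule comm_group_tensor_group)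
  let ?q = "\<lambda>x. tensor_kernel R M N #>\<^bsub>free_Abelian_group (carrier M \<times> carrier N)\<^esub> x"
  have closed: "?q x \<in> carrier (tensor_group R M N)"
    if "x \<in> carrier (free_Abelian_group (carrier M \<times> carrier N))" for x
    using that by (auto simp: tensor_group_def carrier_FactGroup)
  have diff: "?q (x - y) = ?q x \<otimes>\<^bsub>tensor_group R M N\<^esub> inv\<^bsub>tensor_group R M N\<^esub> ?q y"
    if xy: "x \<in> carrier (free_Abelian_group (carrier M \<times> carrier N))"
      "y \<in> carrier (free_Abelian_group (carrier M \<times> carrier N))" for x y
  proof -
    have "?q (x - y) = ?q (x \<otimes>\<^bsub>free_Abelian_group (carrier M \<times> carrier N)\<^esub>
        inv\<^bsub>free_Abelian_group (carrier M \<times> carrier N)\<^esub> y)"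
      using xy by simp
    also have "\<dots> = ?q x \<otimes>\<^bsub>tensor_group R M N\<^esub> inv\<^bsub>tensor_group R M N\<^esub> ?q y"
      using xy closed[OF xy(2)] F.inv_closed[OF xy(2)]
      by (simp add: tensor_group_def K.inv_FactGroup K.rcos_inv K.rcos_sum
          del: carrier_free_Abelian_group_iff inv_free_Abelian_group)
    finally show ?thesis .
  qed
  have inv_pure: "inv\<^bsub>tensor_group R M N\<^esub> pure_tensor R M N m n = pure_tensor R M N (\<ominus>\<^bsub>M\<^esub> m) n"
    if "m \<in> carrier M" "n \<in> carrier N" for m n
  proof (rule T.inv_equality)
    have "pure_tensor R M N \<zero>\<^bsub>M\<^esub> n \<otimes>\<^bsub>tensor_group R M N\<^esub> pure_tensor R M N \<zero>\<^bsub>M\<^esub> n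
      = pure_tensor R M N \<zero>\<^bsub>M\<^esub> n"
      using pure_add_left_group[of "\<zero>\<^bsub>M\<^esub>" "\<zero>\<^bsub>M\<^esub>" n] that by simp
    then have "pure_tensor R M N \<zero>\<^bsub>M\<^esub> n = \<one>\<^bsub>tensor_group R M N\<^esub>"
      using that pure_closed_group[of "\<zero>\<^bsub>M\<^esub>" n] by (simp add: T.l_cancel_one)
    then show "pure_tensor R M N (\<ominus>\<^bsub>M\<^esub> m) n \<otimes>\<^bsub>tensor_group R M N\<^esub> pure_tensor R M N m n
      = \<one>\<^bsub>tensor_group R M N\<^esub>"
      using pure_add_left_group[of "\<ominus>\<^bsub>M\<^esub> m" m n] that by (simp add: M.l_neg)
  qed (use that pure_closed_group in auto)
  \<comment> \<open>The induction on the free abelian group proceeds by differences, so the claim is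
    strengthened to hold at a coset and at its inverse.\<close>
  have "P (?q x) \<and> P (inv\<^bsub>tensor_group R M N\<^esub> ?q x)"
    if "x \<in> carrier (free_Abelian_group (carrier M \<times> carrier N))" for x
  proof (rule free_Abelian_group_induct[of x "carrier M \<times> carrier N"])
    have "?q 0 = \<one>\<^bsub>tensor_group R M N\<^esub>"
      using F.coset_join2[OF F.one_closed K.subgroup_axioms K.one_closed] by (simp add: tensor_group_def)
    then show "P (?q 0) \<and> P (inv\<^bsub>tensor_group R M N\<^esub> ?q 0)"
      using zero by simp
  next
    fix x y :: "('m \<times> 'n) \<Rightarrow>\<^sub>0 int"
    assume "Poly_Mapping.keys x \<subseteq> carrier M \<times> carrier N"
      and "Poly_Mapping.keys y \<subseteq> carrier M \<times> carrier N"
      and "P (?q x) \<and> P (inv\<^bsub>tensor_group R M N\<^esub> ?q x)" and "P (?q y) \<and> P (inv\<^bsub>tensor_group R M N\<^esub> ?q y)"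
    then show "P (?q (x - y)) \<and> P (inv\<^bsub>tensor_group R M N\<^esub> ?q (x - y))"
      using closed[of x] closed[of y]
      by (simp add: diff T.inv_mult mult)
  next
    fix a assume a: "a \<in> carrier M \<times> carrier N"
    obtain m n where "a = (m, n)" by (cases a)
    then show "P (?q (frag_of a)) \<and> P (inv\<^bsub>tensor_group R M N\<^esub> ?q (frag_of a))"
      using a pure inv_pure[of m n] by (simp add: pure_tensor_def[symmetric])
  qed (use that in simp)
  then show ?thesis
    using t by (auto simp: tensor_group_def carrier_FactGroup)
qed

lemma tensor_simps:
  shows "carrier (tensor R M N) = carrier (tensor_group R M N)"
    and "x \<oplus>\<^bsub>tensor R M N\<^esub> y = x \<otimes>\<^bsub>tensor_group R M N\<^esub> y"
    and "\<zero>\<^bsub>tensor R M N\<^esub> = \<one>\<^bsub>tensor_group R M N\<^esub>"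
  by (simp_all add: tensor_def)

text \<open>The scalar action on \<open>tensor\<close> is a definite description; it becomes usable
  through the universal property, applied to the balanced map sending m and n to rm \<otimes>
  n.\<close>

lemma tensor_smult_lift:
  assumes "r \<in> carrier R"
  shows "(\<lambda>t. r \<odot>\<^bsub>tensor R M N\<^esub> t) \<in> hom (tensor_group R M N) (tensor_group R M N)
     \<and> (\<forall>m\<in>carrier M. \<forall>n\<in>carrier N.
          r \<odot>\<^bsub>tensor R M N\<^esub> pure_tensor R M N m n = pure_tensor R M N (r \<odot>\<^bsub>M\<^esub> m) n)"
proof -
  have "\<exists>!g. g \<in> hom (tensor_group R M N) (tensor_group R M N)
      \<and> g \<in> extensional (carrier (tensor_group R M N))
      \<and> (\<forall>m\<in>carrier M. \<forall>n\<in>carrier N. g (pure_tensor R M N m n) = pure_tensor R M N (r \<odot>\<^bsub>M\<^esub> m) n)"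
    using assms comm_group_tensor_group
    by (intro tensor_group_lift_ex1 M N)
      (auto simp: pure_closed_group pure_add_left_group pure_add_right_group
        M.smult_r_distr N.smult_r_distr pure_balanced[symmetric]
        M.smult_assoc1[symmetric] M.m_comm)
  from theI'[OF this] show ?thesis
    by (simp add: tensor_def tensor_group_lift_def)
qed

text \<open>Each scalar acts additively, so every axiom about scalars reduces to pure tensors, where
  it is inherited from \<open>M\<close>.\<close>

lemma module_tensor: "module R (tensor R M N)"
proof -
  interpret T: comm_group "tensor_group R M N" by (rule comm_group_tensor_group)
  have ab: "abelian_group (tensor R M N)"
    using T.m_assoc T.m_comm T.l_inv_ex
    by (intro abelian_groupI) (simp_all add: tensor_simps)
  note hom = tensor_smult_lift[THEN conjunct1]
    and sp = tensor_smult_lift[THEN conjunct2, rule_format]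
  have cl: "r \<odot>\<^bsub>tensor R M N\<^esub> t \<in> carrier (tensor_group R M N)"
    if "r \<in> carrier R" "t \<in> carrier (tensor_group R M N)" for r t
    using hom_in_carrier[OF hom[OF that(1)] that(2)] .
  have ad: "r \<odot>\<^bsub>tensor R M N\<^esub> (t \<otimes>\<^bsub>tensor_group R M N\<^esub> u)
      = (r \<odot>\<^bsub>tensor R M N\<^esub> t) \<otimes>\<^bsub>tensor_group R M N\<^esub> (r \<odot>\<^bsub>tensor R M N\<^esub> u)"
    if "r \<in> carrier R" "t \<in> carrier (tensor_group R M N)" "u \<in> carrier (tensor_group R M N)" for r t u
    using hom_mult[OF hom[OF that(1)]] that by simp
  have on: "r \<odot>\<^bsub>tensor R M N\<^esub> \<one>\<^bsub>tensor_group R M N\<^esub> = \<one>\<^bsub>tensor_group R M N\<^esub>" if "r \<in> carrier R" for r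
    using hom_one[OF hom[OF that]] by simp
  show ?thesis
  proof (rule moduleI[OF M.R.is_cring ab], unfold tensor_simps)
    show "r \<odot>\<^bsub>tensor R M N\<^esub> x \<in> carrier (tensor_group R M N)"
      if "r \<in> carrier R" "x \<in> carrier (tensor_group R M N)" for r x
      using that by (rule cl)
    show "r \<odot>\<^bsub>tensor R M N\<^esub> (x \<otimes>\<^bsub>tensor_group R M N\<^esub> y)
      = (r \<odot>\<^bsub>tensor R M N\<^esub> x) \<otimes>\<^bsub>tensor_group R M N\<^esub> (r \<odot>\<^bsub>tensor R M N\<^esub> y)"
      if "r \<in> carrier R" "x \<in> carrier (tensor_group R M N)" "y \<in> carrier (tensor_group R M N)" for r x y
      using that by (rule ad)
    show "(a \<oplus>\<^bsub>R\<^esub> b) \<odot>\<^bsub>tensor R M N\<^esub> x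
      = (a \<odot>\<^bsub>tensor R M N\<^esub> x) \<otimes>\<^bsub>tensor_group R M N\<^esub> (b \<odot>\<^bsub>tensor R M N\<^esub> x)"
      if "a \<in> carrier R" "b \<in> carrier R" "x \<in> carrier (tensor_group R M N)" for a b x
      using that(3)
    proof (induction rule: tensor_group_induct)
      case (mult x y)
      then show ?case using that by (simp add: ad cl T.m_ac)
    qed (use that in \<open>simp_all add: on sp M.smult_l_distr pure_add_left_group\<close>)
    show "(a \<otimes>\<^bsub>R\<^esub> b) \<odot>\<^bsub>tensor R M N\<^esub> x = a \<odot>\<^bsub>tensor R M N\<^esub> (b \<odot>\<^bsub>tensor R M N\<^esub> x)"
      if "a \<in> carrier R" "b \<in> carrier R" "x \<in> carrier (tensor_group R M N)" for a b x
      using that(3)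
    proof (induction rule: tensor_group_induct)
      case (mult x y)
      then show ?case using that by (simp add: ad cl)
    qed (use that in \<open>simp_all add: on sp M.smult_assoc1\<close>)
    show "\<one>\<^bsub>R\<^esub> \<odot>\<^bsub>tensor R M N\<^esub> x = x" if "x \<in> carrier (tensor_group R M N)" for x
      using that by (induction rule: tensor_group_induct) (simp_all add: on sp ad)
  qed
qed

lemma bil_pure_tensor: "bil R M N (tensor R M N) (pure_tensor R M N)"
  using M N module_tensor tensor_smult_lift[THEN conjunct2]
  by (auto simp: bil_def lin_iff tensor_simps pure_closed_group
      pure_add_left_group pure_add_right_group pure_balanced[symmetric])

lemma tensor_induct [consumes 1, case_names zero pure add]:
  assumes "t \<in> carrier (tensor R M N)"
    and "P \<zero>\<^bsub>tensor R M N\<^esub>"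
    and "\<And>m n. m \<in> carrier M \<Longrightarrow> n \<in> carrier N \<Longrightarrow> P (pure_tensor R M N m n)"
    and "\<And>x y. x \<in> carrier (tensor R M N) \<Longrightarrow> y \<in> carrier (tensor R M N)
      \<Longrightarrow> P x \<Longrightarrow> P y \<Longrightarrow> P (x \<oplus>\<^bsub>tensor R M N\<^esub> y)"
  shows "P t"
  using assms by (intro tensor_group_induct[of t P]) (simp_all add: tensor_simps)

text \<open>The universal property yields only an additive map; compatibility with scalars is added
  by induction over sums of pure tensors.\<close>

lemma tensor_lift:
  assumes f: "bil R M N P f"
  shows "lin R (tensor R M N) P (tensor_lift R M N P f)"
    and "m \<in> carrier M \<Longrightarrow> n \<in> carrier N \<Longrightarrow> tensor_lift R M N P f (pure_tensor R M N m n) = f m n"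
proof -
  have P: "module R P" using bil_module3[OF f] .
  interpret P: module R P by (rule P)
  have f1: "lin R M P (\<lambda>m. f m n)" if "n \<in> carrier N" for n using bil_lin1[OF f that] .
  have f2: "lin R N P (f m)" if "m \<in> carrier M" for m using bil_lin2[OF f that] .
  have G: "comm_group (add_monoid P)" by (rule P.a_comm_group)
  have "\<exists>!g. g \<in> hom (tensor_group R M N) (add_monoid P)
      \<and> g \<in> extensional (carrier (tensor_group R M N))
      \<and> (\<forall>m\<in>carrier M. \<forall>n\<in>carrier N. g (pure_tensor R M N m n) = f m n)"
    by (intro tensor_group_lift_ex1 M N G)
      (auto simp: bil_closed[OF f] lin_add[OF f1] lin_add[OF f2] lin_smult[OF f1] lin_smult[OF f2])
  from theI'[OF this] have *: "tensor_lift R M N P f \<in> hom (tensor_group R M N) (add_monoid P)"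
    "\<And>m n. m \<in> carrier M \<Longrightarrow> n \<in> carrier N \<Longrightarrow> tensor_lift R M N P f (pure_tensor R M N m n) = f m n"
    by (simp_all add: tensor_lift_def tensor_group_lift_def)
  have h0: "tensor_lift R M N P f \<zero>\<^bsub>tensor R M N\<^esub> = \<zero>\<^bsub>P\<^esub>"
    using hom_one[OF *(1)] comm_group.axioms(2)[OF comm_group_tensor_group] P.add.is_group
    by (simp add: tensor_simps)
  interpret T: module R "tensor R M N" by (rule module_tensor)
  have hc: "tensor_lift R M N P f x \<in> carrier P" if "x \<in> carrier (tensor R M N)" for x
    using hom_in_carrier[OF *(1)] that by (simp add: tensor_simps)
  have ha: "tensor_lift R M N P f (x \<oplus>\<^bsub>tensor R M N\<^esub> y) = tensor_lift R M N P f x \<oplus>\<^bsub>P\<^esub> tensor_lift R M N P f y"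
    if "x \<in> carrier (tensor R M N)" "y \<in> carrier (tensor R M N)" for x y
    using hom_mult[OF *(1)] that by (simp add: tensor_simps)
  have hs: "tensor_lift R M N P f (r \<odot>\<^bsub>tensor R M N\<^esub> x) = r \<odot>\<^bsub>P\<^esub> tensor_lift R M N P f x"
    if r: "r \<in> carrier R" and x: "x \<in> carrier (tensor R M N)" for r x
    using x
  proof (induction rule: tensor_induct)
    case (pure m n)
    then show ?case
      using r tensor_smult_lift[THEN conjunct2, rule_format, OF r] *(2) lin_smult[OF f1]
      by simp
  next
    case (add x y)
    then show ?case using r by (simp add: T.smult_r_distr ha hc P.smult_r_distr)
  qed (use r h0 in simp)
  show "lin R (tensor R M N) P (tensor_lift R M N P f)"
    using P module_tensor by (simp add: lin_iff ha hc hs)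
  show "m \<in> carrier M \<Longrightarrow> n \<in> carrier N \<Longrightarrow> tensor_lift R M N P f (pure_tensor R M N m n) = f m n"
    by (rule *(2))
qed

end

lemma lin_tensor_eqI:
  assumes "lin R (tensor R M N) P f" "lin R (tensor R M N) P g" "module R M" "module R N"
    and "\<And>m n. m \<in> carrier M \<Longrightarrow> n \<in> carrier N \<Longrightarrow> f (pure_tensor R M N m n) = g (pure_tensor R M N m n)"
    and "t \<in> carrier (tensor R M N)"
  shows "f t = g t"
proof (rule tensor_induct[OF assms(3,4,6)])
  show "f \<zero>\<^bsub>tensor R M N\<^esub> = g \<zero>\<^bsub>tensor R M N\<^esub>"
    using assms by (simp add: lin_zero)
qed (use assms in \<open>simp_all add: lin_add[OF assms(1)] lin_add[OF assms(2)]\<close>)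

section \<open>Sums over a tensor\<close>

text \<open>Over a list and not a finite set, because a pair may have to be counted several
  times.\<close>

definition lsum :: "('p, 'z) ring_scheme \<Rightarrow> ('m \<times> 'n) list \<Rightarrow> ('m \<Rightarrow> 'n \<Rightarrow> 'p) \<Rightarrow> 'p" where
  "lsum P xs f = foldr (\<lambda>(m, n) s. f m n \<oplus>\<^bsub>P\<^esub> s) xs \<zero>\<^bsub>P\<^esub>"

definition is_tens_rep ::
  "('k, 'r) ring_scheme \<Rightarrow> ('k, 'm, 'x) module_scheme \<Rightarrow> ('k, 'n, 'y) module_scheme
    \<Rightarrow> ('m, 'n) tens \<Rightarrow> ('m \<times> 'n) list \<Rightarrow> bool" where
  "is_tens_rep R M N t xs \<longleftrightarrow>
     set xs \<subseteq> carrier M \<times> carrier N \<and> t = lsum (tensor R M N) xs (pure_tensor R M N)"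

text \<open>
  A fixed decomposition of a tensor into pure tensors.  The value for a non-tensor is junk, but always
  a list over the carriers, which makes congruence and interchange of sums unconditional.
\<close>

definition tens_rep ::
  "('k, 'r) ring_scheme \<Rightarrow> ('k, 'm, 'x) module_scheme \<Rightarrow> ('k, 'n, 'y) module_scheme
    \<Rightarrow> ('m, 'n) tens \<Rightarrow> ('m \<times> 'n) list" where
  "tens_rep R M N t =
     (if \<exists>xs. is_tens_rep R M N t xs then SOME xs. is_tens_rep R M N t xs else [])"

text \<open>For bilinear \<open>f\<close> this is \<open>tensor_lift\<close>. The advantage of an
  honest finite sum is that interchanging two sums and passing through a linear map ask only for
  summands in the carrier, not for bilinearity.\<close>

definition tsum ::
  "('k, 'r) ring_scheme \<Rightarrow> ('k, 'm, 'x) module_scheme \<Rightarrow> ('k, 'n, 'y) module_scheme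
    \<Rightarrow> ('p, 'z) ring_scheme \<Rightarrow> ('m, 'n) tens \<Rightarrow> ('m \<Rightarrow> 'n \<Rightarrow> 'p) \<Rightarrow> 'p" where
  "tsum R M N P t f = lsum P (tens_rep R M N t) f"

lemma lsum_simps [simp]:
  "lsum P [] f = \<zero>\<^bsub>P\<^esub>" "lsum P ((m, n) # xs) f = f m n \<oplus>\<^bsub>P\<^esub> lsum P xs f"
  by (simp_all add: lsum_def)

lemma lsum_closed:
  assumes "module R P" "set xs \<subseteq> A \<times> B" "\<And>m n. m \<in> A \<Longrightarrow> n \<in> B \<Longrightarrow> f m n \<in> carrier P"
  shows "lsum P xs f \<in> carrier P"
proof -
  interpret module R P by fact
  show ?thesis using assms(2) by (induction xs) (auto simp: assms(3))
qed

lemma lsum_append: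
  assumes "module R P" "set xs \<subseteq> A \<times> B" "set ys \<subseteq> A \<times> B"
    "\<And>m n. m \<in> A \<Longrightarrow> n \<in> B \<Longrightarrow> f m n \<in> carrier P"
  shows "lsum P (xs @ ys) f = lsum P xs f \<oplus>\<^bsub>P\<^esub> lsum P ys f"
proof -
  interpret module R P by fact
  show ?thesis using assms(2)
    by (induction xs)
      (auto simp: assms(4) lsum_closed[OF assms(1,3,4)] lsum_closed[OF assms(1) _ assms(4)] a_assoc)
qed

lemma lsum_lin:
  assumes \<phi>: "lin R P Q \<phi>" and xs: "set xs \<subseteq> A \<times> B"
    and f: "\<And>m n. m \<in> A \<Longrightarrow> n \<in> B \<Longrightarrow> f m n \<in> carrier P"
  shows "\<phi> (lsum P xs f) = lsum Q xs (\<lambda>m n. \<phi> (f m n))"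
  using xs
  by (induction xs)
    (auto simp: lin_zero[OF \<phi>] lin_add[OF \<phi>] f lsum_closed[OF lin_module1[OF \<phi>] _ f])

lemma lsum_lin_param:
  assumes "module R X" "module R P" "set xs \<subseteq> A \<times> B"
    and F: "\<And>m n. m \<in> A \<Longrightarrow> n \<in> B \<Longrightarrow> lin R X P (F m n)"
  shows "lin R X P (\<lambda>x. lsum P xs (\<lambda>m n. F m n x))"
proof -
  interpret X: module R X by fact
  interpret P: module R P by fact
  show ?thesis using assms(3)
  proof (induction xs)
    case Nil
    then show ?case using assms by (simp add: lin_iff)
  next
    case (Cons a xs)
    obtain m n where a: "a = (m, n)" by (cases a)
    then have 1: "lin R X P (F m n)" and 2: "lin R X P (\<lambda>x. lsum P xs (\<lambda>m n. F m n x))"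
      using Cons F by auto
    show ?case
      unfolding a lsum_simps
      using assms(1,2)
      by (auto simp: lin_iff lin_closed[OF 1] lin_closed[OF 2] lin_add[OF 1] lin_add[OF 2]
          lin_smult[OF 1] lin_smult[OF 2] P.a_ac P.smult_r_distr)
  qed
qed

lemma lsum_swap:
  assumes "module R P" "set xs \<subseteq> A \<times> B" "set ys \<subseteq> C \<times> D"
    and F: "\<And>a b c d. a \<in> A \<Longrightarrow> b \<in> B \<Longrightarrow> c \<in> C \<Longrightarrow> d \<in> D \<Longrightarrow> F a b c d \<in> carrier P"
  shows "lsum P xs (\<lambda>a b. lsum P ys (\<lambda>c d. F a b c d)) = lsum P ys (\<lambda>c d. lsum P xs (\<lambda>a b. F a b c d))"
proof -
  interpret P: module R P by fact
  have 0: "lsum P ys (\<lambda>c d. \<zero>\<^bsub>P\<^esub>) = \<zero>\<^bsub>P\<^esub>" 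
    by (induction ys) auto
  have add: "lsum P ys (\<lambda>c d. f c d \<oplus>\<^bsub>P\<^esub> g c d) = lsum P ys f \<oplus>\<^bsub>P\<^esub> lsum P ys g"
    if "set ys \<subseteq> C \<times> D" and fg: "\<And>c d. c \<in> C \<Longrightarrow> d \<in> D \<Longrightarrow> f c d \<in> carrier P"
      "\<And>c d. c \<in> C \<Longrightarrow> d \<in> D \<Longrightarrow> g c d \<in> carrier P" for f g
    using that(1)
    by (induction ys)
      (auto simp: fg lsum_closed[OF assms(1) _ fg(1)] lsum_closed[OF assms(1) _ fg(2)] P.a_ac)
  show ?thesis using assms(2)
  proof (induction xs)
    case (Cons x xs)
    then show ?case
      by (cases x) (auto simp: F add[OF assms(3)] lsum_closed[OF assms(1), of _ A B])
  qed (simp add: 0)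
qed

lemma lsum_cong:
  assumes "set xs \<subseteq> A \<times> B" "\<And>m n. m \<in> A \<Longrightarrow> n \<in> B \<Longrightarrow> f m n = g m n"
  shows "lsum P xs f = lsum P xs g"
  using assms(1) by (induction xs) (auto simp: assms(2))

lemma tens_rep_exists:
  assumes "module R M" "module R N" "t \<in> carrier (tensor R M N)"
  shows "\<exists>xs. is_tens_rep R M N t xs"
  unfolding is_tens_rep_def
proof (rule tensor_induct[OF assms])
  show "\<exists>xs. set xs \<subseteq> carrier M \<times> carrier N \<and>
      \<zero>\<^bsub>tensor R M N\<^esub> = lsum (tensor R M N) xs (pure_tensor R M N)"
    by (rule exI[of _ "[]"]) simp
next
  interpret T: module R "tensor R M N" by (rule module_tensor[OF assms(1,2)])
  note p = bil_closed[OF bil_pure_tensor[OF assms(1,2)]]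
  show "\<exists>xs. set xs \<subseteq> carrier M \<times> carrier N \<and>
      pure_tensor R M N m n = lsum (tensor R M N) xs (pure_tensor R M N)"
    if "m \<in> carrier M" "n \<in> carrier N" for m n
    using that p[OF that] by (intro exI[of _ "[(m, n)]"]) simp
  fix x y
  assume "\<exists>xs. set xs \<subseteq> carrier M \<times> carrier N \<and> x = lsum (tensor R M N) xs (pure_tensor R M N)"
    and "\<exists>xs. set xs \<subseteq> carrier M \<times> carrier N \<and> y = lsum (tensor R M N) xs (pure_tensor R M N)"
  then obtain xs ys where "set xs \<subseteq> carrier M \<times> carrier N" "x = lsum (tensor R M N) xs (pure_tensor R M N)"
    "set ys \<subseteq> carrier M \<times> carrier N" "y = lsum (tensor R M N) ys (pure_tensor R M N)"
    by blast
  then show "\<exists>xs. set xs \<subseteq> carrier M \<times> carrier N \<and>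
      x \<oplus>\<^bsub>tensor R M N\<^esub> y = lsum (tensor R M N) xs (pure_tensor R M N)"
    using lsum_append[OF T.module_axioms, of xs "carrier M" "carrier N" ys "pure_tensor R M N"] p
    by (intro exI[of _ "xs @ ys"]) simp
qed

lemma tens_rep_subset: "set (tens_rep R M N t) \<subseteq> carrier M \<times> carrier N"
proof (cases "\<exists>xs. is_tens_rep R M N t xs")
  case True
  then have "is_tens_rep R M N t (tens_rep R M N t)"
    using someI_ex[OF True] by (simp add: tens_rep_def)
  then show ?thesis by (simp add: is_tens_rep_def)
qed (simp add: tens_rep_def)

lemma tsum_pure_id:
  assumes "module R M" "module R N" "t \<in> carrier (tensor R M N)"
  shows "tsum R M N (tensor R M N) t (pure_tensor R M N) = t"
proof -
  have "is_tens_rep R M N t (tens_rep R M N t)"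
    using someI_ex[OF tens_rep_exists[OF assms]] tens_rep_exists[OF assms] by (simp add: tens_rep_def)
  then show ?thesis by (simp add: is_tens_rep_def tsum_def)
qed

lemma tsum_cong:
  assumes "\<And>m n. m \<in> carrier M \<Longrightarrow> n \<in> carrier N \<Longrightarrow> f m n = g m n"
  shows "tsum R M N P t f = tsum R M N P t g"
  unfolding tsum_def by (rule lsum_cong[OF tens_rep_subset assms])

text \<open>As a congruence rule it supplies the simplifier with carrier membership of the bound
  variables, so rewriting reaches into nested sums.\<close>

lemma tsum_cong_full [cong]:
  assumes "M = M'" "N = N'" "P = P'" "t = u"
    and "\<And>m n. m \<in> carrier M' \<Longrightarrow> n \<in> carrier N' \<Longrightarrow> f m n = g m n"
  shows "tsum R M N P t f = tsum R M' N' P' u g"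
  using tsum_cong[OF assms(5)] assms(1-4) by simp

lemma tsum_closed [simp]:
  assumes "module R P" "\<And>m n. m \<in> carrier M \<Longrightarrow> n \<in> carrier N \<Longrightarrow> f m n \<in> carrier P"
  shows "tsum R M N P t f \<in> carrier P"
  unfolding tsum_def using assms by (intro lsum_closed[OF _ tens_rep_subset])

lemma tsum_lin:
  assumes "lin R P Q \<phi>" "\<And>m n. m \<in> carrier M \<Longrightarrow> n \<in> carrier N \<Longrightarrow> f m n \<in> carrier P"
  shows "\<phi> (tsum R M N P t f) = tsum R M N Q t (\<lambda>m n. \<phi> (f m n))"
  unfolding tsum_def by (rule lsum_lin[OF assms(1) tens_rep_subset assms(2)])

lemma tsum_swap:
  assumes "module R P"
    and "\<And>a b c d. a \<in> carrier A \<Longrightarrow> b \<in> carrier B \<Longrightarrow> c \<in> carrier C \<Longrightarrow> d \<in> carrier D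
      \<Longrightarrow> F a b c d \<in> carrier P"
  shows "tsum R A B P t (\<lambda>a b. tsum R C D P u (\<lambda>c d. F a b c d))
    = tsum R C D P u (\<lambda>c d. tsum R A B P t (\<lambda>a b. F a b c d))"
  unfolding tsum_def by (rule lsum_swap[OF assms(1) tens_rep_subset tens_rep_subset assms(2)])

lemma tensor_lift_cong:
  assumes "\<And>m n. m \<in> carrier M \<Longrightarrow> n \<in> carrier N \<Longrightarrow> f m n = g m n"
  shows "tensor_lift R M N P f = tensor_lift R M N P g"
  unfolding tensor_lift_def tensor_group_lift_def using assms by (simp cong: ball_cong)

text \<open>The bridge from the definitions to finite sums: decompose \<open>t\<close> into pure
  tensors and let the linear map \<open>tensor_lift\<close> pass through the sum.\<close>

lemma tensor_lift_eq_tsum: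
  assumes f: "bil R M N P f" and t: "t \<in> carrier (tensor R M N)"
  shows "tensor_lift R M N P f t = tsum R M N P t f"
proof -
  note m = bil_module1[OF f] bil_module2[OF f]
  have "tensor_lift R M N P f t
      = tensor_lift R M N P f (tsum R M N (tensor R M N) t (pure_tensor R M N))"
    using tsum_pure_id[OF m t] by simp
  also have "\<dots> = tsum R M N P t (\<lambda>m n. tensor_lift R M N P f (pure_tensor R M N m n))"
    by (rule tsum_lin[OF tensor_lift(1)[OF m f] bil_closed[OF bil_pure_tensor[OF m]]])
  also have "\<dots> = tsum R M N P t f"
    by (rule tsum_cong) (rule tensor_lift(2)[OF m f])
  finally show ?thesis .
qed

lemma lin_tsum_bil:
  assumes f: "bil R M N P f"
  shows "lin R (tensor R M N) P (\<lambda>t. tsum R M N P t f)"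
proof -
  note m = bil_module1[OF f] bil_module2[OF f]
  show ?thesis
    using tensor_lift(1)[OF m f]
      lin_cong[of "tensor R M N" "tensor_lift R M N P f" "\<lambda>t. tsum R M N P t f", OF tensor_lift_eq_tsum[OF f]]
    by blast
qed

text \<open>The chosen decomposition of a pure tensor need not be the obvious one; bilinearity of
  \<open>f\<close> makes the sum independent of that choice.\<close>

lemma tsum_pure:
  assumes "bil R M N P f" "m \<in> carrier M" "n \<in> carrier N"
  shows "tsum R M N P (pure_tensor R M N m n) f = f m n"
proof -
  note m = bil_module1[OF assms(1)] bil_module2[OF assms(1)]
  show ?thesis
    using tensor_lift_eq_tsum[OF assms(1) bil_closed[OF bil_pure_tensor[OF m] assms(2,3)]]
      tensor_lift(2)[OF m assms] by simp
qed

section \<open>Rules for linearity\<close>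

lemma lin_comp:
  assumes "lin R M N f" "lin R X M g"
  shows "lin R X N (\<lambda>x. f (g x))"
  using assms by (auto simp: lin_iff)

lemma bil_comp1:
  assumes "bil R M N P f" "lin R X M g" "n \<in> carrier N"
  shows "lin R X P (\<lambda>x. f (g x) n)"
  by (rule lin_comp[OF bil_lin1[OF assms(1,3)] assms(2)])

lemma bil_comp2:
  assumes "bil R M N P f" "lin R X N g" "m \<in> carrier M"
  shows "lin R X P (\<lambda>x. f m (g x))"
  by (rule lin_comp[OF bil_lin2[OF assms(1,3)] assms(2)])

lemma lin_id [simp]: "module R M \<Longrightarrow> lin R M M (\<lambda>x. x)"
  by (simp add: lin_iff)

declare module_tensor [simp]

lemma pure_closed [simp]:
  assumes "module R M" "module R N" "m \<in> carrier M" "n \<in> carrier N"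
  shows "pure_tensor R M N m n \<in> carrier (tensor R M N)"
  using assms by (intro bil_closed[OF bil_pure_tensor])

text \<open>Phrased with an inner linear function, like the other rules of this kind, so that the
  simplifier proves a nested expression linear in any one variable by descending along the
  term.\<close>

lemma lin_pure [simp]:
  assumes "module R M" "module R N"
  shows "n \<in> carrier N \<Longrightarrow> lin R X M g \<Longrightarrow> lin R X (tensor R M N) (\<lambda>x. pure_tensor R M N (g x) n)"
    and "m \<in> carrier M \<Longrightarrow> lin R X N g' \<Longrightarrow> lin R X (tensor R M N) (\<lambda>x. pure_tensor R M N m (g' x))"
  by (rule bil_comp1[OF bil_pure_tensor[OF assms]] bil_comp2[OF bil_pure_tensor[OF assms]]; assumption)+

lemma lin_tsum_param [simp]:
  assumes "module R X" "module R P"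
    and "\<And>m n. m \<in> carrier M \<Longrightarrow> n \<in> carrier N \<Longrightarrow> lin R X P (\<lambda>x. F m n x)"
  shows "lin R X P (\<lambda>x. tsum R M N P t (\<lambda>m n. F m n x))"
  unfolding tsum_def using assms by (intro lsum_lin_param[OF _ _ tens_rep_subset])

text \<open>Here the variable sits in the tensor that is summed over, and linearity rests on
  \<open>f\<close> being bilinear. A variable inside the summand is the case of
  \<open>lin_tsum_param\<close>.\<close>

lemma lin_tsum_arg [simp]:
  assumes "bil R M N P f" "lin R X (tensor R M N) g"
  shows "lin R X P (\<lambda>x. tsum R M N P (g x) f)"
  by (rule lin_comp[OF lin_tsum_bil[OF assms(1)] assms(2)])

lemma regular_module_simps [simp]:
  "carrier (regular_module R) = carrier R"
  "ring.add (regular_module R) = ring.add R"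
  "ring.zero (regular_module R) = ring.zero R"
  "smult (regular_module R) = monoid.mult R"
  by (simp_all add: regular_module_def)

lemma module_regular_module:
  assumes "cring R" shows "module R (regular_module R)"
proof -
  interpret cring R by fact
  show ?thesis
    by (intro moduleI abelian_groupI is_cring)
      (auto simp: a_assoc l_distr r_distr m_assoc intro: a_comm add.l_inv_ex)
qed

lemma module_cring: "module R M \<Longrightarrow> cring R"
  by (simp add: module_def)

lemma lin_smult_rules [simp]:
  assumes "module R M"
  shows "m \<in> carrier M \<Longrightarrow> lin R X (regular_module R) g \<Longrightarrow> lin R X M (\<lambda>x. g x \<odot>\<^bsub>M\<^esub> m)"
    and "r \<in> carrier R \<Longrightarrow> lin R X M g' \<Longrightarrow> lin R X M (\<lambda>x. r \<odot>\<^bsub>M\<^esub> g' x)"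
proof -
  interpret module R M by fact
  have "bil R (regular_module R) M M (\<lambda>r m. r \<odot>\<^bsub>M\<^esub> m)"
    using assms module_regular_module[OF is_cring] m_comm
    by (simp add: bil_def lin_iff smult_l_distr smult_r_distr flip: smult_assoc1)
  note b = bil_comp1[OF this] bil_comp2[OF this]
  show "m \<in> carrier M \<Longrightarrow> lin R X (regular_module R) g \<Longrightarrow> lin R X M (\<lambda>x. g x \<odot>\<^bsub>M\<^esub> m)"
    by (rule b)
  show "r \<in> carrier R \<Longrightarrow> lin R X M g' \<Longrightarrow> lin R X M (\<lambda>x. r \<odot>\<^bsub>M\<^esub> g' x)"
    by (rule b) simp_all
qed

lemma lin_scalar_mult [simp]:
  shows "r \<in> carrier R \<Longrightarrow> lin R X (regular_module R) g \<Longrightarrow> lin R X (regular_module R) (\<lambda>x. g x \<otimes>\<^bsub>R\<^esub> r)"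
    and "r \<in> carrier R \<Longrightarrow> lin R X (regular_module R) g \<Longrightarrow> lin R X (regular_module R) (\<lambda>x. r \<otimes>\<^bsub>R\<^esub> g x)"
  using lin_smult_rules[of R "regular_module R"] lin_module2[of R X "regular_module R" g]
  by simp_all

section \<open>Pushing linear maps into sums\<close>

text \<open>Together with \<open>tsum_pure\<close> this evaluates a bilinear map on a tensor that is
  written as a sum of pure tensors, which is how tensor equations become equations of nested
  sums.\<close>

lemma tsum_tsum:
  assumes "bil R M N P g" "\<And>a b. a \<in> carrier A \<Longrightarrow> b \<in> carrier B \<Longrightarrow> f a b \<in> carrier (tensor R M N)"
  shows "tsum R M N P (tsum R A B (tensor R M N) t f) g = tsum R A B P t (\<lambda>a b. tsum R M N P (f a b) g)"
  by (rule tsum_lin[OF lin_tsum_bil[OF assms(1)] assms(2)])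

lemma pure_tsum:
  assumes "module R M" "module R N"
  shows "n \<in> carrier N \<Longrightarrow> (\<And>a b. a \<in> carrier A \<Longrightarrow> b \<in> carrier B \<Longrightarrow> f a b \<in> carrier M) \<Longrightarrow>
      pure_tensor R M N (tsum R A B M t f) n = tsum R A B (tensor R M N) t (\<lambda>a b. pure_tensor R M N (f a b) n)"
    and "m \<in> carrier M \<Longrightarrow> (\<And>a b. a \<in> carrier A \<Longrightarrow> b \<in> carrier B \<Longrightarrow> f' a b \<in> carrier N) \<Longrightarrow>
      pure_tensor R M N m (tsum R A B N t f') = tsum R A B (tensor R M N) t (\<lambda>a b. pure_tensor R M N m (f' a b))"
  using assms by (auto intro!: tsum_lin[where \<phi>="\<lambda>x. pure_tensor R M N x n"] tsum_lin[where \<phi>="\<lambda>x. pure_tensor R M N m x"])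

lemma smult_tsum:
  assumes "module R M"
  shows "m \<in> carrier M \<Longrightarrow> (\<And>a b. a \<in> carrier A \<Longrightarrow> b \<in> carrier B \<Longrightarrow> f a b \<in> carrier R) \<Longrightarrow>
      tsum R A B (regular_module R) t f \<odot>\<^bsub>M\<^esub> m = tsum R A B M t (\<lambda>a b. f a b \<odot>\<^bsub>M\<^esub> m)"
    and "r \<in> carrier R \<Longrightarrow> (\<And>a b. a \<in> carrier A \<Longrightarrow> b \<in> carrier B \<Longrightarrow> f' a b \<in> carrier M) \<Longrightarrow>
      r \<odot>\<^bsub>M\<^esub> tsum R A B M t f' = tsum R A B M t (\<lambda>a b. r \<odot>\<^bsub>M\<^esub> f' a b)"
  using assms module_regular_module[OF module_cring[OF assms]]
  by (auto intro!: tsum_lin[where \<phi>="\<lambda>x. x \<odot>\<^bsub>M\<^esub> m"] tsum_lin[where \<phi>="\<lambda>x. r \<odot>\<^bsub>M\<^esub> x"])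

lemma scalar_mult_tsum:
  assumes "cring R"
  shows "r \<in> carrier R \<Longrightarrow> (\<And>a b. a \<in> carrier A \<Longrightarrow> b \<in> carrier B \<Longrightarrow> f a b \<in> carrier R) \<Longrightarrow>
      tsum R A B (regular_module R) t f \<otimes>\<^bsub>R\<^esub> r = tsum R A B (regular_module R) t (\<lambda>a b. f a b \<otimes>\<^bsub>R\<^esub> r)"
    and "r \<in> carrier R \<Longrightarrow> (\<And>a b. a \<in> carrier A \<Longrightarrow> b \<in> carrier B \<Longrightarrow> f a b \<in> carrier R) \<Longrightarrow>
      r \<otimes>\<^bsub>R\<^esub> tsum R A B (regular_module R) t f = tsum R A B (regular_module R) t (\<lambda>a b. r \<otimes>\<^bsub>R\<^esub> f a b)"
  using smult_tsum(1)[OF module_regular_module[OF assms], where m=r and f=f and A=A and B=B and t=t]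
    smult_tsum(2)[OF module_regular_module[OF assms], where r=r and f'=f and A=A and B=B and t=t]
  by simp_all

lemma tensor_map_eq:
  assumes "lin R M P f" "lin R N Q g" "t \<in> carrier (tensor R M N)"
  shows "tensor_map R M N P Q f g t = tsum R M N (tensor R P Q) t (\<lambda>m n. pure_tensor R P Q (f m) (g n))"
  unfolding tensor_map_def using assms linD[OF assms(1)] linD[OF assms(2)]
  by (intro tensor_lift_eq_tsum bilI) (auto simp: )

lemma tensor_assoc_eq:
  assumes "module R M" "module R N" "module R P" "t \<in> carrier (tensor R (tensor R M N) P)"
  shows "tensor_assoc R M N P t = tsum R (tensor R M N) P (tensor R M (tensor R N P)) t
    (\<lambda>u p. tsum R M N (tensor R M (tensor R N P)) u (\<lambda>m n. pure_tensor R M (tensor R N P) m (pure_tensor R N P n p)))"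
proof -
  have "tensor_assoc R M N P = tensor_lift R (tensor R M N) P (tensor R M (tensor R N P))
    (\<lambda>u p. tsum R M N (tensor R M (tensor R N P)) u
      (\<lambda>m n. pure_tensor R M (tensor R N P) m (pure_tensor R N P n p)))"
    unfolding tensor_assoc_def using assms
    by (intro tensor_lift_cong tensor_lift_eq_tsum bilI) auto
  then show ?thesis
    using assms by (simp add: tensor_lift_eq_tsum bilI)
qed

section \<open>Trilinear maps and composition with multilinear maps\<close>

definition tril ::
  "('k, 'r) ring_scheme \<Rightarrow> ('k, 'a, 'x) module_scheme \<Rightarrow> ('k, 'b, 'y) module_scheme
    \<Rightarrow> ('k, 'c, 'w) module_scheme \<Rightarrow> ('k, 'p, 'z) module_scheme
    \<Rightarrow> ('a \<Rightarrow> 'b \<Rightarrow> 'c \<Rightarrow> 'p) \<Rightarrow> bool" where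
  "tril R A B C P F \<longleftrightarrow>
     (\<forall>c\<in>carrier C. bil R A B P (\<lambda>a b. F a b c)) \<and> (\<forall>a\<in>carrier A. bil R B C P (F a))"

lemma trilI:
  assumes "module R A" "module R B" "module R C"
    and "\<And>b c. b \<in> carrier B \<Longrightarrow> c \<in> carrier C \<Longrightarrow> lin R A P (\<lambda>a. F a b c)"
    and "\<And>a c. a \<in> carrier A \<Longrightarrow> c \<in> carrier C \<Longrightarrow> lin R B P (\<lambda>b. F a b c)"
    and "\<And>a b. a \<in> carrier A \<Longrightarrow> b \<in> carrier B \<Longrightarrow> lin R C P (\<lambda>c. F a b c)"
  shows "tril R A B C P (\<lambda>a b c. F a b c)"
  using assms by (auto simp: tril_def bil_def)

lemma bil_compD:
  assumes F: "bil R A B P F"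
  shows "lin R X A f \<Longrightarrow> b \<in> carrier B \<Longrightarrow> lin R X P (\<lambda>x. F (f x) b)"
    and "lin R X B g \<Longrightarrow> a \<in> carrier A \<Longrightarrow> lin R X P (\<lambda>x. F a (g x))"
    and "a \<in> carrier A \<Longrightarrow> b \<in> carrier B \<Longrightarrow> F a b \<in> carrier P"
    and "module R P"
  using assms by (auto intro: bil_comp1 bil_comp2 bil_closed bil_module3)

lemma tril_compD:
  assumes F: "tril R A B C P F"
  shows "lin R X A f \<Longrightarrow> b \<in> carrier B \<Longrightarrow> c \<in> carrier C \<Longrightarrow> lin R X P (\<lambda>x. F (f x) b c)"
    and "lin R X B g \<Longrightarrow> a \<in> carrier A \<Longrightarrow> c \<in> carrier C \<Longrightarrow> lin R X P (\<lambda>x. F a (g x) c)"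
    and "lin R X C h \<Longrightarrow> a \<in> carrier A \<Longrightarrow> b \<in> carrier B \<Longrightarrow> lin R X P (\<lambda>x. F a b (h x))"
    and "a \<in> carrier A \<Longrightarrow> b \<in> carrier B \<Longrightarrow> c \<in> carrier C \<Longrightarrow> F a b c \<in> carrier P"
    and "a \<in> carrier A \<Longrightarrow> module R P"
proof -
  have F1: "bil R A B P (\<lambda>a b. F a b c)" if "c \<in> carrier C" for c
    using F that by (simp add: tril_def)
  have F2: "bil R B C P (F a)" if "a \<in> carrier A" for a
    using F that by (simp add: tril_def)
  show "lin R X A f \<Longrightarrow> b \<in> carrier B \<Longrightarrow> c \<in> carrier C \<Longrightarrow> lin R X P (\<lambda>x. F (f x) b c)"
    by (rule bil_compD(1)[OF F1])
  show "lin R X B g \<Longrightarrow> a \<in> carrier A \<Longrightarrow> c \<in> carrier C \<Longrightarrow> lin R X P (\<lambda>x. F a (g x) c)"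
    by (rule bil_compD(1)[OF F2])
  show "lin R X C h \<Longrightarrow> a \<in> carrier A \<Longrightarrow> b \<in> carrier B \<Longrightarrow> lin R X P (\<lambda>x. F a b (h x))"
    by (rule bil_compD(2)[OF F2])
  show "a \<in> carrier A \<Longrightarrow> b \<in> carrier B \<Longrightarrow> c \<in> carrier C \<Longrightarrow> F a b c \<in> carrier P"
    by (rule bil_compD(3)[OF F2])
  show "a \<in> carrier A \<Longrightarrow> module R P"
    by (rule bil_compD(4)[OF F2])
qed

lemma lin_compD:
  assumes F: "lin R A P F"
  shows "lin R X A f \<Longrightarrow> lin R X P (\<lambda>x. F (f x))"
    and "a \<in> carrier A \<Longrightarrow> F a \<in> carrier P"
    and "module R P"
  using assms by (auto intro: lin_comp lin_closed lin_module2)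

lemma tril_module:
  assumes "tril R A B C P F" "module R A" shows "module R P"
  using tril_compD(5)[OF assms(1) module_zero_closed[OF assms(2)]] .

section \<open>Modules that agree up to their multiplication\<close>

text \<open>The records may have different extension types, such as a module and a coalgebra, so
  their equality cannot even be stated. Tensor products and linearity depend only on these four
  fields.\<close>

definition same_mod :: "('k, 'm, 'x) module_scheme \<Rightarrow> ('k, 'm, 'y) module_scheme \<Rightarrow> bool" where
  "same_mod M M' \<longleftrightarrow> carrier M = carrier M' \<and> ring.add M = ring.add M' \<and> ring.zero M = ring.zero M'
     \<and> smult M = smult M'"

lemma same_mod_simps:
  assumes "same_mod M M'"
  shows "carrier M = carrier M'" "ring.add M = ring.add M'" "ring.zero M = ring.zero M'" "smult M = smult M'"
  using assms by (auto simp: same_mod_def)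

lemma same_mod_tensor:
  assumes "same_mod M M'"
  shows "tensor_relations R M N = tensor_relations R M' N" "tensor_relations R N M = tensor_relations R N M'"
    "tensor_group R M N = tensor_group R M' N" "tensor_group R N M = tensor_group R N M'"
    "pure_tensor R M N = pure_tensor R M' N" "pure_tensor R N M = pure_tensor R N M'"
    "tensor R M N = tensor R M' N" "tensor R N M = tensor R N M'"
    "tensor_lift R M N P f = tensor_lift R M' N P f" "tensor_lift R N M P f' = tensor_lift R N M' P f'"
    "tensor_lift R N Q M g = tensor_lift R N Q M' g"
    "module R M = module R M'"
    "lin R M P h = lin R M' P h" "lin R P M h' = lin R P M' h'"
    "tsum R M N P t f = tsum R M' N P t f" "tsum R N M P t' f' = tsum R N M' P t' f'"
    "tsum R N Q M t'' g = tsum R N Q M' t'' g"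
proof -
  note s = same_mod_simps[OF assms]
  show 1: "tensor_relations R M N = tensor_relations R M' N" "tensor_relations R N M = tensor_relations R N M'" for N
    by (simp_all add: tensor_relations_def s)
  have 2: "tensor_kernel R M N = tensor_kernel R M' N" "tensor_kernel R N M = tensor_kernel R N M'" for N
    by (simp_all add: tensor_kernel_def 1 s)
  show 3: "tensor_group R M N = tensor_group R M' N" "tensor_group R N M = tensor_group R N M'" for N
    by (simp_all add: tensor_group_def 2 s)
  show 4: "pure_tensor R M N = pure_tensor R M' N" "pure_tensor R N M = pure_tensor R N M'" for N
    by (intro ext, simp add: pure_tensor_def 2 s)+
  have 5: "tensor_group_lift R M N P f = tensor_group_lift R M' N P f"
    "tensor_group_lift R N M P f' = tensor_group_lift R N M' P f'" for N f f' and P :: "('p, 'z) monoid_scheme"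
    by (simp_all add: tensor_group_lift_def 3 4 s)
  show 6: "tensor R M N = tensor R M' N" "tensor R N M = tensor R N M'" for N
    by (simp_all add: tensor_def 3 4 5 s)
  show "tensor_lift R M N P f = tensor_lift R M' N P f" "tensor_lift R N M P f' = tensor_lift R N M' P f'"
    by (simp_all add: tensor_lift_def 5)
  show "tensor_lift R N Q M g = tensor_lift R N Q M' g"
    by (simp add: tensor_lift_def tensor_group_lift_def hom_def s)
  show 7: "module R M = module R M'" by (rule module_eqI) (simp_all add: s)
  show "lin R M P h = lin R M' P h" "lin R P M h' = lin R P M' h'"
    by (simp_all add: lin_iff 7 s)
  have 8: "is_tens_rep R M N = is_tens_rep R M' N" "is_tens_rep R N M = is_tens_rep R N M'" for N
    by (simp_all add: fun_eq_iff is_tens_rep_def s 4 6)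
  show "tsum R M N P t f = tsum R M' N P t f" "tsum R N M P t' f' = tsum R N M' P t' f'"
    by (simp_all only: tsum_def tens_rep_def 8)
  show "tsum R N Q M t'' g = tsum R N Q M' t'' g"
    by (simp add: tsum_def lsum_def s)
qed

lemma same_mod_bil:
  assumes "same_mod M M'"
  shows "bil R M N P f = bil R M' N P f" "bil R N M P g = bil R N M' P g" "bil R N P M h = bil R N P M' h"
  by (simp_all add: bil_def same_mod_simps[OF assms] same_mod_tensor[OF assms])

lemma same_mod_tensor_bialgebra: "same_mod (tensor_bialgebra R G H) (tensor R G H)"
  by (simp add: same_mod_def tensor_bialgebra_def tensor_algebra_def)

lemma same_mod_tensor_algebra: "same_mod (tensor_algebra R G H) (tensor R G H)"
  by (simp add: same_mod_def tensor_algebra_def)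

lemma same_mod_opposite: "same_mod (opposite H) H"
  by (simp add: same_mod_def opposite_def)

text \<open>As simp rules these fix the plain module as normal form: the opposite, the tensor
  algebra and the tensor bialgebra disappear from every tensor, sum and linearity statement.\<close>

lemmas same_mod_rules [simp] =
  same_mod_simps[OF same_mod_tensor_bialgebra] same_mod_tensor[OF same_mod_tensor_bialgebra]
  same_mod_simps[OF same_mod_tensor_algebra] same_mod_tensor[OF same_mod_tensor_algebra]
  same_mod_simps[OF same_mod_opposite] same_mod_tensor[OF same_mod_opposite]
  same_mod_bil[OF same_mod_tensor_bialgebra] same_mod_bil[OF same_mod_opposite]

section \<open>Weak bialgebras\<close>

lemma sweedler_cong:
  assumes "\<And>x y. x \<in> carrier C \<Longrightarrow> y \<in> carrier C \<Longrightarrow> f x y = g x y"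
  shows "sweedler R C P f c = sweedler R C P g c"
  unfolding sweedler_def by (rule fun_cong[OF tensor_lift_cong[OF assms]])

text \<open>Isolates what the translation of Sweedler expressions into sums uses, so that the weak
  bialgebra axioms can be translated before coassociativity, counit laws or any compatibility is
  available.\<close>

locale algebra_coalgebra =
  fixes R :: "('k, 'r) ring_scheme" and H :: "('k, 'h, 'x) coalgebra_scheme" (structure)
  assumes unital_algebra: "unital_algebra R H"
    and comult_linear: "comult H \<in> linear_maps R H (tensor R H H)"
    and counit_linear: "counit H \<in> linear_maps R H (regular_module R)"
begin

lemma module_H [simp]: "module R H" and ring_H: "ring H"
  using unital_algebra by (auto simp: unital_algebra_def)

lemma cring_R [simp]: "cring R"
  by (rule module_cring) (rule module_H)

lemma module_K [simp]: "module R (regular_module R)"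
  by (rule module_regular_module) (rule cring_R)

lemma tsum_closed_scalar [simp]:
  assumes "\<And>m n. m \<in> carrier M \<Longrightarrow> n \<in> carrier N \<Longrightarrow> f m n \<in> carrier R"
  shows "tsum R M N (regular_module R) t f \<in> carrier R"
  using tsum_closed[of R "regular_module R" M N f t] assms by simp

lemma bil_mult: "bil R H H H (\<otimes>)"
  using unital_algebra ring.ring_simprules(5)[OF ring_H]
    ring.ring_simprules(13)[OF ring_H] ring.ring_simprules(23)[OF ring_H]
  by (auto simp: bil_def lin_iff unital_algebra_def)

lemma mult_closed [simp]: "x \<in> carrier H \<Longrightarrow> y \<in> carrier H \<Longrightarrow> x \<otimes> y \<in> carrier H"
  and one_closed [simp]: "\<one> \<in> carrier H"
  and mult_one_left [simp]: "x \<in> carrier H \<Longrightarrow> \<one> \<otimes> x = x"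
  and mult_one_right [simp]: "x \<in> carrier H \<Longrightarrow> x \<otimes> \<one> = x"
  and mult_assoc: "x \<in> carrier H \<Longrightarrow> y \<in> carrier H \<Longrightarrow> z \<in> carrier H \<Longrightarrow> x \<otimes> y \<otimes> z = x \<otimes> (y \<otimes> z)"
  using ring_H by (auto simp: ring_def monoid.m_closed monoid.one_closed monoid.l_one monoid.r_one monoid.m_assoc)

lemma scalar_closed [simp]:
  "r \<in> carrier R \<Longrightarrow> s \<in> carrier R \<Longrightarrow> r \<otimes>\<^bsub>R\<^esub> s \<in> carrier R"
  "module R P \<Longrightarrow> r \<in> carrier R \<Longrightarrow> p \<in> carrier P \<Longrightarrow> r \<odot>\<^bsub>P\<^esub> p \<in> carrier P"
  using cring.cring_simprules(5)[OF cring_R] module.smult_closed by auto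

lemma lin_mult [simp]:
  "lin R X H f \<Longrightarrow> b \<in> carrier H \<Longrightarrow> lin R X H (\<lambda>x. f x \<otimes> b)"
  "lin R X H g \<Longrightarrow> a \<in> carrier H \<Longrightarrow> lin R X H (\<lambda>x. a \<otimes> g x)"
  by (rule bil_compD[OF bil_mult]; assumption)+

lemma mult_tsum:
  "b \<in> carrier H \<Longrightarrow> (\<And>m n. m \<in> carrier M \<Longrightarrow> n \<in> carrier N \<Longrightarrow> f m n \<in> carrier H) \<Longrightarrow>
    tsum R M N H t f \<otimes> b = tsum R M N H t (\<lambda>m n. f m n \<otimes> b)"
  "a \<in> carrier H \<Longrightarrow> (\<And>m n. m \<in> carrier M \<Longrightarrow> n \<in> carrier N \<Longrightarrow> f m n \<in> carrier H) \<Longrightarrow>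
    a \<otimes> tsum R M N H t f = tsum R M N H t (\<lambda>m n. a \<otimes> f m n)"
  by (rule tsum_lin[where \<phi>="\<lambda>x. x \<otimes> b"]; simp) (rule tsum_lin[where \<phi>="\<lambda>x. a \<otimes> x"]; simp)

lemma lin_comult: "lin R H (tensor R H H) (comult H)"
  and lin_counit: "lin R H (regular_module R) (counit H)"
  using comult_linear counit_linear by (auto simp: lin_def)

lemma lin_comult_comp [simp]: "lin R X H f \<Longrightarrow> lin R X (tensor R H H) (\<lambda>x. comult H (f x))"
  and lin_counit_comp [simp]: "lin R X H f \<Longrightarrow> lin R X (regular_module R) (\<lambda>x. counit H (f x))"
  by (rule lin_comp[OF lin_comult]; assumption) (rule lin_comp[OF lin_counit]; assumption)

lemma comult_closed [simp]: "h \<in> carrier H \<Longrightarrow> comult H h \<in> carrier (tensor R H H)"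
  and counit_closed [simp]: "h \<in> carrier H \<Longrightarrow> counit H h \<in> carrier R"
  using lin_closed[OF lin_comult] lin_closed[OF lin_counit] by auto

text \<open>
  The sum \<open>sw P h F\<close> is \<open>F(h\<^sub>1, h\<^sub>2)\<close>.  An identity of tensors, such as
  \<open>\<epsilon>\<^sub>s(h\<^sub>1) \<otimes> h\<^sub>2 = 1\<^sub>1 \<otimes> h1\<^sub>2\<close>, is stated as an equality of such sums for every multilinear \<open>F\<close>.
\<close>

abbreviation sw where "sw P h f \<equiv> tsum R H H P (comult H h) f"
abbreviation HH where "HH \<equiv> tensor R H H"
abbreviation K where "K \<equiv> regular_module R"
abbreviation counit_H ("\<epsilon>") where "\<epsilon> \<equiv> counit H"

lemma sweedler_eq_tsum: "h \<in> carrier H \<Longrightarrow> bil R H H P f \<Longrightarrow> sweedler R H P f h = sw P h f"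
  unfolding sweedler_def by (rule tensor_lift_eq_tsum) auto

text \<open>Scalar-valued Sweedler expressions have the ring \<open>R\<close> as target. The regular
  module has the same additive structure and is a legitimate target of linear maps.\<close>

lemma tensor_lift_scalar: "tensor_lift R M N R f = tensor_lift R M N K f"
  by (simp add: tensor_lift_def tensor_group_lift_def hom_def)

lemma sweedler_scalar: "h \<in> carrier H \<Longrightarrow> bil R H H K f \<Longrightarrow> sweedler R H R f h = sw K h f"
  unfolding sweedler_def tensor_lift_scalar by (rule tensor_lift_eq_tsum) auto

lemma sw_pure: "h \<in> carrier H \<Longrightarrow> sw HH h (pure_tensor R H H) = comult H h"
  by (rule tsum_pure_id) auto

end

text \<open>The tensor axioms are stated for the universal multilinear map, the pure tensor; their
  forms for an arbitrary multilinear map are derived from these.\<close>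

locale weak_bialg = algebra_coalgebra +
  assumes coassoc: "h \<in> carrier H \<Longrightarrow>
      sw (tensor R H HH) h (\<lambda>x c. sw (tensor R H HH) x (\<lambda>a b. pure_tensor R H HH a (pure_tensor R H H b c)))
    = sw (tensor R H HH) h (\<lambda>a x. sw (tensor R H HH) x (\<lambda>b c. pure_tensor R H HH a (pure_tensor R H H b c)))"
    and counit_left: "h \<in> carrier H \<Longrightarrow> sw H h (\<lambda>a b. \<epsilon> a \<odot> b) = h"
    and counit_right: "h \<in> carrier H \<Longrightarrow> sw H h (\<lambda>a b. \<epsilon> b \<odot> a) = h"
    and comult_mult: "h \<in> carrier H \<Longrightarrow> k \<in> carrier H \<Longrightarrow> comult H (h \<otimes> k)
      = sw HH h (\<lambda>a b. sw HH k (\<lambda>c d. pure_tensor R H H (a \<otimes> c) (b \<otimes> d)))"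
    and comult_one_left: "sw (tensor R HH H) \<one> (\<lambda>x c. pure_tensor R HH H (comult H x) c)
      = sw (tensor R HH H) \<one> (\<lambda>x y. sw (tensor R HH H) \<one>
          (\<lambda>x' y'. pure_tensor R HH H (pure_tensor R H H x (y \<otimes> x')) y'))"
    and comult_one_right: "sw (tensor R HH H) \<one> (\<lambda>x c. pure_tensor R HH H (comult H x) c)
      = sw (tensor R HH H) \<one> (\<lambda>x y. sw (tensor R HH H) \<one>
          (\<lambda>x' y'. pure_tensor R HH H (pure_tensor R H H x (x' \<otimes> y)) y'))"
    and counit_mult1: "h \<in> carrier H \<Longrightarrow> k \<in> carrier H \<Longrightarrow> l \<in> carrier H \<Longrightarrow>
      \<epsilon> (h \<otimes> k \<otimes> l) = sw K k (\<lambda>a b. \<epsilon> (h \<otimes> a) \<otimes>\<^bsub>R\<^esub> \<epsilon> (b \<otimes> l))"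
    and counit_mult2: "h \<in> carrier H \<Longrightarrow> k \<in> carrier H \<Longrightarrow> l \<in> carrier H \<Longrightarrow>
      \<epsilon> (h \<otimes> k \<otimes> l) = sw K k (\<lambda>a b. \<epsilon> (h \<otimes> b) \<otimes>\<^bsub>R\<^esub> \<epsilon> (a \<otimes> l))"

context algebra_coalgebra
begin

lemma tensor_algebra_mult_eq:
  assumes "t \<in> carrier HH" "u \<in> carrier HH"
  shows "t \<otimes>\<^bsub>tensor_algebra R H H\<^esub> u
    = tsum R H H HH t (\<lambda>a b. tsum R H H HH u (\<lambda>c d. pure_tensor R H H (a \<otimes> c) (b \<otimes> d)))"
proof -
  have "t \<otimes>\<^bsub>tensor_algebra R H H\<^esub> u = tensor_lift R H H HH (\<lambda>a b. tsum R H H HH u (\<lambda>c d. pure_tensor R H H (a \<otimes> c) (b \<otimes> d))) t"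
    using assms
    by (simp add: tensor_algebra_def tensor_lift_eq_tsum bilI cong: tensor_lift_cong)
  also have "\<dots> = tsum R H H HH t (\<lambda>a b. tsum R H H HH u (\<lambda>c d. pure_tensor R H H (a \<otimes> c) (b \<otimes> d)))"
    using assms by (simp add: tensor_lift_eq_tsum bilI)
  finally show ?thesis .
qed

lemma coassoc_left_eq:
  assumes "h \<in> carrier H"
  shows "tensor_assoc R H H H (tensor_map R H H HH H (comult H) (\<lambda>x. x) (comult H h))
    = sw (tensor R H HH) h (\<lambda>x c. sw (tensor R H HH) x (\<lambda>a b. pure_tensor R H HH a (pure_tensor R H H b c)))"
  using assms lin_comult by (simp add: tensor_map_eq tensor_assoc_eq tsum_tsum tsum_pure bilI)

lemma coassoc_right_eq:
  assumes "h \<in> carrier H"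
  shows "tensor_map R H H H HH (\<lambda>x. x) (comult H) (comult H h)
    = sw (tensor R H HH) h (\<lambda>a x. sw (tensor R H HH) x (\<lambda>b c. pure_tensor R H HH a (pure_tensor R H H b c)))"
proof -
  have "pure_tensor R H HH a (comult H x)
    = sw (tensor R H HH) x (\<lambda>b c. pure_tensor R H HH a (pure_tensor R H H b c))"
    if "a \<in> carrier H" "x \<in> carrier H" for a x
    using that tsum_lin[of R HH "tensor R H HH" "pure_tensor R H HH a" H H "pure_tensor R H H" "comult H x"]
    by (simp add: sw_pure)
  then show ?thesis using assms lin_comult by (simp add: tensor_map_eq)
qed

lemma counital_coalgebra_iff:
  "counital_coalgebra R H \<longleftrightarrow>
    (\<forall>h\<in>carrier H.
      sw (tensor R H HH) h (\<lambda>x c. sw (tensor R H HH) x (\<lambda>a b. pure_tensor R H HH a (pure_tensor R H H b c)))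
    = sw (tensor R H HH) h (\<lambda>a x. sw (tensor R H HH) x (\<lambda>b c. pure_tensor R H HH a (pure_tensor R H H b c))))
    \<and> (\<forall>h\<in>carrier H. sw H h (\<lambda>a b. \<epsilon> a \<odot> b) = h) \<and> (\<forall>h\<in>carrier H. sw H h (\<lambda>a b. \<epsilon> b \<odot> a) = h)"
  unfolding counital_coalgebra_def using comult_linear counit_linear
  by (simp add: coassoc_left_eq coassoc_right_eq sweedler_eq_tsum bilI cong: ball_cong)

lemma weak_bialgebra_iff: "weak_bialgebra R H \<longleftrightarrow> weak_bialg R H"
proof -
  have tensor_mult: "comult H h \<otimes>\<^bsub>tensor_algebra R H H\<^esub> comult H k
    = sw HH h (\<lambda>a b. sw HH k (\<lambda>c d. pure_tensor R H H (a \<otimes> c) (b \<otimes> d)))"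
    if "h \<in> carrier H" "k \<in> carrier H" for h k
    using that by (simp add: tensor_algebra_mult_eq)
  have one: "tensor_map R H H HH H (comult H) (\<lambda>x. x) (comult H \<one>)
      = sw (tensor R HH H) \<one> (\<lambda>x c. pure_tensor R HH H (comult H x) c)"
    by (simp add: tensor_map_eq lin_comult)
  \<comment> \<open>The inner expression is converted under the outer one, and only afterwards is
    the outer summand, now a sum, seen to be bilinear.\<close>
  have double: "sweedler R H (tensor R HH H) (\<lambda>x y. sweedler R H (tensor R HH H) (f x y) \<one>) \<one>
      = sw (tensor R HH H) \<one> (\<lambda>x y. sw (tensor R HH H) \<one> (f x y))"
    if "\<And>x y. x \<in> carrier H \<Longrightarrow> y \<in> carrier H \<Longrightarrow> bil R H H (tensor R HH H) (f x y)"
       "\<And>x' y'. x' \<in> carrier H \<Longrightarrow> y' \<in> carrier H \<Longrightarrow> bil R H H (tensor R HH H) (\<lambda>x y. f x y x' y')" for f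
  proof -
    have "sweedler R H (tensor R HH H) (\<lambda>x y. sweedler R H (tensor R HH H) (f x y) \<one>) \<one>
      = sweedler R H (tensor R HH H) (\<lambda>x y. sw (tensor R HH H) \<one> (f x y)) \<one>"
      using that by (intro sweedler_cong sweedler_eq_tsum) simp_all
    also have "\<dots> = sw (tensor R HH H) \<one> (\<lambda>x y. sw (tensor R HH H) \<one> (f x y))"
      using that by (intro sweedler_eq_tsum bilI lin_tsum_param) (simp_all add: bil_lin1[OF that(2)] bil_lin2[OF that(2)])
    finally show ?thesis .
  qed
  have one_l: "sweedler R H (tensor R HH H) (\<lambda>x y. sweedler R H (tensor R HH H)
        (\<lambda>x' y'. pure_tensor R HH H (pure_tensor R H H x (y \<otimes> x')) y') \<one>) \<one>
      = sw (tensor R HH H) \<one> (\<lambda>x y. sw (tensor R HH H) \<one>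
          (\<lambda>x' y'. pure_tensor R HH H (pure_tensor R H H x (y \<otimes> x')) y'))"
    by (rule double) (simp_all add: bilI)
  have one_r: "sweedler R H (tensor R HH H) (\<lambda>x y. sweedler R H (tensor R HH H)
        (\<lambda>x' y'. pure_tensor R HH H (pure_tensor R H H x (x' \<otimes> y)) y') \<one>) \<one>
      = sw (tensor R HH H) \<one> (\<lambda>x y. sw (tensor R HH H) \<one>
          (\<lambda>x' y'. pure_tensor R HH H (pure_tensor R H H x (x' \<otimes> y)) y'))"
    by (rule double) (simp_all add: bilI)
  have counit1: "sweedler R H R (\<lambda>a b. \<epsilon> (h \<otimes> a) \<otimes>\<^bsub>R\<^esub> \<epsilon> (b \<otimes> l)) k = sw K k (\<lambda>a b. \<epsilon> (h \<otimes> a) \<otimes>\<^bsub>R\<^esub> \<epsilon> (b \<otimes> l))"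
    and counit2: "sweedler R H R (\<lambda>a b. \<epsilon> (h \<otimes> b) \<otimes>\<^bsub>R\<^esub> \<epsilon> (a \<otimes> l)) k = sw K k (\<lambda>a b. \<epsilon> (h \<otimes> b) \<otimes>\<^bsub>R\<^esub> \<epsilon> (a \<otimes> l))"
    if "h \<in> carrier H" "k \<in> carrier H" "l \<in> carrier H" for h k l
    using that by (simp_all add: sweedler_scalar bilI)
  show ?thesis
    unfolding weak_bialgebra_def weak_bialg_def weak_bialg_axioms_def counital_coalgebra_iff one one_l one_r
    using unital_algebra algebra_coalgebra_axioms
    by (simp only: tensor_mult counit1 counit2 Ball_def all_conj_distrib imp_conjR
        conj_assoc simp_thms all_simps cong: imp_cong)
qed

end

context weak_bialg
begin

text \<open>A trilinear \<open>F\<close> induces the linear map \<open>?\<phi>\<close> on H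
  \<otimes> (H \<otimes> H), which is applied to the coassociativity equation. The other structure
  equations are transported in the same way.\<close>

lemma sw_coassoc:
  assumes F: "tril R H H H P F" and h: "h \<in> carrier H"
  shows "sw P h (\<lambda>x c. sw P x (\<lambda>a b. F a b c)) = sw P h (\<lambda>a x. sw P x (\<lambda>b c. F a b c))"
proof -
  note [simp] = tril_compD(1-4)[OF F] tril_module[OF F module_H]
  let ?\<phi> = "\<lambda>t. tsum R H HH P t (\<lambda>a u. tsum R H H P u (\<lambda>b c. F a b c))"
  show ?thesis
    using arg_cong[OF coassoc[OF h], of ?\<phi>] h by (simp add: tsum_tsum tsum_pure bilI)
qed

lemma sw_mult:
  assumes F: "bil R H H P F" and "h \<in> carrier H" "k \<in> carrier H"
  shows "sw P (h \<otimes> k) F = sw P h (\<lambda>a b. sw P k (\<lambda>c d. F (a \<otimes> c) (b \<otimes> d)))"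
proof -
  note [simp] = bil_compD[OF F]
  show ?thesis using assms by (simp add: comult_mult tsum_tsum tsum_pure)
qed

lemma sw_counit_left:
  assumes f: "lin R H P f" and h: "h \<in> carrier H"
  shows "sw P h (\<lambda>a b. \<epsilon> a \<odot>\<^bsub>P\<^esub> f b) = f h"
proof -
  note [simp] = lin_compD[OF f]
  have "f (sw H h (\<lambda>a b. \<epsilon> a \<odot> b)) = sw P h (\<lambda>a b. f (\<epsilon> a \<odot> b))"
    by (rule tsum_lin[OF f]) simp
  then show ?thesis using h by (simp add: counit_left lin_smult[OF f])
qed

lemma sw_counit_right:
  assumes f: "lin R H P f" and h: "h \<in> carrier H"
  shows "sw P h (\<lambda>a b. \<epsilon> b \<odot>\<^bsub>P\<^esub> f a) = f h"
proof -
  note [simp] = lin_compD[OF f]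
  have "f (sw H h (\<lambda>a b. \<epsilon> b \<odot> a)) = sw P h (\<lambda>a b. f (\<epsilon> b \<odot> a))"
    by (rule tsum_lin[OF f]) simp
  then show ?thesis using h by (simp add: counit_right lin_smult[OF f])
qed

text \<open>Read from right to left, this merges two copies of \<Delta>(1) whose legs are multiplied
  in the middle into an iterated coproduct of 1, to which coassociativity applies.\<close>

lemma sw_one:
  assumes F: "tril R H H H P F"
  shows sw_one_left: "sw P \<one> (\<lambda>x c. sw P x (\<lambda>a b. F a b c))
      = sw P \<one> (\<lambda>x y. sw P \<one> (\<lambda>x' y'. F x (y \<otimes> x') y'))"
    and sw_one_right: "sw P \<one> (\<lambda>x c. sw P x (\<lambda>a b. F a b c))
      = sw P \<one> (\<lambda>x y. sw P \<one> (\<lambda>x' y'. F x (x' \<otimes> y) y'))"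
proof -
  note [simp] = tril_compD(1-4)[OF F] tril_module[OF F module_H]
  let ?\<phi> = "\<lambda>t. tsum R HH H P t (\<lambda>u c. tsum R H H P u (\<lambda>a b. F a b c))"
  show "sw P \<one> (\<lambda>x c. sw P x (\<lambda>a b. F a b c)) = sw P \<one> (\<lambda>x y. sw P \<one> (\<lambda>x' y'. F x (y \<otimes> x') y'))"
    using arg_cong[OF comult_one_left, of ?\<phi>] by (simp add: tsum_tsum tsum_pure bilI)
  show "sw P \<one> (\<lambda>x c. sw P x (\<lambda>a b. F a b c)) = sw P \<one> (\<lambda>x y. sw P \<one> (\<lambda>x' y'. F x (x' \<otimes> y) y'))"
    using arg_cong[OF comult_one_right, of ?\<phi>] by (simp add: tsum_tsum tsum_pure bilI)
qed

lemma counit_mult_smult: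
  assumes "module R P" "h \<in> carrier H" "k \<in> carrier H" "l \<in> carrier H" "p \<in> carrier P"
  shows counit_mult_smult1: "\<epsilon> (h \<otimes> (k \<otimes> l)) \<odot>\<^bsub>P\<^esub> p = sw P k (\<lambda>a b. \<epsilon> (h \<otimes> a) \<odot>\<^bsub>P\<^esub> (\<epsilon> (b \<otimes> l) \<odot>\<^bsub>P\<^esub> p))"
    and counit_mult_smult2: "\<epsilon> (h \<otimes> (k \<otimes> l)) \<odot>\<^bsub>P\<^esub> p = sw P k (\<lambda>a b. \<epsilon> (h \<otimes> b) \<odot>\<^bsub>P\<^esub> (\<epsilon> (a \<otimes> l) \<odot>\<^bsub>P\<^esub> p))"
proof -
  note s = smult_tsum(1)[OF assms(1)] module.smult_assoc1[OF assms(1)]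
  show "\<epsilon> (h \<otimes> (k \<otimes> l)) \<odot>\<^bsub>P\<^esub> p = sw P k (\<lambda>a b. \<epsilon> (h \<otimes> a) \<odot>\<^bsub>P\<^esub> (\<epsilon> (b \<otimes> l) \<odot>\<^bsub>P\<^esub> p))"
    using assms counit_mult1[OF assms(2-4)] by (simp add: mult_assoc s)
  show "\<epsilon> (h \<otimes> (k \<otimes> l)) \<odot>\<^bsub>P\<^esub> p = sw P k (\<lambda>a b. \<epsilon> (h \<otimes> b) \<odot>\<^bsub>P\<^esub> (\<epsilon> (a \<otimes> l) \<odot>\<^bsub>P\<^esub> p))"
    using assms counit_mult2[OF assms(2-4)] by (simp add: mult_assoc s)
qed

section \<open>Target and source counital maps\<close>

abbreviation eps_t_H ("\<epsilon>\<^sub>t") where "\<epsilon>\<^sub>t \<equiv> eps_t R H"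
abbreviation eps_s_H ("\<epsilon>\<^sub>s") where "\<epsilon>\<^sub>s \<equiv> eps_s R H"

lemma eps_eq:
  assumes "h \<in> carrier H"
  shows eps_t_eq: "\<epsilon>\<^sub>t h = sw H \<one> (\<lambda>x y. \<epsilon> (x \<otimes> h) \<odot> y)"
    and eps_s_eq: "\<epsilon>\<^sub>s h = sw H \<one> (\<lambda>x y. \<epsilon> (h \<otimes> y) \<odot> x)"
  using assms by (simp_all add: eps_t_def eps_s_def sweedler_eq_tsum bilI)

lemma lin_eps: "lin R H H \<epsilon>\<^sub>t" "lin R H H \<epsilon>\<^sub>s"
  using lin_cong[of H \<epsilon>\<^sub>t "\<lambda>h. sw H \<one> (\<lambda>x y. \<epsilon> (x \<otimes> h) \<odot> y)" R H]
    lin_cong[of H \<epsilon>\<^sub>s "\<lambda>h. sw H \<one> (\<lambda>x y. \<epsilon> (h \<otimes> y) \<odot> x)" R H]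
  by (simp_all add: eps_eq)

lemmas lin_eps_comp [simp] = lin_compD(1)[OF lin_eps(1)] lin_compD(1)[OF lin_eps(2)]
lemmas eps_closed [simp] = lin_compD(2)[OF lin_eps(1)] lin_compD(2)[OF lin_eps(2)]

lemma lin_eps_expand:
  assumes f: "lin R H P f" and h: "h \<in> carrier H"
  shows lin_eps_t: "f (\<epsilon>\<^sub>t h) = sw P \<one> (\<lambda>x y. \<epsilon> (x \<otimes> h) \<odot>\<^bsub>P\<^esub> f y)"
    and lin_eps_s: "f (\<epsilon>\<^sub>s h) = sw P \<one> (\<lambda>x y. \<epsilon> (h \<otimes> y) \<odot>\<^bsub>P\<^esub> f x)"
  using h by (simp_all add: eps_eq tsum_lin[OF f] lin_smult[OF f])

text \<open>Write h as h1'. Then eps_s(h_1 1'_1) \<otimes> h_2 1'_2 = 1_1 \<otimes> \<epsilon>(h_1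
  1'_1 1_2) h_2 1'_2; the unit axiom merges the copies of \<Delta>(1) into 1_1 \<otimes>
  \<epsilon>(h_1 1_2) h_2 1_3, and the counit of h1_2 remains.\<close>

lemma sw_eps_s_left:
  assumes F: "bil R H H P F" and h: "h \<in> carrier H"
  shows "sw P h (\<lambda>a b. F (\<epsilon>\<^sub>s a) b) = sw P \<one> (\<lambda>x y. F x (h \<otimes> y))"
proof -
  note [simp] = bil_compD[OF F] h
  have "sw P h (\<lambda>a b. F (\<epsilon>\<^sub>s a) b) = sw P (h \<otimes> \<one>) (\<lambda>a b. F (\<epsilon>\<^sub>s a) b)"
    by simp
  also have "\<dots> = sw P h (\<lambda>a b. sw P \<one> (\<lambda>x' y'. F (\<epsilon>\<^sub>s (a \<otimes> x')) (b \<otimes> y')))"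
    by (rule sw_mult) (simp_all add: bilI)
  also have "\<dots> = sw P h (\<lambda>a b. sw P \<one> (\<lambda>x' y'. sw P \<one> (\<lambda>x y. \<epsilon> (a \<otimes> (x' \<otimes> y)) \<odot>\<^bsub>P\<^esub> F x (b \<otimes> y'))))"
    by (simp add: lin_eps_s[of P "\<lambda>x. F x _"] mult_assoc)
  also have "\<dots> = sw P h (\<lambda>a b. sw P \<one> (\<lambda>x y. sw P \<one> (\<lambda>x' y'. \<epsilon> (a \<otimes> (x' \<otimes> y)) \<odot>\<^bsub>P\<^esub> F x (b \<otimes> y'))))"
    by (rule tsum_cong, rule tsum_swap) simp_all
  also have "\<dots> = sw P h (\<lambda>a b. sw P \<one> (\<lambda>z y. sw P z (\<lambda>x m. \<epsilon> (a \<otimes> m) \<odot>\<^bsub>P\<^esub> F x (b \<otimes> y))))"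
    by (intro tsum_cong sw_one_right[symmetric] trilI) simp_all
  also have "\<dots> = sw P h (\<lambda>a b. sw P \<one> (\<lambda>x z. sw P z (\<lambda>m y. \<epsilon> (a \<otimes> m) \<odot>\<^bsub>P\<^esub> F x (b \<otimes> y))))"
    by (intro tsum_cong sw_coassoc trilI) simp_all
  also have "\<dots> = sw P \<one> (\<lambda>x z. sw P h (\<lambda>a b. sw P z (\<lambda>m y. \<epsilon> (a \<otimes> m) \<odot>\<^bsub>P\<^esub> F x (b \<otimes> y))))"
    by (rule tsum_swap) simp_all
  also have "\<dots> = sw P \<one> (\<lambda>x z. sw P (h \<otimes> z) (\<lambda>a b. \<epsilon> a \<odot>\<^bsub>P\<^esub> F x b))"
    by (intro tsum_cong sw_mult[symmetric] bilI) simp_all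
  also have "\<dots> = sw P \<one> (\<lambda>x z. F x (h \<otimes> z))"
    by (intro tsum_cong sw_counit_left) simp_all
  finally show ?thesis .
qed

text \<open>The mirror image: h is written as 1'h, and the middle leg 1_1 1'_2 under the counit is
  merged by the unit axiom.\<close>

lemma sw_eps_t_right:
  assumes F: "bil R H H P F" and h: "h \<in> carrier H"
  shows "sw P h (\<lambda>a b. F a (\<epsilon>\<^sub>t b)) = sw P \<one> (\<lambda>x y. F (x \<otimes> h) y)"
proof -
  note [simp] = bil_compD[OF F] h
  have "sw P h (\<lambda>a b. F a (\<epsilon>\<^sub>t b)) = sw P (\<one> \<otimes> h) (\<lambda>a b. F a (\<epsilon>\<^sub>t b))"
    by simp
  also have "\<dots> = sw P \<one> (\<lambda>x' y'. sw P h (\<lambda>a b. F (x' \<otimes> a) (\<epsilon>\<^sub>t (y' \<otimes> b))))"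
    by (rule sw_mult) (simp_all add: bilI)
  also have "\<dots> = sw P h (\<lambda>a b. sw P \<one> (\<lambda>x' y'. F (x' \<otimes> a) (\<epsilon>\<^sub>t (y' \<otimes> b))))"
    by (rule tsum_swap) simp_all
  also have "\<dots> = sw P h (\<lambda>a b. sw P \<one> (\<lambda>x' y'. sw P \<one> (\<lambda>x y. \<epsilon> ((x \<otimes> y') \<otimes> b) \<odot>\<^bsub>P\<^esub> F (x' \<otimes> a) y)))"
    by (simp add: lin_eps_t[of P "F _"] mult_assoc)
  also have "\<dots> = sw P h (\<lambda>a b. sw P \<one> (\<lambda>z y. sw P z (\<lambda>x m. \<epsilon> (m \<otimes> b) \<odot>\<^bsub>P\<^esub> F (x \<otimes> a) y)))"
    by (intro tsum_cong sw_one_right[symmetric] trilI) simp_all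
  also have "\<dots> = sw P \<one> (\<lambda>z y. sw P h (\<lambda>a b. sw P z (\<lambda>x m. \<epsilon> (m \<otimes> b) \<odot>\<^bsub>P\<^esub> F (x \<otimes> a) y)))"
    by (rule tsum_swap) simp_all
  also have "\<dots> = sw P \<one> (\<lambda>z y. sw P z (\<lambda>x m. sw P h (\<lambda>a b. \<epsilon> (m \<otimes> b) \<odot>\<^bsub>P\<^esub> F (x \<otimes> a) y)))"
    by (rule tsum_cong, rule tsum_swap) simp_all
  also have "\<dots> = sw P \<one> (\<lambda>z y. sw P (z \<otimes> h) (\<lambda>a b. \<epsilon> b \<odot>\<^bsub>P\<^esub> F a y))"
    by (intro tsum_cong sw_mult[symmetric] bilI) simp_all
  also have "\<dots> = sw P \<one> (\<lambda>z y. F (z \<otimes> h) y)"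
    by (intro tsum_cong sw_counit_right) simp_all
  finally show ?thesis .
qed

text \<open>With h written as 1h, the value \<epsilon>(x 1_1 h_1) splits along 1_1 by weak
  multiplicativity of the counit. Coassociativity then collects the later legs into \<Delta>(1_2 h),
  whose first leg is removed by the counit law.\<close>

lemma sw_counit_mult_left:
  assumes f: "lin R H P f" and h: "h \<in> carrier H" and x: "x \<in> carrier H"
  shows "sw P h (\<lambda>a b. \<epsilon> (x \<otimes> a) \<odot>\<^bsub>P\<^esub> f b) = sw P \<one> (\<lambda>a b. \<epsilon> (x \<otimes> a) \<odot>\<^bsub>P\<^esub> f (b \<otimes> h))"
proof -
  note [simp] = lin_compD[OF f] h x
  have "sw P h (\<lambda>a b. \<epsilon> (x \<otimes> a) \<odot>\<^bsub>P\<^esub> f b) = sw P (\<one> \<otimes> h) (\<lambda>a b. \<epsilon> (x \<otimes> a) \<odot>\<^bsub>P\<^esub> f b)"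
    by simp
  also have "\<dots> = sw P \<one> (\<lambda>z q. sw P h (\<lambda>a b. \<epsilon> (x \<otimes> (z \<otimes> a)) \<odot>\<^bsub>P\<^esub> f (q \<otimes> b)))"
    by (rule sw_mult) (simp_all add: bilI)
  also have "\<dots> = sw P \<one> (\<lambda>z q. sw P h (\<lambda>a b. sw P z (\<lambda>m n. \<epsilon> (x \<otimes> m) \<odot>\<^bsub>P\<^esub> (\<epsilon> (n \<otimes> a) \<odot>\<^bsub>P\<^esub> f (q \<otimes> b)))))"
    by (intro tsum_cong counit_mult_smult1) simp_all
  also have "\<dots> = sw P \<one> (\<lambda>z q. sw P z (\<lambda>m n. sw P h (\<lambda>a b. \<epsilon> (x \<otimes> m) \<odot>\<^bsub>P\<^esub> (\<epsilon> (n \<otimes> a) \<odot>\<^bsub>P\<^esub> f (q \<otimes> b)))))"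
    by (rule tsum_cong, rule tsum_swap) simp_all
  also have "\<dots> = sw P \<one> (\<lambda>m z. sw P z (\<lambda>n q. sw P h (\<lambda>a b. \<epsilon> (x \<otimes> m) \<odot>\<^bsub>P\<^esub> (\<epsilon> (n \<otimes> a) \<odot>\<^bsub>P\<^esub> f (q \<otimes> b)))))"
    by (rule sw_coassoc) (simp_all add: trilI)
  also have "\<dots> = sw P \<one> (\<lambda>m z. sw P (z \<otimes> h) (\<lambda>a b. \<epsilon> (x \<otimes> m) \<odot>\<^bsub>P\<^esub> (\<epsilon> a \<odot>\<^bsub>P\<^esub> f b)))"
    by (intro tsum_cong sw_mult[symmetric] bilI) simp_all
  also have "\<dots> = sw P \<one> (\<lambda>m z. \<epsilon> (x \<otimes> m) \<odot>\<^bsub>P\<^esub> sw P (z \<otimes> h) (\<lambda>a b. \<epsilon> a \<odot>\<^bsub>P\<^esub> f b))"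
    by (simp add: smult_tsum)
  also have "\<dots> = sw P \<one> (\<lambda>m z. \<epsilon> (x \<otimes> m) \<odot>\<^bsub>P\<^esub> f (z \<otimes> h))"
    by (simp add: sw_counit_left)
  finally show ?thesis .
qed

text \<open>Moves h out of the coproduct and leaves \<open>eps_t\<close> on a leg of \<Delta>(1),
  where it can later be traded for the antipode.\<close>

lemma sw_eps_t_left:
  assumes F: "bil R H H P F" and h: "h \<in> carrier H"
  shows "sw P h (\<lambda>a b. F (\<epsilon>\<^sub>t a) b) = sw P \<one> (\<lambda>a b. F (\<epsilon>\<^sub>t a) (b \<otimes> h))"
proof -
  note [simp] = bil_compD[OF F] h
  have "sw P h (\<lambda>a b. F (\<epsilon>\<^sub>t a) b) = sw P h (\<lambda>a b. sw P \<one> (\<lambda>x y. \<epsilon> (x \<otimes> a) \<odot>\<^bsub>P\<^esub> F y b))"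
    by (simp add: lin_eps_t[of P "\<lambda>x. F x _"])
  also have "\<dots> = sw P \<one> (\<lambda>x y. sw P h (\<lambda>a b. \<epsilon> (x \<otimes> a) \<odot>\<^bsub>P\<^esub> F y b))"
    by (rule tsum_swap) simp_all
  also have "\<dots> = sw P \<one> (\<lambda>x y. sw P \<one> (\<lambda>a b. \<epsilon> (x \<otimes> a) \<odot>\<^bsub>P\<^esub> F y (b \<otimes> h)))"
    by (intro tsum_cong sw_counit_mult_left) simp_all
  also have "\<dots> = sw P \<one> (\<lambda>a b. sw P \<one> (\<lambda>x y. \<epsilon> (x \<otimes> a) \<odot>\<^bsub>P\<^esub> F y (b \<otimes> h)))"
    by (rule tsum_swap) simp_all
  also have "\<dots> = sw P \<one> (\<lambda>a b. F (\<epsilon>\<^sub>t a) (b \<otimes> h))"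
    by (simp add: lin_eps_t[of P "\<lambda>x. F x _"])
  finally show ?thesis .
qed

text \<open>Comultiplying the second leg of \<Delta>(1) gives \<epsilon>(1_1 h) 1_2 \<otimes> 1_3;
  splitting the iterated coproduct of 1 turns the middle leg into 1'_1 1_2 and exposes
  \<open>eps_t\<close> as its right factor.\<close>

lemma sw_eps_t:
  assumes F: "bil R H H P F" and h: "h \<in> carrier H"
  shows "sw P (\<epsilon>\<^sub>t h) F = sw P \<one> (\<lambda>x y. F (x \<otimes> \<epsilon>\<^sub>t h) y)"
proof -
  note [simp] = bil_compD[OF F] h
  have "sw P (\<epsilon>\<^sub>t h) F = sw P \<one> (\<lambda>a z. \<epsilon> (a \<otimes> h) \<odot>\<^bsub>P\<^esub> sw P z F)"
    by (rule lin_eps_t) (simp_all add: bilI)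
  also have "\<dots> = sw P \<one> (\<lambda>a z. sw P z (\<lambda>c d. \<epsilon> (a \<otimes> h) \<odot>\<^bsub>P\<^esub> F c d))"
    by (simp add: smult_tsum)
  also have "\<dots> = sw P \<one> (\<lambda>z d. sw P z (\<lambda>a c. \<epsilon> (a \<otimes> h) \<odot>\<^bsub>P\<^esub> F c d))"
    by (rule sw_coassoc[symmetric]) (simp_all add: trilI)
  also have "\<dots> = sw P \<one> (\<lambda>x y. sw P \<one> (\<lambda>x' y'. \<epsilon> (x \<otimes> h) \<odot>\<^bsub>P\<^esub> F (x' \<otimes> y) y'))"
    by (rule sw_one_right) (simp_all add: trilI)
  also have "\<dots> = sw P \<one> (\<lambda>x' y'. sw P \<one> (\<lambda>x y. \<epsilon> (x \<otimes> h) \<odot>\<^bsub>P\<^esub> F (x' \<otimes> y) y'))"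
    by (rule tsum_swap) simp_all
  finally show "sw P (\<epsilon>\<^sub>t h) F = sw P \<one> (\<lambda>x y. F (x \<otimes> \<epsilon>\<^sub>t h) y)"
    by (simp add: lin_eps_t[of P "\<lambda>z. F (_ \<otimes> z) _"])
qed

lemma sw_eps_s:
  assumes F: "bil R H H P F" and h: "h \<in> carrier H"
  shows "sw P (\<epsilon>\<^sub>s h) F = sw P \<one> (\<lambda>x y. F x (\<epsilon>\<^sub>s h \<otimes> y))"
proof -
  note [simp] = bil_compD[OF F] h
  have "sw P (\<epsilon>\<^sub>s h) F = sw P \<one> (\<lambda>z d. \<epsilon> (h \<otimes> d) \<odot>\<^bsub>P\<^esub> sw P z F)"
    by (rule lin_eps_s) (simp_all add: bilI)
  also have "\<dots> = sw P \<one> (\<lambda>z d. sw P z (\<lambda>a c. \<epsilon> (h \<otimes> d) \<odot>\<^bsub>P\<^esub> F a c))"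
    by (simp add: smult_tsum)
  also have "\<dots> = sw P \<one> (\<lambda>x y. sw P \<one> (\<lambda>x' y'. \<epsilon> (h \<otimes> y') \<odot>\<^bsub>P\<^esub> F x (x' \<otimes> y)))"
    by (rule sw_one_right) (simp_all add: trilI)
  finally show "sw P (\<epsilon>\<^sub>s h) F = sw P \<one> (\<lambda>x y. F x (\<epsilon>\<^sub>s h \<otimes> y))"
    by (simp add: lin_eps_s[of P "\<lambda>z. F _ (z \<otimes> _)"])
qed

text \<open>Both products equal \<epsilon>(1_1 k) \<epsilon>(h 1_3) 1_2: the two weak unit axioms
  split the middle leg in opposite orders.\<close>

lemma eps_s_eps_t_commute:
  assumes [simp]: "h \<in> carrier H" "k \<in> carrier H"
  shows "\<epsilon>\<^sub>s h \<otimes> \<epsilon>\<^sub>t k = \<epsilon>\<^sub>t k \<otimes> \<epsilon>\<^sub>s h"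
proof -
  let ?F = "\<lambda>a b c. \<epsilon> (a \<otimes> k) \<odot> (\<epsilon> (h \<otimes> c) \<odot> b)"
  have F: "tril R H H H H ?F" by (simp add: trilI)
  have "\<epsilon>\<^sub>t k \<otimes> \<epsilon>\<^sub>s h = sw H \<one> (\<lambda>x y. \<epsilon> (x \<otimes> k) \<odot> (y \<otimes> \<epsilon>\<^sub>s h))"
    by (rule lin_eps_t[of H "\<lambda>z. z \<otimes> \<epsilon>\<^sub>s h"]) simp_all
  also have "\<dots> = sw H \<one> (\<lambda>x y. sw H \<one> (\<lambda>x' y'. ?F x (y \<otimes> x') y'))"
    by (simp add: lin_eps_s[of H "\<lambda>z. _ \<otimes> z"] smult_tsum)
  also have "\<dots> = sw H \<one> (\<lambda>x y. sw H \<one> (\<lambda>x' y'. ?F x (x' \<otimes> y) y'))"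
    using sw_one_left[OF F] sw_one_right[OF F] by simp
  also have "\<dots> = sw H \<one> (\<lambda>x y. \<epsilon> (x \<otimes> k) \<odot> (\<epsilon>\<^sub>s h \<otimes> y))"
    by (simp add: lin_eps_s[of H "\<lambda>z. z \<otimes> _"] smult_tsum)
  also have "\<dots> = \<epsilon>\<^sub>s h \<otimes> \<epsilon>\<^sub>t k"
    by (rule lin_eps_t[of H "\<lambda>z. \<epsilon>\<^sub>s h \<otimes> z", symmetric]) simp_all
  finally show ?thesis by simp
qed

text \<open>The dual statement: both sides equal \<epsilon>(1_1 h 1'_2) 1'_1 \<otimes> 1_2, obtained
  from the two forms of weak multiplicativity of the counit.\<close>

lemma sw_eps_s_eps_t_commute:
  assumes F: "bil R H H P F" and h: "h \<in> carrier H"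
  shows "sw P h (\<lambda>a b. F (\<epsilon>\<^sub>s b) (\<epsilon>\<^sub>t a)) = sw P h (\<lambda>a b. F (\<epsilon>\<^sub>s a) (\<epsilon>\<^sub>t b))"
proof -
  note [simp] = bil_compD[OF F] h
  have "sw P h (\<lambda>a b. F (\<epsilon>\<^sub>s b) (\<epsilon>\<^sub>t a))
    = sw P h (\<lambda>a b. sw P \<one> (\<lambda>x y. sw P \<one> (\<lambda>x' y'. \<epsilon> (x \<otimes> a) \<odot>\<^bsub>P\<^esub> (\<epsilon> (b \<otimes> y') \<odot>\<^bsub>P\<^esub> F x' y))))"
    by (simp add: lin_eps_t[of P "F _"] lin_eps_s[of P "\<lambda>z. F z _"] smult_tsum)
  also have "\<dots> = sw P \<one> (\<lambda>x y. sw P h (\<lambda>a b. sw P \<one> (\<lambda>x' y'. \<epsilon> (x \<otimes> a) \<odot>\<^bsub>P\<^esub> (\<epsilon> (b \<otimes> y') \<odot>\<^bsub>P\<^esub> F x' y))))"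
    by (rule tsum_swap) simp_all
  also have "\<dots> = sw P \<one> (\<lambda>x y. sw P \<one> (\<lambda>x' y'. sw P h (\<lambda>a b. \<epsilon> (x \<otimes> a) \<odot>\<^bsub>P\<^esub> (\<epsilon> (b \<otimes> y') \<odot>\<^bsub>P\<^esub> F x' y))))"
    by (rule tsum_cong, rule tsum_swap) simp_all
  \<comment> \<open>Each inner sum over the legs of h folds into \<epsilon>(x h y'), the left one by
    the first counit axiom and the right one by the second.\<close>
  also have "\<dots> = sw P \<one> (\<lambda>x y. sw P \<one> (\<lambda>x' y'. sw P h (\<lambda>a b. \<epsilon> (x \<otimes> b) \<odot>\<^bsub>P\<^esub> (\<epsilon> (a \<otimes> y') \<odot>\<^bsub>P\<^esub> F x' y))))"
    by (simp flip: counit_mult_smult)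
  also have "\<dots> = sw P \<one> (\<lambda>x y. sw P h (\<lambda>a b. sw P \<one> (\<lambda>x' y'. \<epsilon> (x \<otimes> b) \<odot>\<^bsub>P\<^esub> (\<epsilon> (a \<otimes> y') \<odot>\<^bsub>P\<^esub> F x' y))))"
    by (rule tsum_cong, rule tsum_swap) simp_all
  also have "\<dots> = sw P h (\<lambda>a b. sw P \<one> (\<lambda>x y. sw P \<one> (\<lambda>x' y'. \<epsilon> (x \<otimes> b) \<odot>\<^bsub>P\<^esub> (\<epsilon> (a \<otimes> y') \<odot>\<^bsub>P\<^esub> F x' y))))"
    by (rule tsum_swap) simp_all
  also have "\<dots> = sw P h (\<lambda>a b. F (\<epsilon>\<^sub>s a) (\<epsilon>\<^sub>t b))"
    by (simp add: lin_eps_t[of P "F _"] lin_eps_s[of P "\<lambda>z. F z _"] smult_tsum)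
  finally show ?thesis .
qed

text \<open>Weak multiplicativity of the counit with 1 as middle factor; therefore \<epsilon> does
  not distinguish k from eps_t(k) as a right factor.\<close>

lemma counit_mult_eps_t:
  assumes [simp]: "h \<in> carrier H" "k \<in> carrier H"
  shows "\<epsilon> (h \<otimes> \<epsilon>\<^sub>t k) = \<epsilon> (h \<otimes> k)"
proof -
  have "\<epsilon> (h \<otimes> \<epsilon>\<^sub>t k) = sw K \<one> (\<lambda>a b. \<epsilon> (a \<otimes> k) \<otimes>\<^bsub>R\<^esub> \<epsilon> (h \<otimes> b))"
    using lin_eps_t[of K "\<lambda>z. \<epsilon> (h \<otimes> z)" k] by simp
  also have "\<dots> = \<epsilon> (h \<otimes> \<one> \<otimes> k)"
    by (simp add: counit_mult2[of h \<one> k] cring.cring_simprules(14)[OF cring_R] del: mult_one_right)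
  finally show ?thesis by simp
qed

lemma counit_eps_s_mult:
  assumes [simp]: "h \<in> carrier H" "k \<in> carrier H"
  shows "\<epsilon> (\<epsilon>\<^sub>s h \<otimes> k) = \<epsilon> (h \<otimes> k)"
proof -
  have "\<epsilon> (\<epsilon>\<^sub>s h \<otimes> k) = sw K \<one> (\<lambda>a b. \<epsilon> (h \<otimes> b) \<otimes>\<^bsub>R\<^esub> \<epsilon> (a \<otimes> k))"
    using lin_eps_s[of K "\<lambda>z. \<epsilon> (z \<otimes> k)" h] by simp
  also have "\<dots> = \<epsilon> (h \<otimes> \<one> \<otimes> k)"
    by (simp add: counit_mult2[of h \<one> k] del: mult_one_right)
  finally show ?thesis by simp
qed

lemma counit_eps_s: "h \<in> carrier H \<Longrightarrow> \<epsilon> (\<epsilon>\<^sub>s h) = \<epsilon> h"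
  using counit_eps_s_mult[of h \<one>] by simp

lemma eps_t_one: "\<epsilon>\<^sub>t \<one> = \<one>"
  by (simp add: eps_t_eq counit_left)

lemma eps_t_mult_eps_t: "h \<in> carrier H \<Longrightarrow> k \<in> carrier H \<Longrightarrow> \<epsilon>\<^sub>t (h \<otimes> \<epsilon>\<^sub>t k) = \<epsilon>\<^sub>t (h \<otimes> k)"
  by (simp add: eps_t_eq[of "h \<otimes> _"] mult_assoc[symmetric] counit_mult_eps_t)

lemma eps_s_eps_s_mult: "h \<in> carrier H \<Longrightarrow> k \<in> carrier H \<Longrightarrow> \<epsilon>\<^sub>s (\<epsilon>\<^sub>s h \<otimes> k) = \<epsilon>\<^sub>s (h \<otimes> k)"
  by (simp add: eps_s_eq[of "_ \<otimes> k"] mult_assoc counit_eps_s_mult)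

end

section \<open>The antipode of a weak Hopf algebra\<close>

locale weak_hopf = weak_bialg R H
  for R :: "('k, 'r) ring_scheme" and H :: "('k, 'h, 'x) coalgebra_scheme" (structure) +
  fixes S :: "'h \<Rightarrow> 'h"
  assumes antipode_linear: "S \<in> linear_maps R H H"
    and antipode_left: "h \<in> carrier H \<Longrightarrow> sw H h (\<lambda>a b. S a \<otimes> b) = \<epsilon>\<^sub>s h"
    and antipode_right: "h \<in> carrier H \<Longrightarrow> sw H h (\<lambda>a b. a \<otimes> S b) = \<epsilon>\<^sub>t h"
    and antipode_both: "h \<in> carrier H \<Longrightarrow> sw H h (\<lambda>x c. sw H x (\<lambda>a b. S a \<otimes> b \<otimes> S c)) = S h"

lemma weak_hopf_algebra_imp_weak_hopf:
  assumes "weak_hopf_algebra R H S"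
  shows "weak_hopf R H S"
proof -
  interpret algebra_coalgebra R H
    using assms
    by unfold_locales (auto simp: weak_hopf_algebra_def weak_bialgebra_def counital_coalgebra_def)
  interpret weak_bialg R H
    using assms weak_bialgebra_iff by (simp add: weak_hopf_algebra_def)
  have "lin R H H S" using assms by (simp add: weak_hopf_algebra_def lin_def)
  note [simp] = lin_compD[OF this]
  have 3: "sweedler R H H (\<lambda>x c. sweedler R H H (\<lambda>a b. S a \<otimes>\<^bsub>H\<^esub> b \<otimes>\<^bsub>H\<^esub> S c) x) h
    = sw H h (\<lambda>x c. sw H x (\<lambda>a b. S a \<otimes>\<^bsub>H\<^esub> b \<otimes>\<^bsub>H\<^esub> S c))" if "h \<in> carrier H" for h
  proof -
    have "sweedler R H H (\<lambda>x c. sweedler R H H (\<lambda>a b. S a \<otimes>\<^bsub>H\<^esub> b \<otimes>\<^bsub>H\<^esub> S c) x) h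
      = sweedler R H H (\<lambda>x c. sw H x (\<lambda>a b. S a \<otimes>\<^bsub>H\<^esub> b \<otimes>\<^bsub>H\<^esub> S c)) h"
      by (rule sweedler_cong) (simp add: sweedler_eq_tsum bilI)
    then show ?thesis using that by (simp add: sweedler_eq_tsum bilI)
  qed
  show ?thesis
    using assms
    by unfold_locales (simp_all add: weak_hopf_algebra_def sweedler_eq_tsum bilI 3)
qed

context weak_hopf
begin

lemma lin_S: "lin R H H S"
  using antipode_linear by (simp add: lin_def)

lemmas lin_S_comp [simp] = lin_compD(1)[OF lin_S]
lemmas S_closed [simp] = lin_compD(2)[OF lin_S]

text \<open>Besides the two antipode axioms, this regroups the third one in both ways, so that S
  absorbs \<open>eps_s\<close> by convolution from the left and \<open>eps_t\<close> from the right.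
  These absorptions stand in for invertibility.\<close>

lemma sw_antipode:
  assumes f: "lin R H P f" and h: "h \<in> carrier H"
  shows sw_antipode_left: "sw P h (\<lambda>a b. f (S a \<otimes> b)) = f (\<epsilon>\<^sub>s h)"
    and sw_antipode_right: "sw P h (\<lambda>a b. f (a \<otimes> S b)) = f (\<epsilon>\<^sub>t h)"
    and sw_eps_s_antipode: "sw P h (\<lambda>a b. f (\<epsilon>\<^sub>s a \<otimes> S b)) = f (S h)"
    and sw_antipode_eps_t: "sw P h (\<lambda>a b. f (S a \<otimes> \<epsilon>\<^sub>t b)) = f (S h)"
proof -
  note [simp] = lin_compD[OF f] h
  show "sw P h (\<lambda>a b. f (S a \<otimes> b)) = f (\<epsilon>\<^sub>s h)" "sw P h (\<lambda>a b. f (a \<otimes> S b)) = f (\<epsilon>\<^sub>t h)"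
    by (simp_all flip: antipode_left antipode_right add: tsum_lin[OF f])
  have 1: "sw H h (\<lambda>a b. \<epsilon>\<^sub>s a \<otimes> S b) = S h"
    using antipode_both[OF h] by (simp flip: antipode_left add: mult_tsum)
  have "sw H h (\<lambda>a b. S a \<otimes> \<epsilon>\<^sub>t b) = sw H h (\<lambda>a x. sw H x (\<lambda>b c. S a \<otimes> b \<otimes> S c))"
    by (simp flip: antipode_right add: mult_tsum mult_assoc)
  also have "\<dots> = sw H h (\<lambda>x c. sw H x (\<lambda>a b. S a \<otimes> b \<otimes> S c))"
    by (rule sw_coassoc[symmetric]) (simp_all add: trilI)
  finally have 2: "sw H h (\<lambda>a b. S a \<otimes> \<epsilon>\<^sub>t b) = S h" by (simp add: antipode_both)
  show "sw P h (\<lambda>a b. f (\<epsilon>\<^sub>s a \<otimes> S b)) = f (S h)" "sw P h (\<lambda>a b. f (S a \<otimes> \<epsilon>\<^sub>t b)) = f (S h)"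
    using arg_cong[OF 1, of f] arg_cong[OF 2, of f] by (simp_all add: tsum_lin[OF f])
qed

text \<open>S(1) = eps_s(1_1) S(1_2), and for h = 1 the map \<open>eps_s\<close> on the first leg
  disappears, leaving 1_1 S(1_2) = eps_t(1).\<close>

lemma antipode_one: "S \<one> = \<one>"
proof -
  have "S \<one> = sw H \<one> (\<lambda>a b. \<epsilon>\<^sub>s a \<otimes> S b)"
    using sw_eps_s_antipode[of H "\<lambda>x. x" \<one>] by simp
  also have "\<dots> = sw H \<one> (\<lambda>x y. x \<otimes> S (\<one> \<otimes> y))"
    by (rule sw_eps_s_left) (simp_all add: bilI)
  also have "\<dots> = \<one>"
    by (simp add: antipode_right eps_t_one)
  finally show ?thesis .
qed

text \<open>\<epsilon>(S(h)) = \<epsilon>(S(h_1) eps_t(h_2)) = \<epsilon>(S(h_1) h_2) =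
  \<epsilon>(eps_s(h)), since the counit ignores \<open>eps_t\<close> in a right factor.\<close>

lemma counit_antipode:
  assumes [simp]: "h \<in> carrier H" shows "\<epsilon> (S h) = \<epsilon> h"
proof -
  have "\<epsilon> (S h) = sw K h (\<lambda>a b. \<epsilon> (S a \<otimes> \<epsilon>\<^sub>t b))"
    using sw_antipode_eps_t[of K \<epsilon> h] by simp
  also have "\<dots> = \<epsilon> (\<epsilon>\<^sub>s h)"
    using sw_antipode_left[of K \<epsilon> h] by (simp add: counit_mult_eps_t)
  finally show ?thesis by (simp add: counit_eps_s)
qed

text \<open>S(1_1) \<otimes> 1_2 = eps_s(1_1) S(1_2) \<otimes> 1_3. On \<Delta>(1) the map
  \<open>eps_s\<close> on the first leg is invisible, and 1_1 S(1_2) is eps_t of the merged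
  leg.\<close>

lemma sw_one_antipode_left:
  assumes F: "bil R H H P F"
  shows "sw P \<one> (\<lambda>a b. F (S a) b) = sw P \<one> (\<lambda>a b. F (\<epsilon>\<^sub>t a) b)"
proof -
  note [simp] = bil_compD[OF F]
  have "sw P \<one> (\<lambda>a b. F (S a) b) = sw P \<one> (\<lambda>z b. sw P z (\<lambda>a c. F (\<epsilon>\<^sub>s a \<otimes> S c) b))"
    by (simp add: sw_eps_s_antipode[of P "\<lambda>z. F z _"])
  also have "\<dots> = sw P \<one> (\<lambda>a u. sw P u (\<lambda>c b. F (\<epsilon>\<^sub>s a \<otimes> S c) b))"
    by (rule sw_coassoc) (simp_all add: trilI)
  also have "\<dots> = sw P \<one> (\<lambda>a u. sw P (\<one> \<otimes> u) (\<lambda>c b. F (a \<otimes> S c) b))"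
    by (rule sw_eps_s_left) (simp_all add: bilI)
  also have "\<dots> = sw P \<one> (\<lambda>a u. sw P u (\<lambda>c b. F (a \<otimes> S c) b))"
    by simp
  also have "\<dots> = sw P \<one> (\<lambda>z b. sw P z (\<lambda>a c. F (a \<otimes> S c) b))"
    by (rule sw_coassoc[symmetric]) (simp_all add: trilI)
  also have "\<dots> = sw P \<one> (\<lambda>z b. F (\<epsilon>\<^sub>t z) b)"
    by (simp add: sw_antipode_right[of P "\<lambda>z. F z _"])
  finally show ?thesis .
qed

text \<open>Replace k by eps_t(k), whose coproduct is 1_1 eps_t(k) \<otimes> 1_2; the legs of 1 are
  then absorbed into those of h. This avoids the coproduct of a general k.\<close>

lemma eps_t_mult:
  assumes [simp]: "h \<in> carrier H" "k \<in> carrier H"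
  shows "\<epsilon>\<^sub>t (h \<otimes> k) = sw H h (\<lambda>a b. a \<otimes> (\<epsilon>\<^sub>t k \<otimes> S b))"
proof -
  have "\<epsilon>\<^sub>t (h \<otimes> k) = sw H (h \<otimes> \<epsilon>\<^sub>t k) (\<lambda>a b. a \<otimes> S b)"
    by (simp add: antipode_right eps_t_mult_eps_t)
  also have "\<dots> = sw H h (\<lambda>a b. sw H (\<epsilon>\<^sub>t k) (\<lambda>c d. (a \<otimes> c) \<otimes> S (b \<otimes> d)))"
    by (rule sw_mult) (simp_all add: bilI)
  also have "\<dots> = sw H h (\<lambda>a b. sw H \<one> (\<lambda>x y. (a \<otimes> (x \<otimes> \<epsilon>\<^sub>t k)) \<otimes> S (b \<otimes> y)))"
    by (intro tsum_cong sw_eps_t bilI) simp_all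
  also have "\<dots> = sw H h (\<lambda>a b. sw H \<one> (\<lambda>x y. (a \<otimes> x) \<otimes> (\<epsilon>\<^sub>t k \<otimes> S (b \<otimes> y))))"
    by (simp add: mult_assoc)
  also have "\<dots> = sw H (h \<otimes> \<one>) (\<lambda>a b. a \<otimes> (\<epsilon>\<^sub>t k \<otimes> S b))"
    by (rule sw_mult[symmetric]) (simp_all add: bilI)
  finally show ?thesis by simp
qed

lemma eps_s_mult:
  assumes [simp]: "h \<in> carrier H" "k \<in> carrier H"
  shows "\<epsilon>\<^sub>s (h \<otimes> k) = sw H k (\<lambda>a b. S a \<otimes> (\<epsilon>\<^sub>s h \<otimes> b))"
proof -
  have "\<epsilon>\<^sub>s (h \<otimes> k) = sw H (\<epsilon>\<^sub>s h \<otimes> k) (\<lambda>a b. S a \<otimes> b)"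
    by (simp add: antipode_left eps_s_eps_s_mult)
  also have "\<dots> = sw H (\<epsilon>\<^sub>s h) (\<lambda>c d. sw H k (\<lambda>a b. S (c \<otimes> a) \<otimes> (d \<otimes> b)))"
    by (rule sw_mult) (simp_all add: bilI)
  also have "\<dots> = sw H \<one> (\<lambda>x y. sw H k (\<lambda>a b. S (x \<otimes> a) \<otimes> ((\<epsilon>\<^sub>s h \<otimes> y) \<otimes> b)))"
    by (rule sw_eps_s) (simp_all add: bilI)
  also have "\<dots> = sw H \<one> (\<lambda>x y. sw H k (\<lambda>a b. S (x \<otimes> a) \<otimes> (\<epsilon>\<^sub>s h \<otimes> (y \<otimes> b))))"
    by (simp add: mult_assoc)
  also have "\<dots> = sw H (\<one> \<otimes> k) (\<lambda>a b. S a \<otimes> (\<epsilon>\<^sub>s h \<otimes> b))"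
    by (rule sw_mult[symmetric]) (simp_all add: bilI)
  finally show ?thesis by simp
qed

text \<open>
  \<open>S(hk) = S(h\<^sub>1k\<^sub>1) h\<^sub>2k\<^sub>2 S(k\<^sub>3) S(h\<^sub>3) = S(k\<^sub>1) \<epsilon>\<^sub>s(h\<^sub>1) \<epsilon>\<^sub>t(k\<^sub>2) S(h\<^sub>2)\<close>, where the two middle factors commute.
\<close>

lemma antipode_mult:
  assumes [simp]: "h \<in> carrier H" "k \<in> carrier H"
  shows "S (h \<otimes> k) = S k \<otimes> S h"
proof -
  have "S (h \<otimes> k) = sw H (h \<otimes> k) (\<lambda>a b. S a \<otimes> \<epsilon>\<^sub>t b)"
    using sw_antipode_eps_t[of H "\<lambda>x. x" "h \<otimes> k"] by simp
  also have "\<dots> = sw H h (\<lambda>a b. sw H k (\<lambda>c d. S (a \<otimes> c) \<otimes> \<epsilon>\<^sub>t (b \<otimes> d)))"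
    by (rule sw_mult) (simp_all add: bilI)
  also have "\<dots> = sw H h (\<lambda>a b. sw H k (\<lambda>c d. sw H b (\<lambda>b1 b2. S (a \<otimes> c) \<otimes> (b1 \<otimes> (\<epsilon>\<^sub>t d \<otimes> S b2)))))"
    by (simp add: eps_t_mult mult_tsum)
  also have "\<dots> = sw H h (\<lambda>a b. sw H b (\<lambda>b1 b2. sw H k (\<lambda>c d. S (a \<otimes> c) \<otimes> (b1 \<otimes> (\<epsilon>\<^sub>t d \<otimes> S b2)))))"
    by (rule tsum_cong, rule tsum_swap) simp_all
  also have "\<dots> = sw H h (\<lambda>u b2. sw H u (\<lambda>a b1. sw H k (\<lambda>c d. S (a \<otimes> c) \<otimes> (b1 \<otimes> (\<epsilon>\<^sub>t d \<otimes> S b2)))))"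
    by (rule sw_coassoc[symmetric]) (simp_all add: trilI)
  \<comment> \<open>Writing \<open>\<epsilon>\<^sub>t d\<close> as d_1 S(d_2) completes the factor
    S(u_1 v_1) u_2 v_2, which is eps_s(uv).\<close>
  also have "\<dots> = sw H h (\<lambda>u b2. sw H k (\<lambda>v d2. \<epsilon>\<^sub>s (u \<otimes> v) \<otimes> (S d2 \<otimes> S b2)))"
  proof (rule tsum_cong)
    fix u b2 assume [simp]: "u \<in> carrier H" "b2 \<in> carrier H"
    have "sw H u (\<lambda>a b1. sw H k (\<lambda>c d. S (a \<otimes> c) \<otimes> (b1 \<otimes> (\<epsilon>\<^sub>t d \<otimes> S b2))))
      = sw H u (\<lambda>a b1. sw H k (\<lambda>c d. sw H d (\<lambda>d1 d2. S (a \<otimes> c) \<otimes> ((b1 \<otimes> d1) \<otimes> (S d2 \<otimes> S b2)))))"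
      by (simp add: antipode_right[symmetric] mult_tsum mult_assoc)
    also have "\<dots> = sw H u (\<lambda>a b1. sw H k (\<lambda>v d2. sw H v (\<lambda>c d1. S (a \<otimes> c) \<otimes> ((b1 \<otimes> d1) \<otimes> (S d2 \<otimes> S b2)))))"
      by (intro tsum_cong sw_coassoc[symmetric] trilI) simp_all
    also have "\<dots> = sw H k (\<lambda>v d2. sw H u (\<lambda>a b1. sw H v (\<lambda>c d1. S (a \<otimes> c) \<otimes> ((b1 \<otimes> d1) \<otimes> (S d2 \<otimes> S b2)))))"
      by (rule tsum_swap) simp_all
    also have "\<dots> = sw H k (\<lambda>v d2. sw H (u \<otimes> v) (\<lambda>a b. S a \<otimes> (b \<otimes> (S d2 \<otimes> S b2))))"
      by (intro tsum_cong sw_mult[symmetric] bilI) simp_all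
    also have "\<dots> = sw H k (\<lambda>v d2. \<epsilon>\<^sub>s (u \<otimes> v) \<otimes> (S d2 \<otimes> S b2))"
      by (simp add: antipode_left[symmetric] mult_tsum mult_assoc)
    finally show "sw H u (\<lambda>a b1. sw H k (\<lambda>c d. S (a \<otimes> c) \<otimes> (b1 \<otimes> (\<epsilon>\<^sub>t d \<otimes> S b2))))
      = sw H k (\<lambda>v d2. \<epsilon>\<^sub>s (u \<otimes> v) \<otimes> (S d2 \<otimes> S b2))" .
  qed
  also have "\<dots> = sw H h (\<lambda>u b2. S k \<otimes> (\<epsilon>\<^sub>s u \<otimes> S b2))"
  proof (rule tsum_cong)
    fix u b2 assume [simp]: "u \<in> carrier H" "b2 \<in> carrier H"
    have "sw H k (\<lambda>v d2. \<epsilon>\<^sub>s (u \<otimes> v) \<otimes> (S d2 \<otimes> S b2))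
      = sw H k (\<lambda>v d2. sw H v (\<lambda>c d. S c \<otimes> (\<epsilon>\<^sub>s u \<otimes> ((d \<otimes> S d2) \<otimes> S b2))))"
      by (simp add: eps_s_mult mult_tsum mult_assoc)
    also have "\<dots> = sw H k (\<lambda>c w. sw H w (\<lambda>d d2. S c \<otimes> (\<epsilon>\<^sub>s u \<otimes> ((d \<otimes> S d2) \<otimes> S b2))))"
      by (rule sw_coassoc) (simp_all add: trilI)
    also have "\<dots> = sw H k (\<lambda>c w. S c \<otimes> ((\<epsilon>\<^sub>s u \<otimes> \<epsilon>\<^sub>t w) \<otimes> S b2))"
      by (simp add: antipode_right[symmetric] mult_tsum mult_assoc)
    \<comment> \<open>The commutation puts \<open>\<epsilon>\<^sub>t w\<close> next to
      \<open>S c\<close>, and these two sum to S(k).\<close>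
    also have "\<dots> = sw H k (\<lambda>c w. (S c \<otimes> \<epsilon>\<^sub>t w) \<otimes> (\<epsilon>\<^sub>s u \<otimes> S b2))"
      by (simp add: eps_s_eps_t_commute) (simp add: mult_assoc)
    also have "\<dots> = S k \<otimes> (\<epsilon>\<^sub>s u \<otimes> S b2)"
      by (rule sw_antipode_eps_t[of H "\<lambda>x. x \<otimes> (\<epsilon>\<^sub>s u \<otimes> S b2)"]) simp_all
    finally show "sw H k (\<lambda>v d2. \<epsilon>\<^sub>s (u \<otimes> v) \<otimes> (S d2 \<otimes> S b2)) = S k \<otimes> (\<epsilon>\<^sub>s u \<otimes> S b2)" .
  qed
  also have "\<dots> = S k \<otimes> S h"
    by (rule sw_eps_s_antipode[of H "\<lambda>x. S k \<otimes> x"]) simp_all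
  finally show ?thesis .
qed

section \<open>The coproduct of the antipode\<close>

lemma sw_eps_t_adjoint:
  assumes F: "bil R H H P F" and h: "h \<in> carrier H"
  shows "sw P (\<epsilon>\<^sub>t h) F = sw P h (\<lambda>u c. sw P u (\<lambda>a b. F (a \<otimes> S c) (\<epsilon>\<^sub>t b)))"
proof -
  note [simp] = bil_compD[OF F] h
  have "sw P h (\<lambda>u c. sw P u (\<lambda>a b. F (a \<otimes> S c) (\<epsilon>\<^sub>t b)))
    = sw P h (\<lambda>u c. sw P \<one> (\<lambda>x y. F ((x \<otimes> u) \<otimes> S c) y))"
    by (intro tsum_cong sw_eps_t_right bilI) simp_all
  also have "\<dots> = sw P \<one> (\<lambda>x y. sw P h (\<lambda>u c. F ((x \<otimes> u) \<otimes> S c) y))"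
    by (rule tsum_swap) simp_all
  also have "\<dots> = sw P \<one> (\<lambda>x y. F (x \<otimes> \<epsilon>\<^sub>t h) y)"
    by (simp add: mult_assoc sw_antipode_right[of P "\<lambda>z. F (_ \<otimes> z) _"])
  also have "\<dots> = sw P (\<epsilon>\<^sub>t h) F"
    by (rule sw_eps_t[symmetric, OF F h])
  finally show ?thesis by simp
qed

text \<open>Expresses \<Delta>(eps_s(h)) as eps_s(h_2) \<otimes> S(h_1) h_3, that is, the coproduct
  of S(h_1) h_2 without a coproduct of S. This and its mirror image allow \<Delta>(S(h)) to be
  computed.\<close>

lemma sw_eps_s_adjoint:
  assumes F: "bil R H H P F" and h: "h \<in> carrier H"
  shows "sw P (\<epsilon>\<^sub>s h) F = sw P h (\<lambda>a u. sw P u (\<lambda>b c. F (\<epsilon>\<^sub>s b) (S a \<otimes> c)))"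
proof -
  note [simp] = bil_compD[OF F] h
  have "sw P h (\<lambda>a u. sw P u (\<lambda>b c. F (\<epsilon>\<^sub>s b) (S a \<otimes> c)))
    = sw P h (\<lambda>a u. sw P \<one> (\<lambda>x y. F x (S a \<otimes> (u \<otimes> y))))"
    by (intro tsum_cong sw_eps_s_left bilI) simp_all
  also have "\<dots> = sw P \<one> (\<lambda>x y. sw P h (\<lambda>a u. F x ((S a \<otimes> u) \<otimes> y)))"
    by (subst tsum_swap) (simp_all add: mult_assoc)
  also have "\<dots> = sw P \<one> (\<lambda>x y. F x (\<epsilon>\<^sub>s h \<otimes> y))"
    by (simp add: sw_antipode_left[of P "\<lambda>z. F _ (z \<otimes> _)"])
  also have "\<dots> = sw P (\<epsilon>\<^sub>s h) F"
    by (rule sw_eps_s[symmetric, OF F h])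
  finally show ?thesis by simp
qed

text \<open>
  The dual computation: \<open>\<Delta>(S(h)) = \<Delta>(S(h\<^sub>1)) \<Delta>(\<epsilon>\<^sub>t(h\<^sub>2)) = \<epsilon>\<^sub>s(h\<^sub>2) S(h\<^sub>4) \<otimes> S(h\<^sub>1) \<epsilon>\<^sub>t(h\<^sub>3)\<close>,
  where \<open>\<epsilon>\<^sub>s(h\<^sub>2) \<otimes> \<epsilon>\<^sub>t(h\<^sub>3) = \<epsilon>\<^sub>s(h\<^sub>3) \<otimes> \<epsilon>\<^sub>t(h\<^sub>2)\<close>.
\<close>

lemma sw_antipode_comult:
  assumes F: "bil R H H P F" and h: "h \<in> carrier H"
  shows "sw P (S h) F = sw P h (\<lambda>a b. F (S b) (S a))"
proof -
  note [simp] = bil_compD[OF F] h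
  have "sw P (S h) F = sw P h (\<lambda>a b. sw P (S a \<otimes> \<epsilon>\<^sub>t b) F)"
    by (rule sw_antipode_eps_t[symmetric]) (simp_all add: bilI)
  also have "\<dots> = sw P h (\<lambda>a b. sw P b (\<lambda>u e. sw P u (\<lambda>v d. sw P (S a \<otimes> v) (\<lambda>p q. F (p \<otimes> S e) (q \<otimes> S d)))))"
  proof (rule tsum_cong)
    fix a b assume [simp]: "a \<in> carrier H" "b \<in> carrier H"
    have "sw P (S a \<otimes> \<epsilon>\<^sub>t b) F = sw P (S a) (\<lambda>p q. sw P (\<epsilon>\<^sub>t b) (\<lambda>r s. F (p \<otimes> r) (q \<otimes> s)))"
      by (rule sw_mult) (simp_all add: bilI)
    also have "\<dots> = sw P (S a) (\<lambda>p q. sw P b (\<lambda>u e. sw P u (\<lambda>c d. F (p \<otimes> (c \<otimes> S e)) (q \<otimes> \<epsilon>\<^sub>t d))))"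
      by (intro tsum_cong sw_eps_t_adjoint bilI) simp_all
    also have "\<dots> = sw P b (\<lambda>u e. sw P (S a) (\<lambda>p q. sw P u (\<lambda>c d. F (p \<otimes> (c \<otimes> S e)) (q \<otimes> \<epsilon>\<^sub>t d))))"
      by (rule tsum_swap) simp_all
    also have "\<dots> = sw P b (\<lambda>u e. sw P u (\<lambda>v d. sw P (S a \<otimes> v) (\<lambda>p q. F (p \<otimes> S e) (q \<otimes> S d))))"
    proof (rule tsum_cong)
      fix u e assume [simp]: "u \<in> carrier H" "e \<in> carrier H"
      \<comment> \<open>The remaining \<open>\<epsilon>\<^sub>t d\<close> is opened as well, so that
        legs of u can be multiplied onto both legs of \<Delta>(S(a)) and give
        \<Delta>(S(a)v).\<close>
      have "sw P (S a) (\<lambda>p q. sw P u (\<lambda>c d. F (p \<otimes> (c \<otimes> S e)) (q \<otimes> \<epsilon>\<^sub>t d)))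
        = sw P (S a) (\<lambda>p q. sw P u (\<lambda>c z. sw P z (\<lambda>b d. F ((p \<otimes> c) \<otimes> S e) ((q \<otimes> b) \<otimes> S d))))"
        by (simp add: mult_assoc sw_antipode_right[of P "\<lambda>z. F _ (_ \<otimes> z)"])
      also have "\<dots> = sw P (S a) (\<lambda>p q. sw P u (\<lambda>v d. sw P v (\<lambda>c b. F ((p \<otimes> c) \<otimes> S e) ((q \<otimes> b) \<otimes> S d))))"
        by (intro tsum_cong sw_coassoc[symmetric] trilI) simp_all
      also have "\<dots> = sw P u (\<lambda>v d. sw P (S a) (\<lambda>p q. sw P v (\<lambda>c b. F ((p \<otimes> c) \<otimes> S e) ((q \<otimes> b) \<otimes> S d))))"
        by (rule tsum_swap) simp_all
      also have "\<dots> = sw P u (\<lambda>v d. sw P (S a \<otimes> v) (\<lambda>p q. F (p \<otimes> S e) (q \<otimes> S d)))"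
        by (intro tsum_cong sw_mult[symmetric] bilI) simp_all
      finally show "sw P (S a) (\<lambda>p q. sw P u (\<lambda>c d. F (p \<otimes> (c \<otimes> S e)) (q \<otimes> \<epsilon>\<^sub>t d)))
        = sw P u (\<lambda>v d. sw P (S a \<otimes> v) (\<lambda>p q. F (p \<otimes> S e) (q \<otimes> S d)))" .
    qed
    finally show "sw P (S a \<otimes> \<epsilon>\<^sub>t b) F
      = sw P b (\<lambda>u e. sw P u (\<lambda>v d. sw P (S a \<otimes> v) (\<lambda>p q. F (p \<otimes> S e) (q \<otimes> S d))))" .
  qed
  also have "\<dots> = sw P h (\<lambda>w e. sw P w (\<lambda>a u. sw P u (\<lambda>v d. sw P (S a \<otimes> v) (\<lambda>p q. F (p \<otimes> S e) (q \<otimes> S d)))))"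
    by (rule sw_coassoc[symmetric]) (simp_all add: trilI bilI)
  also have "\<dots> = sw P h (\<lambda>w e. sw P w (\<lambda>s r. F (\<epsilon>\<^sub>s r \<otimes> S e) (S s)))"
  proof (rule tsum_cong)
    fix w e assume [simp]: "w \<in> carrier H" "e \<in> carrier H"
    have "sw P w (\<lambda>a u. sw P u (\<lambda>v d. sw P (S a \<otimes> v) (\<lambda>p q. F (p \<otimes> S e) (q \<otimes> S d))))
      = sw P w (\<lambda>z d. sw P z (\<lambda>a v. sw P (S a \<otimes> v) (\<lambda>p q. F (p \<otimes> S e) (q \<otimes> S d))))"
      by (rule sw_coassoc[symmetric]) (simp_all add: trilI bilI)
    \<comment> \<open>Here S is freed from the coproduct: S(a)v sums to eps_s(z), and the coproduct
      of eps_s(z) is known.\<close>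
    also have "\<dots> = sw P w (\<lambda>z d. sw P (\<epsilon>\<^sub>s z) (\<lambda>p q. F (p \<otimes> S e) (q \<otimes> S d)))"
      by (intro tsum_cong sw_antipode_left) (simp_all add: bilI)
    also have "\<dots> = sw P w (\<lambda>z d. sw P z (\<lambda>a u. sw P u (\<lambda>b c. F (\<epsilon>\<^sub>s b \<otimes> S e) ((S a \<otimes> c) \<otimes> S d))))"
      by (intro tsum_cong sw_eps_s_adjoint bilI) simp_all
    also have "\<dots> = sw P w (\<lambda>a t. sw P t (\<lambda>u d. sw P u (\<lambda>b c. F (\<epsilon>\<^sub>s b \<otimes> S e) ((S a \<otimes> c) \<otimes> S d))))"
      by (rule sw_coassoc) (simp_all add: trilI bilI)
    also have "\<dots> = sw P w (\<lambda>a t. sw P t (\<lambda>b r. sw P r (\<lambda>c d. F (\<epsilon>\<^sub>s b \<otimes> S e) ((S a \<otimes> c) \<otimes> S d))))"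
      by (intro tsum_cong sw_coassoc trilI) simp_all
    also have "\<dots> = sw P w (\<lambda>a t. sw P t (\<lambda>b r. F (\<epsilon>\<^sub>s b \<otimes> S e) (S a \<otimes> \<epsilon>\<^sub>t r)))"
      by (simp add: mult_assoc sw_antipode_right[of P "\<lambda>z. F _ (_ \<otimes> z)"])
    also have "\<dots> = sw P w (\<lambda>a t. sw P t (\<lambda>b r. F (\<epsilon>\<^sub>s r \<otimes> S e) (S a \<otimes> \<epsilon>\<^sub>t b)))"
      by (rule tsum_cong, rule sw_eps_s_eps_t_commute[symmetric]) (simp_all add: bilI)
    also have "\<dots> = sw P w (\<lambda>s r. sw P s (\<lambda>a b. F (\<epsilon>\<^sub>s r \<otimes> S e) (S a \<otimes> \<epsilon>\<^sub>t b)))"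
      by (rule sw_coassoc[symmetric]) (simp_all add: trilI)
    also have "\<dots> = sw P w (\<lambda>s r. F (\<epsilon>\<^sub>s r \<otimes> S e) (S s))"
      by (intro tsum_cong sw_antipode_eps_t) simp_all
    finally show "sw P w (\<lambda>a u. sw P u (\<lambda>v d. sw P (S a \<otimes> v) (\<lambda>p q. F (p \<otimes> S e) (q \<otimes> S d))))
      = sw P w (\<lambda>s r. F (\<epsilon>\<^sub>s r \<otimes> S e) (S s))" .
  qed
  also have "\<dots> = sw P h (\<lambda>s k. sw P k (\<lambda>r e. F (\<epsilon>\<^sub>s r \<otimes> S e) (S s)))"
    by (rule sw_coassoc) (simp_all add: trilI)
  also have "\<dots> = sw P h (\<lambda>s k. F (S k) (S s))"
    by (simp add: sw_eps_s_antipode[of P "\<lambda>z. F z _"])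
  finally show ?thesis .
qed

end

section \<open>The inverse of the antipode\<close>

locale weak_hopf_bij = weak_hopf +
  assumes bij: "bij_betw S (carrier H) (carrier H)"
begin

abbreviation antipode_inv ("S''") where "S' \<equiv> antipode_inverse H S"

lemma antipode_inverse [simp]:
  assumes "h \<in> carrier H"
  shows antipode_inv_closed: "S' h \<in> carrier H" and "S (S' h) = h" and "S' (S h) = h"
  unfolding antipode_inverse_def
  using bij_betw_inv_into_right[OF bij assms] bij_betw_inv_into_left[OF bij assms]
    bij_betw_apply[OF bij_betw_inv_into[OF bij] assms] by simp_all

lemma antipode_inj: "x \<in> carrier H \<Longrightarrow> y \<in> carrier H \<Longrightarrow> S x = S y \<Longrightarrow> x = y"
  using bij by (auto simp: bij_betw_def inj_on_def)

text \<open>Since S is injective, an equation for its inverse may be checked after applying S.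
  Products are treated in the same way below.\<close>

lemma lin_antipode_inv: "lin R H H S'"
proof -
  interpret module R H by simp
  have "S' (x \<oplus> y) = S' x \<oplus> S' y" if "x \<in> carrier H" "y \<in> carrier H" for x y
    by (rule antipode_inj) (simp_all add: that lin_add[OF lin_S])
  moreover have "S' (r \<odot> x) = r \<odot> S' x" if "r \<in> carrier R" "x \<in> carrier H" for r x
    by (rule antipode_inj) (simp_all add: that lin_smult[OF lin_S])
  ultimately show ?thesis by (simp add: lin_iff)
qed

lemmas lin_antipode_inv_comp [simp] = lin_compD(1)[OF lin_antipode_inv]

lemma antipode_inv_mult:
  "h \<in> carrier H \<Longrightarrow> k \<in> carrier H \<Longrightarrow> S' (h \<otimes> k) = S' k \<otimes> S' h"
  by (rule antipode_inj) (simp_all add: antipode_mult)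

lemma counit_antipode_inv: "h \<in> carrier H \<Longrightarrow> \<epsilon> (S' h) = \<epsilon> h"
  using counit_antipode[of "S' h"] by simp

text \<open>The formula for \<Delta>(S(x)) at x = S^-1(h), with S^-1 inserted into both arguments of
  \<open>F\<close> to cancel the two antipodes.\<close>

lemma sw_antipode_inv_comult:
  assumes F: "bil R H H P F" and h: "h \<in> carrier H"
  shows "sw P (S' h) F = sw P h (\<lambda>a b. F (S' b) (S' a))"
proof -
  note [simp] = bil_compD[OF F] h
  show ?thesis
    using sw_antipode_comult[of P "\<lambda>a b. F (S' b) (S' a)" "S' h"] by (simp add: bilI)
qed

text \<open>Apply S^-1 to S(h_1) h_2 and to h_1 S(h_2). The product is reversed while the legs keep
  their places, so S^-1 acts as an antipode for the opposite multiplication.\<close>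

lemma sw_antipode_inv:
  assumes f: "lin R H P f" and h: "h \<in> carrier H"
  shows sw_antipode_inv_left: "sw P h (\<lambda>a b. f (S' b \<otimes> a)) = f (S' (\<epsilon>\<^sub>s h))"
    and sw_antipode_inv_right: "sw P h (\<lambda>a b. f (b \<otimes> S' a)) = f (S' (\<epsilon>\<^sub>t h))"
proof -
  note [simp] = lin_compD[OF f] h
  show "sw P h (\<lambda>a b. f (S' b \<otimes> a)) = f (S' (\<epsilon>\<^sub>s h))" "sw P h (\<lambda>a b. f (b \<otimes> S' a)) = f (S' (\<epsilon>\<^sub>t h))"
    using sw_antipode_left[of P "\<lambda>z. f (S' z)" h] sw_antipode_right[of P "\<lambda>z. f (S' z)" h]
    by (simp_all add: antipode_inv_mult)
qed

text \<open>eps_t(h_1) \<otimes> h_2 reduces to eps_t(1_1) \<otimes> 1_2 h, and on \<Delta>(1) the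
  map \<open>eps_t\<close> on the first leg may be replaced by S, which S^-1 cancels.\<close>

lemma sw_antipode_inv_eps_t:
  assumes F: "bil R H H P F" and h: "h \<in> carrier H"
  shows "sw P h (\<lambda>a b. F (S' (\<epsilon>\<^sub>t a)) b) = sw P \<one> (\<lambda>x y. F x (y \<otimes> h))"
proof -
  note [simp] = bil_compD[OF F] h
  have "sw P h (\<lambda>a b. F (S' (\<epsilon>\<^sub>t a)) b) = sw P \<one> (\<lambda>x y. F (S' (\<epsilon>\<^sub>t x)) (y \<otimes> h))"
    by (rule sw_eps_t_left) (simp_all add: bilI)
  also have "\<dots> = sw P \<one> (\<lambda>x y. F (S' (S x)) (y \<otimes> h))"
    by (rule sw_one_antipode_left[symmetric]) (simp_all add: bilI)
  finally show ?thesis by simp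
qed

text \<open>\<Delta>(1) = \<Delta>(S(1)) = S(1_2) \<otimes> S(1_1); applying S^-1 to the first leg
  gives 1_2 \<otimes> S(1_1).\<close>

lemma sw_one_antipode_inv:
  assumes F: "bil R H H P F"
  shows "sw P \<one> (\<lambda>x y. F (S' x) y) = sw P \<one> (\<lambda>x y. F y (S x))"
proof -
  note [simp] = bil_compD[OF F]
  show ?thesis
    using sw_antipode_comult[of P "\<lambda>x y. F (S' x) y" \<one>] by (simp add: bilI antipode_one)
qed

end

section \<open>Opposite and tensor product weak bialgebras\<close>

lemma opposite_simps [simp]:
  "x \<otimes>\<^bsub>opposite H\<^esub> y = y \<otimes>\<^bsub>H\<^esub> x" "\<one>\<^bsub>opposite H\<^esub> = \<one>\<^bsub>H\<^esub>"
  "comult (opposite H) = comult H" "counit (opposite H) = counit H"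
  by (simp_all add: opposite_def)

text \<open>Reversing the multiplication interchanges the two weak unit axioms and the two weak
  counit axioms.\<close>

lemma weak_bialg_opposite:
  fixes H :: "('k, 'h) coalgebra"
  assumes "weak_bialg R H"
  shows "weak_bialg R (opposite H)"
proof -
  interpret weak_bialg R H by fact
  interpret mod: module R H by simp
  interpret ring H by (rule ring_H)
  have "monoid (opposite H)"
    by (rule monoidI) (simp_all add: mult_assoc)
  moreover have "abelian_group (opposite H)"
    using module_H same_mod_tensor(12)[OF same_mod_opposite, of R H] by (simp add: module_def)
  ultimately have "ring (opposite H)"
    by (intro ringI) (simp_all add: l_distr r_distr)
  then have ua: "unital_algebra R (opposite H)"
    using unital_algebra by (simp add: unital_algebra_def)
  interpret O: algebra_coalgebra R "opposite H"
    using ua lin_comult lin_counit by unfold_locales (simp_all add: lin_def linear_maps_def)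
  show ?thesis
  proof unfold_locales
    fix h k assume "h \<in> carrier (opposite H)" "k \<in> carrier (opposite H)"
    then have [simp]: "h \<in> carrier H" "k \<in> carrier H" by simp_all
    show "comult (opposite H) (h \<otimes>\<^bsub>opposite H\<^esub> k) = O.sw O.HH h (\<lambda>a b. O.sw O.HH k
        (\<lambda>c d. pure_tensor R (opposite H) (opposite H) (a \<otimes>\<^bsub>opposite H\<^esub> c) (b \<otimes>\<^bsub>opposite H\<^esub> d)))"
      using comult_mult[of k h] by simp (rule tsum_swap, simp_all)
    fix l assume "l \<in> carrier (opposite H)"
    then have [simp]: "l \<in> carrier H" by simp
    show "counit (opposite H) (h \<otimes>\<^bsub>opposite H\<^esub> k \<otimes>\<^bsub>opposite H\<^esub> l) = O.sw K k
        (\<lambda>a b. counit (opposite H) (h \<otimes>\<^bsub>opposite H\<^esub> a) \<otimes>\<^bsub>R\<^esub> counit (opposite H) (b \<otimes>\<^bsub>opposite H\<^esub> l))"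
      using counit_mult2[of l k h] by (simp add: mult_assoc cring.cring_simprules(14)[OF cring_R])
    show "counit (opposite H) (h \<otimes>\<^bsub>opposite H\<^esub> k \<otimes>\<^bsub>opposite H\<^esub> l) = O.sw K k
        (\<lambda>a b. counit (opposite H) (h \<otimes>\<^bsub>opposite H\<^esub> b) \<otimes>\<^bsub>R\<^esub> counit (opposite H) (a \<otimes>\<^bsub>opposite H\<^esub> l))"
      using counit_mult1[of l k h] by (simp add: mult_assoc cring.cring_simprules(14)[OF cring_R])
  qed (use coassoc counit_left counit_right comult_one_left comult_one_right in simp_all)
qed

text \<open>Compared one argument at a time: with the other argument fixed, a linear map on a tensor
  product is determined by pure tensors.\<close>

lemma bil_tensor_eqI:
  assumes f: "bil R (tensor R M N) (tensor R M' N') P f" and g: "bil R (tensor R M N) (tensor R M' N') P g"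
    and M: "module R M" "module R N" "module R M'" "module R N'"
    and eq: "\<And>m n m' n'. m \<in> carrier M \<Longrightarrow> n \<in> carrier N \<Longrightarrow> m' \<in> carrier M' \<Longrightarrow> n' \<in> carrier N' \<Longrightarrow>
      f (pure_tensor R M N m n) (pure_tensor R M' N' m' n') = g (pure_tensor R M N m n) (pure_tensor R M' N' m' n')"
    and t: "t \<in> carrier (tensor R M N)" and u: "u \<in> carrier (tensor R M' N')"
  shows "f t u = g t u"
proof (rule lin_tensor_eqI[OF bil_lin1[OF f u] bil_lin1[OF g u] M(1,2) _ t])
  fix m n assume mn: "m \<in> carrier M" "n \<in> carrier N"
  then have p: "pure_tensor R M N m n \<in> carrier (tensor R M N)" using M by simp
  show "f (pure_tensor R M N m n) u = g (pure_tensor R M N m n) u"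
    by (rule lin_tensor_eqI[OF bil_lin2[OF f p] bil_lin2[OF g p] M(3,4) _ u]) (rule eq[OF mn])
qed

lemma tril_tensor_eqI:
  assumes f: "tril R (tensor R M N) (tensor R M N) (tensor R M N) P f"
    and g: "tril R (tensor R M N) (tensor R M N) (tensor R M N) P g"
    and M: "module R M" "module R N"
    and eq: "\<And>a b c d e h. a \<in> carrier M \<Longrightarrow> b \<in> carrier N \<Longrightarrow> c \<in> carrier M \<Longrightarrow> d \<in> carrier N \<Longrightarrow>
      e \<in> carrier M \<Longrightarrow> h \<in> carrier N \<Longrightarrow>
      f (pure_tensor R M N a b) (pure_tensor R M N c d) (pure_tensor R M N e h)
      = g (pure_tensor R M N a b) (pure_tensor R M N c d) (pure_tensor R M N e h)"
    and t: "t \<in> carrier (tensor R M N)" "u \<in> carrier (tensor R M N)" "v \<in> carrier (tensor R M N)"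
  shows "f t u v = g t u v"
proof (rule bil_tensor_eqI[where f="\<lambda>t u. f t u v" and g="\<lambda>t u. g t u v"])
  show "bil R (tensor R M N) (tensor R M N) P (\<lambda>t u. f t u v)" "bil R (tensor R M N) (tensor R M N) P (\<lambda>t u. g t u v)"
    using f g t by (auto simp: tril_def)
  fix a b c d assume "a \<in> carrier M" "b \<in> carrier N" "c \<in> carrier M" "d \<in> carrier N"
  note * = this
  have p: "pure_tensor R M N a b \<in> carrier (tensor R M N)" "pure_tensor R M N c d \<in> carrier (tensor R M N)"
    using M * by simp_all
  have l: "lin R (tensor R M N) (tensor R M N) (\<lambda>v. v)" using M by simp
  show "f (pure_tensor R M N a b) (pure_tensor R M N c d) v = g (pure_tensor R M N a b) (pure_tensor R M N c d) v"
    by (rule lin_tensor_eqI[OF tril_compD(3)[OF f l p] tril_compD(3)[OF g l p] M _ t(3)]) (rule eq[OF *])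
qed (use M t in auto)

section \<open>The tensor product of two weak bialgebras\<close>

locale two_weak_bialg = G: weak_bialg R G + H: weak_bialg R H
  for R :: "('k, 'r) ring_scheme" and G :: "('k, 'g, 'x) coalgebra_scheme"
    and H :: "('k, 'h, 'y) coalgebra_scheme"
begin

abbreviation GH where "GH \<equiv> tensor R G H"
abbreviation B where "B \<equiv> tensor_bialgebra R G H"
abbreviation pt where "pt \<equiv> pure_tensor R G H"
abbreviation pt2 where "pt2 \<equiv> pure_tensor R GH GH"

lemma one_B: "\<one>\<^bsub>B\<^esub> = pt \<one>\<^bsub>G\<^esub> \<one>\<^bsub>H\<^esub>"
  by (simp add: tensor_bialgebra_def tensor_algebra_def)

lemma mult_B_eq:
  assumes "t \<in> carrier GH" "u \<in> carrier GH"
  shows "t \<otimes>\<^bsub>B\<^esub> u = tsum R G H GH t (\<lambda>a b. tsum R G H GH u (\<lambda>c d. pt (a \<otimes>\<^bsub>G\<^esub> c) (b \<otimes>\<^bsub>H\<^esub> d)))"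
  using assms
  by (simp add: tensor_bialgebra_def tensor_algebra_def tensor_lift_eq_tsum bilI cong: tensor_lift_cong)

lemma bil_mult_B: "bil R GH GH GH (\<otimes>\<^bsub>B\<^esub>)"
  using bil_cong[of GH GH "\<lambda>t u. t \<otimes>\<^bsub>B\<^esub> u"
      "\<lambda>t u. tsum R G H GH t (\<lambda>a b. tsum R G H GH u (\<lambda>c d. pt (a \<otimes>\<^bsub>G\<^esub> c) (b \<otimes>\<^bsub>H\<^esub> d)))" R GH, OF mult_B_eq]
  by (simp add: bilI)

lemmas mult_B_rules [simp] = bil_compD[OF bil_mult_B]

lemma mult_B_pure [simp]:
  "a \<in> carrier G \<Longrightarrow> b \<in> carrier H \<Longrightarrow> c \<in> carrier G \<Longrightarrow> d \<in> carrier H \<Longrightarrow>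
    pt a b \<otimes>\<^bsub>B\<^esub> pt c d = pt (a \<otimes>\<^bsub>G\<^esub> c) (b \<otimes>\<^bsub>H\<^esub> d)"
  by (simp add: mult_B_eq tsum_pure bilI)

lemma mult_B_assoc:
  "t \<in> carrier GH \<Longrightarrow> u \<in> carrier GH \<Longrightarrow> v \<in> carrier GH \<Longrightarrow> t \<otimes>\<^bsub>B\<^esub> u \<otimes>\<^bsub>B\<^esub> v = t \<otimes>\<^bsub>B\<^esub> (u \<otimes>\<^bsub>B\<^esub> v)"
  by (rule tril_tensor_eqI[of R G H GH "\<lambda>t u v. t \<otimes>\<^bsub>B\<^esub> u \<otimes>\<^bsub>B\<^esub> v" "\<lambda>t u v. t \<otimes>\<^bsub>B\<^esub> (u \<otimes>\<^bsub>B\<^esub> v)"])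
    (simp_all add: trilI G.mult_assoc H.mult_assoc)

lemma mult_B_one:
  assumes "t \<in> carrier GH" shows "\<one>\<^bsub>B\<^esub> \<otimes>\<^bsub>B\<^esub> t = t" "t \<otimes>\<^bsub>B\<^esub> \<one>\<^bsub>B\<^esub> = t"
  using assms lin_tensor_eqI[of R G H GH "\<lambda>t. \<one>\<^bsub>B\<^esub> \<otimes>\<^bsub>B\<^esub> t" "\<lambda>t. t" t]
    lin_tensor_eqI[of R G H GH "\<lambda>t. t \<otimes>\<^bsub>B\<^esub> \<one>\<^bsub>B\<^esub>" "\<lambda>t. t" t]
  by (simp_all add: one_B)

lemma unital_algebra_B: "unital_algebra R B"
proof -
  have mod: "module R B" by simp
  have "ring B"
  proof (rule ringI)
    show "abelian_group B" using mod by (simp add: module_def)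
    show "monoid B"
      by (rule monoidI) (simp_all add: mult_B_assoc mult_B_one, simp add: one_B)
  qed (use bilD[OF bil_mult_B] in \<open>simp_all add: lin_iff\<close>)
  then show ?thesis
    using mod bilD[OF bil_mult_B] by (simp add: unital_algebra_def lin_iff)
qed

lemma comult_B_eq:
  assumes "t \<in> carrier GH"
  shows "comult B t = tsum R G H (tensor R GH GH) t (\<lambda>g h. G.sw (tensor R GH GH) g (\<lambda>g1 g2.
    H.sw (tensor R GH GH) h (\<lambda>h1 h2. pt2 (pt g1 h1) (pt g2 h2))))"
  using assms
  by (simp add: tensor_bialgebra_def sweedler_def tensor_lift_eq_tsum bilI cong: tensor_lift_cong)

lemma counit_B_eq:
  assumes "t \<in> carrier GH"
  shows "counit B t = tsum R G H H.K t (\<lambda>g h. counit G g \<otimes>\<^bsub>R\<^esub> counit H h)"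
  using assms by (simp add: tensor_bialgebra_def H.tensor_lift_scalar tensor_lift_eq_tsum bilI)

lemma lin_comult_B: "lin R GH (tensor R GH GH) (comult B)"
  using lin_cong[of GH "comult B", OF comult_B_eq, of R "tensor R GH GH"] by (simp add: bilI)

lemma lin_counit_B: "lin R GH H.K (counit B)"
  using lin_cong[of GH "counit B", OF counit_B_eq, of R H.K] by (simp add: bilI)

lemmas lin_B_rules [simp] = lin_compD(1,2)[OF lin_comult_B] lin_compD(1)[OF lin_counit_B]

lemma counit_B_closed [simp]: "t \<in> carrier GH \<Longrightarrow> counit B t \<in> carrier R"
  using lin_compD(2)[OF lin_counit_B] by simp

sublocale B: algebra_coalgebra R B
  using unital_algebra_B lin_comult_B lin_counit_B
  by unfold_locales (simp_all add: lin_def linear_maps_def hom_def)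

lemma comult_B_pure:
  assumes "g \<in> carrier G" "h \<in> carrier H"
  shows "comult B (pt g h) = G.sw (tensor R GH GH) g (\<lambda>g1 g2. H.sw (tensor R GH GH) h (\<lambda>h1 h2. pt2 (pt g1 h1) (pt g2 h2)))"
  using assms by (simp add: comult_B_eq tsum_pure bilI)

lemma counit_B_pure [simp]:
  "g \<in> carrier G \<Longrightarrow> h \<in> carrier H \<Longrightarrow> counit B (pt g h) = counit G g \<otimes>\<^bsub>R\<^esub> counit H h"
  by (simp add: counit_B_eq tsum_pure bilI)

lemma sw_B_pure:
  assumes F: "bil R GH GH P F" and "g \<in> carrier G" "h \<in> carrier H"
  shows "tsum R GH GH P (comult B (pt g h)) F = G.sw P g (\<lambda>g1 g2. H.sw P h (\<lambda>h1 h2. F (pt g1 h1) (pt g2 h2)))"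
proof -
  note [simp] = bil_compD[OF F]
  show ?thesis using assms by (simp add: comult_B_pure tsum_tsum tsum_pure)
qed

text \<open>On a pure tensor the sums over the legs of \<open>G\<close> and of \<open>H\<close>
  alternate; once they are interchanged, the axiom of each factor applies by itself.
  Multiplicativity and the unit axioms follow the same pattern.\<close>

lemma coassoc_B:
  assumes "t \<in> carrier GH"
  shows "tsum R GH GH (tensor R GH (tensor R GH GH)) (comult B t) (\<lambda>x c. tsum R GH GH (tensor R GH (tensor R GH GH)) (comult B x)
      (\<lambda>a b. pure_tensor R GH (tensor R GH GH) a (pt2 b c)))
    = tsum R GH GH (tensor R GH (tensor R GH GH)) (comult B t) (\<lambda>a x. tsum R GH GH (tensor R GH (tensor R GH GH)) (comult B x)
      (\<lambda>b c. pure_tensor R GH (tensor R GH GH) a (pt2 b c)))"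
    (is "?L t = ?R t")
proof (rule lin_tensor_eqI[of R G H "tensor R GH (tensor R GH GH)" ?L ?R])
  let ?P = "tensor R GH (tensor R GH GH)"
  fix g h assume [simp]: "g \<in> carrier G" "h \<in> carrier H"
  let ?Q = "\<lambda>g1 g2 g3 h1 h2 h3. pure_tensor R GH (tensor R GH GH) (pt g1 h1) (pt2 (pt g2 h2) (pt g3 h3))"
  have "?L (pt g h) = G.sw ?P g (\<lambda>x g3. H.sw ?P h (\<lambda>y h3. G.sw ?P x (\<lambda>g1 g2. H.sw ?P y (\<lambda>h1 h2. ?Q g1 g2 g3 h1 h2 h3))))"
    by (simp add: sw_B_pure bilI)
  also have "\<dots> = G.sw ?P g (\<lambda>x g3. G.sw ?P x (\<lambda>g1 g2. H.sw ?P h (\<lambda>y h3. H.sw ?P y (\<lambda>h1 h2. ?Q g1 g2 g3 h1 h2 h3))))"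
    by (rule tsum_cong, rule tsum_swap) simp_all
  also have "\<dots> = G.sw ?P g (\<lambda>g1 x. G.sw ?P x (\<lambda>g2 g3. H.sw ?P h (\<lambda>y h3. H.sw ?P y (\<lambda>h1 h2. ?Q g1 g2 g3 h1 h2 h3))))"
    by (rule G.sw_coassoc) (simp_all add: trilI)
  also have "\<dots> = G.sw ?P g (\<lambda>g1 x. G.sw ?P x (\<lambda>g2 g3. H.sw ?P h (\<lambda>h1 y. H.sw ?P y (\<lambda>h2 h3. ?Q g1 g2 g3 h1 h2 h3))))"
    by (intro tsum_cong H.sw_coassoc) (simp_all add: trilI)
  also have "\<dots> = G.sw ?P g (\<lambda>g1 x. H.sw ?P h (\<lambda>h1 y. G.sw ?P x (\<lambda>g2 g3. H.sw ?P y (\<lambda>h2 h3. ?Q g1 g2 g3 h1 h2 h3))))"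
    by (rule tsum_cong, rule tsum_swap) simp_all
  also have "\<dots> = ?R (pt g h)"
    by (simp add: sw_B_pure bilI)
  finally show "?L (pt g h) = ?R (pt g h)" .
qed (use assms in \<open>simp_all add: bilI\<close>)

lemma counit_left_B: "t \<in> carrier GH \<Longrightarrow> tsum R GH GH GH (comult B t) (\<lambda>a b. counit B a \<odot>\<^bsub>GH\<^esub> b) = t" (is "_ \<Longrightarrow> ?L t = t")
  and counit_right_B: "t \<in> carrier GH \<Longrightarrow> tsum R GH GH GH (comult B t) (\<lambda>a b. counit B b \<odot>\<^bsub>GH\<^esub> a) = t" (is "_ \<Longrightarrow> ?R t = t")
proof -
  interpret GH: module R GH by simp
  have "?L (pt g h) = pt g h" if [simp]: "g \<in> carrier G" "h \<in> carrier H" for g h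
  proof -
    have "?L (pt g h) = G.sw GH g (\<lambda>a b. counit G a \<odot>\<^bsub>GH\<^esub> H.sw GH h (\<lambda>c d. counit H c \<odot>\<^bsub>GH\<^esub> pt b d))"
      by (simp add: sw_B_pure bilI GH.smult_assoc1 smult_tsum)
    also have "\<dots> = G.sw GH g (\<lambda>a b. counit G a \<odot>\<^bsub>GH\<^esub> pt b h)"
      by (simp add: H.sw_counit_left)
    also have "\<dots> = pt g h"
      by (rule G.sw_counit_left) simp_all
    finally show ?thesis .
  qed
  moreover have "?R (pt g h) = pt g h" if [simp]: "g \<in> carrier G" "h \<in> carrier H" for g h
  proof -
    have "?R (pt g h) = G.sw GH g (\<lambda>a b. counit G b \<odot>\<^bsub>GH\<^esub> H.sw GH h (\<lambda>c d. counit H d \<odot>\<^bsub>GH\<^esub> pt a c))"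
      by (simp add: sw_B_pure bilI GH.smult_assoc1 smult_tsum)
    also have "\<dots> = G.sw GH g (\<lambda>a b. counit G b \<odot>\<^bsub>GH\<^esub> pt a h)"
      by (simp add: H.sw_counit_right)
    also have "\<dots> = pt g h"
      by (rule G.sw_counit_right) simp_all
    finally show ?thesis .
  qed
  ultimately show "t \<in> carrier GH \<Longrightarrow> ?L t = t" "t \<in> carrier GH \<Longrightarrow> ?R t = t"
    using lin_tensor_eqI[of R G H GH ?L "\<lambda>t. t" t] lin_tensor_eqI[of R G H GH ?R "\<lambda>t. t" t]
    by (simp_all add: bilI)
qed

lemma comult_mult_B:
  assumes "t \<in> carrier GH" "u \<in> carrier GH"
  shows "comult B (t \<otimes>\<^bsub>B\<^esub> u) = tsum R GH GH (tensor R GH GH) (comult B t) (\<lambda>a b.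
    tsum R GH GH (tensor R GH GH) (comult B u) (\<lambda>c d. pt2 (a \<otimes>\<^bsub>B\<^esub> c) (b \<otimes>\<^bsub>B\<^esub> d)))" (is "?L t u = ?R t u")
proof (rule bil_tensor_eqI[of R G H G H "tensor R GH GH" ?L ?R])
  let ?P = "tensor R GH GH"
  fix g h g' h' assume [simp]: "g \<in> carrier G" "h \<in> carrier H" "g' \<in> carrier G" "h' \<in> carrier H"
  let ?Q = "\<lambda>a b c d a' b' c' d'. pt2 (pt (a \<otimes>\<^bsub>G\<^esub> a') (c \<otimes>\<^bsub>H\<^esub> c')) (pt (b \<otimes>\<^bsub>G\<^esub> b') (d \<otimes>\<^bsub>H\<^esub> d'))"
  have "?L (pt g h) (pt g' h') = G.sw ?P g (\<lambda>a b. G.sw ?P g' (\<lambda>a' b'. H.sw ?P (h \<otimes>\<^bsub>H\<^esub> h') (\<lambda>c d.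
      pt2 (pt (a \<otimes>\<^bsub>G\<^esub> a') c) (pt (b \<otimes>\<^bsub>G\<^esub> b') d))))"
    by (simp add: comult_B_pure) (rule G.sw_mult, simp_all add: bilI)
  also have "\<dots> = G.sw ?P g (\<lambda>a b. G.sw ?P g' (\<lambda>a' b'. H.sw ?P h (\<lambda>c d. H.sw ?P h' (\<lambda>c' d'. ?Q a b c d a' b' c' d'))))"
    by (intro tsum_cong H.sw_mult) (simp_all add: bilI)
  also have "\<dots> = G.sw ?P g (\<lambda>a b. H.sw ?P h (\<lambda>c d. G.sw ?P g' (\<lambda>a' b'. H.sw ?P h' (\<lambda>c' d'. ?Q a b c d a' b' c' d'))))"
    by (rule tsum_cong, rule tsum_swap) simp_all
  also have "\<dots> = ?R (pt g h) (pt g' h')"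
    by (simp add: sw_B_pure bilI)
  finally show "?L (pt g h) (pt g' h') = ?R (pt g h) (pt g' h')" .
qed (use assms in \<open>simp_all add: bilI\<close>)

lemma comult_one_B:
  defines "P \<equiv> tensor R (tensor R GH GH) GH"
  shows "tsum R GH GH P (comult B \<one>\<^bsub>B\<^esub>) (\<lambda>x c. pure_tensor R (tensor R GH GH) GH (comult B x) c)
      = tsum R GH GH P (comult B \<one>\<^bsub>B\<^esub>) (\<lambda>x y. tsum R GH GH P (comult B \<one>\<^bsub>B\<^esub>)
          (\<lambda>x' y'. pure_tensor R (tensor R GH GH) GH (pt2 x (y \<otimes>\<^bsub>B\<^esub> x')) y'))" (is "?L = ?R1")
    and "tsum R GH GH P (comult B \<one>\<^bsub>B\<^esub>) (\<lambda>x c. pure_tensor R (tensor R GH GH) GH (comult B x) c)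
      = tsum R GH GH P (comult B \<one>\<^bsub>B\<^esub>) (\<lambda>x y. tsum R GH GH P (comult B \<one>\<^bsub>B\<^esub>)
          (\<lambda>x' y'. pure_tensor R (tensor R GH GH) GH (pt2 x (x' \<otimes>\<^bsub>B\<^esub> y)) y'))" (is "?L = ?R2")
proof -
  have [simp]: "module R P" by (simp add: P_def)
  let ?Q = "\<lambda>g1 g2 g3 h1 h2 h3. pure_tensor R (tensor R GH GH) GH (pt2 (pt g1 h1) (pt g2 h2)) (pt g3 h3)"
  have "?L = G.sw P \<one>\<^bsub>G\<^esub> (\<lambda>x g3. H.sw P \<one>\<^bsub>H\<^esub> (\<lambda>y h3. G.sw P x (\<lambda>g1 g2. H.sw P y (\<lambda>h1 h2. ?Q g1 g2 g3 h1 h2 h3))))"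
    by (simp add: one_B sw_B_pure bilI P_def) (simp add: comult_B_pure pure_tsum)
  also have "\<dots> = G.sw P \<one>\<^bsub>G\<^esub> (\<lambda>x g3. G.sw P x (\<lambda>g1 g2. H.sw P \<one>\<^bsub>H\<^esub> (\<lambda>y h3. H.sw P y (\<lambda>h1 h2. ?Q g1 g2 g3 h1 h2 h3))))"
    by (rule tsum_cong, rule tsum_swap) (simp_all add: P_def)
  \<comment> \<open>The common starting point of both unit axioms: all sums over legs in
    \<open>G\<close> stand outside those over \<open>H\<close>.\<close>
  finally have L: "?L = \<dots>" .
  also have "\<dots> = G.sw P \<one>\<^bsub>G\<^esub> (\<lambda>a b. G.sw P \<one>\<^bsub>G\<^esub> (\<lambda>a' b'. H.sw P \<one>\<^bsub>H\<^esub> (\<lambda>y h3. H.sw P y (\<lambda>h1 h2. ?Q a (b \<otimes>\<^bsub>G\<^esub> a') b' h1 h2 h3))))"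
    by (rule G.sw_one_left) (simp_all add: trilI P_def)
  also have "\<dots> = G.sw P \<one>\<^bsub>G\<^esub> (\<lambda>a b. G.sw P \<one>\<^bsub>G\<^esub> (\<lambda>a' b'. H.sw P \<one>\<^bsub>H\<^esub> (\<lambda>c d. H.sw P \<one>\<^bsub>H\<^esub> (\<lambda>c' d'. ?Q a (b \<otimes>\<^bsub>G\<^esub> a') b' c (d \<otimes>\<^bsub>H\<^esub> c') d'))))"
    by (rule tsum_cong, rule tsum_cong, rule H.sw_one_left) (simp_all add: trilI P_def)
  also have "\<dots> = G.sw P \<one>\<^bsub>G\<^esub> (\<lambda>a b. H.sw P \<one>\<^bsub>H\<^esub> (\<lambda>c d. G.sw P \<one>\<^bsub>G\<^esub> (\<lambda>a' b'. H.sw P \<one>\<^bsub>H\<^esub> (\<lambda>c' d'. ?Q a (b \<otimes>\<^bsub>G\<^esub> a') b' c (d \<otimes>\<^bsub>H\<^esub> c') d'))))"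
    by (rule tsum_cong, rule tsum_swap) (simp_all add: P_def)
  also have "\<dots> = ?R1"
    by (simp add: one_B sw_B_pure bilI P_def)
  finally show "?L = ?R1" .
  note L
  also have "G.sw P \<one>\<^bsub>G\<^esub> (\<lambda>x g3. G.sw P x (\<lambda>g1 g2. H.sw P \<one>\<^bsub>H\<^esub> (\<lambda>y h3. H.sw P y (\<lambda>h1 h2. ?Q g1 g2 g3 h1 h2 h3))))
    = G.sw P \<one>\<^bsub>G\<^esub> (\<lambda>a b. G.sw P \<one>\<^bsub>G\<^esub> (\<lambda>a' b'. H.sw P \<one>\<^bsub>H\<^esub> (\<lambda>y h3. H.sw P y (\<lambda>h1 h2. ?Q a (a' \<otimes>\<^bsub>G\<^esub> b) b' h1 h2 h3))))"
    by (rule G.sw_one_right) (simp_all add: trilI P_def)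
  also have "\<dots> = G.sw P \<one>\<^bsub>G\<^esub> (\<lambda>a b. G.sw P \<one>\<^bsub>G\<^esub> (\<lambda>a' b'. H.sw P \<one>\<^bsub>H\<^esub> (\<lambda>c d. H.sw P \<one>\<^bsub>H\<^esub> (\<lambda>c' d'. ?Q a (a' \<otimes>\<^bsub>G\<^esub> b) b' c (c' \<otimes>\<^bsub>H\<^esub> d) d'))))"
    by (rule tsum_cong, rule tsum_cong, rule H.sw_one_right) (simp_all add: trilI P_def)
  also have "\<dots> = G.sw P \<one>\<^bsub>G\<^esub> (\<lambda>a b. H.sw P \<one>\<^bsub>H\<^esub> (\<lambda>c d. G.sw P \<one>\<^bsub>G\<^esub> (\<lambda>a' b'. H.sw P \<one>\<^bsub>H\<^esub> (\<lambda>c' d'. ?Q a (a' \<otimes>\<^bsub>G\<^esub> b) b' c (c' \<otimes>\<^bsub>H\<^esub> d) d'))))"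
    by (rule tsum_cong, rule tsum_swap) (simp_all add: P_def)
  also have "\<dots> = ?R2"
    by (simp add: one_B sw_B_pure bilI P_def)
  finally show "?L = ?R2" .
qed

lemma counit_mult_B:
  assumes "t \<in> carrier GH" "u \<in> carrier GH" "v \<in> carrier GH"
  shows "counit B (t \<otimes>\<^bsub>B\<^esub> u \<otimes>\<^bsub>B\<^esub> v) = tsum R GH GH H.K (comult B u) (\<lambda>a b. counit B (t \<otimes>\<^bsub>B\<^esub> a) \<otimes>\<^bsub>R\<^esub> counit B (b \<otimes>\<^bsub>B\<^esub> v))"
      (is "?L t u v = ?R1 t u v")
    and "counit B (t \<otimes>\<^bsub>B\<^esub> u \<otimes>\<^bsub>B\<^esub> v) = tsum R GH GH H.K (comult B u) (\<lambda>a b. counit B (t \<otimes>\<^bsub>B\<^esub> b) \<otimes>\<^bsub>R\<^esub> counit B (a \<otimes>\<^bsub>B\<^esub> v))"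
      (is "?L t u v = ?R2 t u v")
proof -
  interpret R: cring R by simp
  \<comment> \<open>Brings the two counit values from \<open>G\<close> together and likewise those
    from \<open>H\<close>, so that each factor's axiom can be recognised.\<close>
  have m: "(x \<otimes>\<^bsub>R\<^esub> y) \<otimes>\<^bsub>R\<^esub> (z \<otimes>\<^bsub>R\<^esub> w) = (x \<otimes>\<^bsub>R\<^esub> z) \<otimes>\<^bsub>R\<^esub> (y \<otimes>\<^bsub>R\<^esub> w)"
    if "x \<in> carrier R" "y \<in> carrier R" "z \<in> carrier R" "w \<in> carrier R" for x y z w
    using that by (simp add: R.m_ac)
  have "?L (pt a b) (pt c d) (pt e f) = ?R1 (pt a b) (pt c d) (pt e f)"
    and "?L (pt a b) (pt c d) (pt e f) = ?R2 (pt a b) (pt c d) (pt e f)"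
    if [simp]: "a \<in> carrier G" "b \<in> carrier H" "c \<in> carrier G" "d \<in> carrier H" "e \<in> carrier G" "f \<in> carrier H"
    for a b c d e f
    by (simp add: G.counit_mult1 H.counit_mult1 sw_B_pure bilI scalar_mult_tsum m, rule tsum_swap; simp)
      (simp add: G.counit_mult2 H.counit_mult2 sw_B_pure bilI scalar_mult_tsum m, rule tsum_swap; simp)
  then show "?L t u v = ?R1 t u v" "?L t u v = ?R2 t u v"
    using assms tril_tensor_eqI[of R G H H.K ?L ?R1 t u v] tril_tensor_eqI[of R G H H.K ?L ?R2 t u v]
    by (simp_all add: trilI bilI)
qed

text \<open>The locale axioms speak of tensor powers of \<open>B\<close>; the module normal form
  turns them into tensor powers of \<open>GH\<close>, for which they have been proved.\<close>

sublocale B: weak_bialg R B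
  by unfold_locales
    (simp only: same_mod_rules opposite_simps regular_module_simps,
      (rule coassoc_B counit_left_B counit_right_B comult_mult_B comult_one_B counit_mult_B; simp))+

end

lemma same_mod_tensor_map:
  assumes "same_mod M M'"
  shows "tensor_map R M N P Q f1 g1 = tensor_map R M' N P Q f1 g1"
    "tensor_map R N M P Q f2 g2 = tensor_map R N M' P Q f2 g2"
    "tensor_map R N P M Q f3 g3 = tensor_map R N P M' Q f3 g3"
    "tensor_map R N P Q M f4 g4 = tensor_map R N P Q M' f4 g4"
    "tensor_assoc R M N P = tensor_assoc R M' N P"
    "tensor_assoc R N M P = tensor_assoc R N M' P"
    "tensor_assoc R N P M = tensor_assoc R N P M'"
  by (simp_all add: tensor_map_def tensor_assoc_def same_mod_tensor[OF assms])

lemmas same_mod_map_rules [simp] =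
  same_mod_tensor_map[OF same_mod_tensor_bialgebra] same_mod_tensor_map[OF same_mod_opposite]

section \<open>The weak Doi-Hopf datum\<close>

locale weak_hopf_datum = weak_hopf_bij R H S
  for R :: "('k, 'r) ring_scheme" and H :: "('k, 'h) coalgebra" (structure) and S :: "'h \<Rightarrow> 'h"
begin

sublocale T: two_weak_bialg R "opposite H" H
  by (intro two_weak_bialg.intro weak_bialg_opposite weak_bialg_axioms)

abbreviation Henv where "Henv \<equiv> tensor_bialgebra R (opposite H) H"
abbreviation pH where "pH \<equiv> pure_tensor R H H"
abbreviation coact where "coact \<equiv> yd_coaction R H S"

lemmas sw_Henv_pure = T.sw_B_pure[simplified]
lemmas mult_Henv_pure [simp] = T.mult_B_pure[simplified]
lemmas Henv_rules [simp] = T.mult_B_rules[simplified] T.lin_B_rules[simplified] T.counit_B_closed[simplified]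
  T.counit_B_pure[simplified]
lemmas one_Henv = T.one_B[simplified]

section \<open>The comodule algebra\<close>

lemma coact_eq:
  assumes "h \<in> carrier H"
  shows "coact h = sw (tensor R H HH) h (\<lambda>x c. sw (tensor R H HH) x (\<lambda>a b. pure_tensor R H HH b (pH (S' a) c)))"
proof -
  have "coact h = sweedler R H (tensor R H HH) (\<lambda>x c. sweedler R H (tensor R H HH)
      (\<lambda>a b. pure_tensor R H HH b (pH (S' a) c)) x) h"
    by (simp add: yd_coaction_def sweedler_def)
  also have "\<dots> = sweedler R H (tensor R H HH) (\<lambda>x c. sw (tensor R H HH) x (\<lambda>a b. pure_tensor R H HH b (pH (S' a) c))) h"
    by (rule sweedler_cong) (simp add: sweedler_eq_tsum bilI)
  also have "\<dots> = sw (tensor R H HH) h (\<lambda>x c. sw (tensor R H HH) x (\<lambda>a b. pure_tensor R H HH b (pH (S' a) c)))"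
    using assms by (simp add: sweedler_eq_tsum bilI)
  finally show ?thesis .
qed

lemma lin_coact: "lin R H (tensor R H HH) coact"
  using lin_cong[of H coact, OF coact_eq, of R "tensor R H HH"] by (simp add: bilI)

lemmas coact_rules [simp] = lin_compD(1,2)[OF lin_coact]

lemma tsum_coact:
  assumes F: "bil R H HH P F" and h: "h \<in> carrier H"
  shows "tsum R H HH P (coact h) F = sw P h (\<lambda>x c. sw P x (\<lambda>a b. F b (pH (S' a) c)))"
proof -
  note [simp] = bil_compD[OF F]
  show ?thesis using h F by (simp add: coact_eq tsum_tsum tsum_pure)
qed

text \<open>Both sides are h_3 \<otimes> (S^-1(h_2) \<otimes> h_4) \<otimes> (S^-1(h_1) \<otimes>
  h_5). The right side contains \<Delta>(S^-1(h_1)), and S^-1 reversing coproducts gives the indices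
  2 and 1 in this order.\<close>

lemma coact_coassoc:
  assumes h: "h \<in> carrier H"
  shows "tensor_assoc R H Henv Henv (tensor_map R H Henv (tensor R H Henv) Henv coact (\<lambda>c. c) (coact h))
    = tensor_map R H Henv H (tensor R Henv Henv) (\<lambda>m. m) (comult Henv) (coact h)"
proof -
  define P where "P = tensor R H (tensor R HH HH)"
  have [simp]: "module R P" by (simp add: P_def)
  \<comment> \<open>\<open>a\<close>, \<open>p\<close>, \<open>q\<close>, \<open>d\<close>,
    \<open>e\<close> will be the legs h_1 to h_5. The term is folded and has its own linearity
    rules, so that regrouping the five legs never touches its shape.\<close>
  define Y where "Y a p q d e = pure_tensor R H (tensor R HH HH) q (pure_tensor R HH HH (pH (S' p) d) (pH (S' a) e))"
    for a p q d e
  have Y: "Y a p q d e \<in> carrier P" "lin R X H f \<Longrightarrow> lin R X P (\<lambda>x. Y (f x) p q d e)"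
     "lin R X H f \<Longrightarrow> lin R X P (\<lambda>x. Y a (f x) q d e)" "lin R X H f \<Longrightarrow> lin R X P (\<lambda>x. Y a p (f x) d e)"
     "lin R X H f \<Longrightarrow> lin R X P (\<lambda>x. Y a p q (f x) e)" "lin R X H f \<Longrightarrow> lin R X P (\<lambda>x. Y a p q d (f x))"
    if "a \<in> carrier H" "p \<in> carrier H" "q \<in> carrier H" "d \<in> carrier H" "e \<in> carrier H"
    for a p q d e f and X :: "('k, 'z, 'zz) module_scheme"
    using that by (simp_all add: Y_def P_def)
  note [simp] = Y
  have "tensor_assoc R H Henv Henv (tensor_map R H Henv (tensor R H Henv) Henv coact (\<lambda>c. c) (coact h))
    = tsum R H HH P (coact h) (\<lambda>u p. tsum R H HH P (coact u) (\<lambda>m n. pure_tensor R H (tensor R HH HH) m (pure_tensor R HH HH n p)))"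
    using h by (simp add: tensor_map_eq tensor_assoc_eq lin_coact tsum_tsum tsum_pure bilI P_def)
  also have "\<dots> = sw P h (\<lambda>x e. sw P x (\<lambda>a b. sw P b (\<lambda>y d. sw P y (\<lambda>p q. Y a p q d e))))"
    using h by (simp add: tsum_coact bilI P_def Y_def)
  also have "\<dots> = sw P h (\<lambda>x e. sw P x (\<lambda>y d. sw P y (\<lambda>a z. sw P z (\<lambda>p q. Y a p q d e))))"
    by (rule tsum_cong, rule sw_coassoc[symmetric]) (simp_all add: trilI bilI)
  also have "\<dots> = sw P h (\<lambda>x e. sw P x (\<lambda>y d. sw P y (\<lambda>z q. sw P z (\<lambda>a p. Y a p q d e))))"
    by (rule tsum_cong, rule tsum_cong, rule sw_coassoc[symmetric]) (simp_all add: trilI)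
  also have "\<dots> = sw P h (\<lambda>x c. sw P c (\<lambda>d e. sw P x (\<lambda>z q. sw P z (\<lambda>a p. Y a p q d e))))"
    by (rule sw_coassoc) (use h in \<open>simp_all add: trilI bilI\<close>)
  also have "\<dots> = sw P h (\<lambda>x c. sw P x (\<lambda>z q. sw P c (\<lambda>d e. sw P z (\<lambda>a p. Y a p q d e))))"
    by (rule tsum_cong, rule tsum_swap) simp_all
  also have "\<dots> = sw P h (\<lambda>x c. sw P x (\<lambda>z q. sw P z (\<lambda>a p. sw P c (\<lambda>d e. Y a p q d e))))"
    by (rule tsum_cong, rule tsum_cong, rule tsum_swap) simp_all
  also have "\<dots> = sw P h (\<lambda>x c. sw P x (\<lambda>a b. pure_tensor R H (tensor R HH HH) b (comult Henv (pH (S' a) c))))"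
  proof (intro tsum_cong)
    fix x c z q assume [simp]: "x \<in> carrier H" "c \<in> carrier H" "z \<in> carrier H" "q \<in> carrier H"
    have "pure_tensor R H (tensor R HH HH) q (comult Henv (pH (S' z) c))
      = sw P (S' z) (\<lambda>p a. sw P c (\<lambda>d e. pure_tensor R H (tensor R HH HH) q (pure_tensor R HH HH (pH p d) (pH a e))))"
      using T.comult_B_pure[of "S' z" c] by (simp add: pure_tsum P_def)
    also have "\<dots> = sw P z (\<lambda>a p. sw P c (\<lambda>d e. Y a p q d e))"
      by (simp add: sw_antipode_inv_comult bilI Y_def P_def)
    finally show "sw P z (\<lambda>a p. sw P c (\<lambda>d e. Y a p q d e))
      = pure_tensor R H (tensor R HH HH) q (comult Henv (pH (S' z) c))" by simp
  qed
  also have "\<dots> = tensor_map R H Henv H (tensor R Henv Henv) (\<lambda>m. m) (comult Henv) (coact h)"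
    using h T.lin_comult_B by (simp add: tensor_map_eq tsum_coact bilI P_def)
  finally show ?thesis .
qed

lemma coact_counit:
  assumes h: "h \<in> carrier H"
  shows "tensor_lift R H Henv H (\<lambda>m0 m1. counit Henv m1 \<odot> m0) (coact h) = h"
proof -
  interpret mod: module R H by simp
  have "tensor_lift R H Henv H (\<lambda>m0 m1. counit Henv m1 \<odot> m0) (coact h)
    = sw H h (\<lambda>x c. sw H x (\<lambda>a b. (\<epsilon> a \<otimes>\<^bsub>R\<^esub> \<epsilon> c) \<odot> b))"
    using h by (simp add: tensor_lift_eq_tsum tsum_coact bilI counit_antipode_inv)
  also have "\<dots> = sw H h (\<lambda>x c. \<epsilon> c \<odot> sw H x (\<lambda>a b. \<epsilon> a \<odot> b))"
    by (simp add: smult_tsum mod.m_comm mod.smult_assoc1)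
  also have "\<dots> = h"
    using h by (simp add: counit_left counit_right)
  finally show ?thesis .
qed

text \<open>In H^op the elements S^-1(h_1) and S^-1(k_1) multiply to S^-1(k_1) S^-1(h_1) = S^-1(h_1
  k_1).\<close>

lemma coact_mult:
  assumes [simp]: "h \<in> carrier H" "k \<in> carrier H"
  shows "coact h \<otimes>\<^bsub>tensor_algebra R H Henv\<^esub> coact k = coact (h \<otimes> k)"
proof -
  \<comment> \<open>Borrows the multiplication formula of a tensor product for H \<otimes> (H^op
    \<otimes> H).\<close>
  interpret U: two_weak_bialg R H Henv
    by (intro two_weak_bialg.intro T.B.weak_bialg_axioms weak_bialg_axioms)
  define P where "P = tensor R H HH"
  have [simp]: "module R P" by (simp add: P_def)
  let ?Q = "\<lambda>a b c a' b' c'. pure_tensor R H HH (b \<otimes> b') (pH (S' (a \<otimes> a')) (c \<otimes> c'))"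
  have "coact h \<otimes>\<^bsub>tensor_algebra R H Henv\<^esub> coact k
    = tsum R H HH P (coact h) (\<lambda>b c. tsum R H HH P (coact k) (\<lambda>b' c'. pure_tensor R H HH (b \<otimes> b') (c \<otimes>\<^bsub>Henv\<^esub> c')))"
    using U.mult_B_eq[of "coact h" "coact k"] by (simp add: tensor_bialgebra_def[of R H] P_def)
  also have "\<dots> = sw P h (\<lambda>x c. sw P x (\<lambda>a b. sw P k (\<lambda>y d. sw P y (\<lambda>a' b'. ?Q a b c a' b' d))))"
    by (simp add: tsum_coact bilI P_def antipode_inv_mult)
  also have "\<dots> = sw P h (\<lambda>x c. sw P k (\<lambda>y d. sw P x (\<lambda>a b. sw P y (\<lambda>a' b'. ?Q a b c a' b' d))))"
    by (rule tsum_cong, rule tsum_swap) (simp_all add: P_def)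
  also have "\<dots> = sw P h (\<lambda>x c. sw P k (\<lambda>y d. sw P (x \<otimes> y) (\<lambda>a b. pure_tensor R H HH b (pH (S' a) (c \<otimes> d)))))"
    by (intro tsum_cong sw_mult[symmetric]) (simp_all add: bilI P_def)
  also have "\<dots> = sw P (h \<otimes> k) (\<lambda>x c. sw P x (\<lambda>a b. pure_tensor R H HH b (pH (S' a) c)))"
    by (rule sw_mult[symmetric]) (simp_all add: bilI P_def)
  finally show ?thesis by (simp add: coact_eq P_def)
qed

text \<open>The target counital map of H^op, written with the multiplication of H.\<close>

definition eps_op where "eps_op k = sw H \<one> (\<lambda>x y. \<epsilon> (k \<otimes> x) \<odot> y)"

lemma lin_eps_op: "lin R H H eps_op"
  unfolding eps_op_def by simp

lemmas lin_eps_op_rules [simp] = lin_compD(1,2)[OF lin_eps_op]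

text \<open>1_1 \<otimes> \<epsilon>(1_2 1'_1) 1'_2 is the iterated coproduct of 1 with the counit
  on its middle leg.\<close>

lemma sw_one_eps_op:
  assumes F: "bil R H H P F"
  shows "sw P \<one> (\<lambda>x y. F x (eps_op y)) = sw P \<one> (\<lambda>x y. F x y)"
proof -
  note [simp] = bil_compD[OF F]
  have "sw P \<one> (\<lambda>x y. F x (eps_op y)) = sw P \<one> (\<lambda>x y. sw P \<one> (\<lambda>x' y'. \<epsilon> (y \<otimes> x') \<odot>\<^bsub>P\<^esub> F x y'))"
    by (simp add: eps_op_def tsum_lin[OF bil_lin2[OF F]] lin_smult[OF bil_lin2[OF F]])
  also have "\<dots> = sw P \<one> (\<lambda>z c. sw P z (\<lambda>a b. \<epsilon> b \<odot>\<^bsub>P\<^esub> F a c))"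
    by (rule sw_one_left[symmetric]) (simp_all add: trilI)
  also have "\<dots> = sw P \<one> (\<lambda>z c. F z c)"
    by (simp add: sw_counit_right[of P "\<lambda>z. F z _"])
  finally show ?thesis .
qed

text \<open>Unit, coproduct and counit of a tensor product are taken factorwise, hence so is its
  target map.\<close>

lemma eps_t_Henv_pure:
  assumes [simp]: "k \<in> carrier H" "h \<in> carrier H"
  shows "eps_t R Henv (pH k h) = pH (eps_op k) (\<epsilon>\<^sub>t h)"
proof -
  interpret mod: module R HH by simp
  have "eps_t R Henv (pH k h) = sw HH \<one> (\<lambda>x y. sw HH \<one> (\<lambda>x' y'. (\<epsilon> (k \<otimes> x) \<otimes>\<^bsub>R\<^esub> \<epsilon> (x' \<otimes> h)) \<odot>\<^bsub>HH\<^esub> pH y y'))"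
    using T.B.eps_t_eq[of "pH k h"] by (simp add: one_Henv sw_Henv_pure bilI)
  also have "\<dots> = sw HH \<one> (\<lambda>x y. \<epsilon> (k \<otimes> x) \<odot>\<^bsub>HH\<^esub> pH y (\<epsilon>\<^sub>t h))"
    by (simp add: mod.smult_assoc1 lin_eps_t[of HH "pH _"] smult_tsum)
  also have "\<dots> = pH (eps_op k) (\<epsilon>\<^sub>t h)"
    using lin_smult[OF bil_lin1[OF bil_pure_tensor[of R H H]]] by (simp add: eps_op_def pure_tsum)
  finally show ?thesis .
qed

text \<open>The target map acts on the outer legs of \<Delta>(1) only. On the last leg it is
  absorbed by \<Delta>(1); on S^-1(1_1) it first has to be moved to a second leg.\<close>

lemma coact_one: "tensor_map R H Henv H Henv (\<lambda>a. a) (eps_t R Henv) (coact \<one>) = coact \<one>"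
proof -
  define P where "P = tensor R H HH"
  have [simp]: "module R P" by (simp add: P_def)
  let ?Z = "\<lambda>a b c. pure_tensor R H HH b (pH a c)"
  have 1: "lin R HH HH (eps_t R Henv)" using T.B.lin_eps by simp
  have "tensor_map R H Henv H Henv (\<lambda>a. a) (eps_t R Henv) (coact \<one>)
    = sw P \<one> (\<lambda>z c. sw P z (\<lambda>a b. ?Z (eps_op (S' a)) b (\<epsilon>\<^sub>t c)))"
    by (simp add: tensor_map_eq 1 lin_compD[OF 1] tsum_coact bilI P_def eps_t_Henv_pure)
  also have "\<dots> = sw P \<one> (\<lambda>z c. sw P (z \<otimes> \<one>) (\<lambda>a b. ?Z (eps_op (S' a)) b c))"
    by (rule sw_eps_t_right) (simp_all add: bilI P_def)
  also have "\<dots> = sw P \<one> (\<lambda>z c. sw P z (\<lambda>a b. ?Z (eps_op (S' a)) b c))"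
    by simp
  also have "\<dots> = sw P \<one> (\<lambda>a u. sw P u (\<lambda>b c. ?Z (eps_op (S' a)) b c))"
    by (rule sw_coassoc) (simp_all add: trilI P_def)
  \<comment> \<open>S^-1(1_1) \<otimes> 1_2 = 1_2 \<otimes> S(1_1) puts \<open>eps_op\<close> on the
    second leg of \<Delta>(1), where it acts trivially; the same identity then restores
    S^-1.\<close>
  also have "\<dots> = sw P \<one> (\<lambda>x y. sw P (S x) (\<lambda>b c. ?Z (eps_op y) b c))"
    by (rule sw_one_antipode_inv) (simp_all add: bilI P_def)
  also have "\<dots> = sw P \<one> (\<lambda>x y. sw P (S x) (\<lambda>b c. ?Z y b c))"
    by (rule sw_one_eps_op) (simp_all add: bilI P_def)
  also have "\<dots> = sw P \<one> (\<lambda>a u. sw P u (\<lambda>b c. ?Z (S' a) b c))"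
    by (rule sw_one_antipode_inv[symmetric]) (simp_all add: bilI P_def)
  also have "\<dots> = sw P \<one> (\<lambda>z c. sw P z (\<lambda>a b. ?Z (S' a) b c))"
    by (rule sw_coassoc[symmetric]) (simp_all add: trilI P_def)
  finally show ?thesis by (simp add: coact_eq P_def)
qed

lemma right_comodule_algebra_coact: "right_comodule_algebra R Henv H coact"
  unfolding right_comodule_algebra_def right_comodule_def
  using lin_coact unital_algebra coact_coassoc coact_counit coact_mult coact_one
  by (simp add: lin_def linear_maps_def)

section \<open>The module coalgebra\<close>

abbreviation env_act where "env_act \<equiv> yd_action R H"

lemma env_act_eq:
  "t \<in> carrier HH \<Longrightarrow> c \<in> carrier H \<Longrightarrow> env_act t c = tsum R H H H t (\<lambda>k h. h \<otimes> c \<otimes> k)"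
  by (simp add: yd_action_def tensor_lift_eq_tsum bilI)

lemma bil_env_act: "bil R HH H H env_act"
  using bil_cong[of HH H env_act "\<lambda>t c. tsum R H H H t (\<lambda>k h. h \<otimes> c \<otimes> k)" R H, OF env_act_eq]
  by (simp add: bilI)

lemmas env_act_rules [simp] = bil_compD[OF bil_env_act]

lemma env_act_pure [simp]:
  "k \<in> carrier H \<Longrightarrow> h \<in> carrier H \<Longrightarrow> c \<in> carrier H \<Longrightarrow> env_act (pH k h) c = h \<otimes> c \<otimes> k"
  by (simp add: env_act_eq tsum_pure bilI)

lemma left_module_env_act: "left_module R Henv H env_act"
  unfolding left_module_def
proof (intro conjI ballI)
  show "module R H" by simp
  show "env_act a \<in> linear_maps R H H" if "a \<in> carrier Henv" for a
    using bil_lin2[OF bil_env_act, of a] that by (simp add: lin_def)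
  show "(\<lambda>a. env_act a m) \<in> linear_maps R Henv H" if "m \<in> carrier H" for m
    using bil_lin1[OF bil_env_act, of m] that by (simp add: lin_def linear_maps_def hom_def)
  show "env_act (a \<otimes>\<^bsub>Henv\<^esub> b) m = env_act a (env_act b m)"
    if "a \<in> carrier Henv" "b \<in> carrier Henv" "m \<in> carrier H" for a b m
    using bil_tensor_eqI[of R H H H H H "\<lambda>a b. env_act (a \<otimes>\<^bsub>Henv\<^esub> b) m" "\<lambda>a b. env_act a (env_act b m)" a b] that
    by (simp add: bilI mult_assoc)
  show "env_act \<one>\<^bsub>Henv\<^esub> m = m" if "m \<in> carrier H" for m
    using that by (simp add: one_Henv)
qed

lemma comult_env_act:
  assumes "b \<in> carrier HH" and [simp]: "c \<in> carrier H"
  shows "comult H (env_act b c) = tsum R HH HH HH (comult Henv b) (\<lambda>b1 b2. sw HH c (\<lambda>c1 c2. pH (env_act b1 c1) (env_act b2 c2)))"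
    (is "?L b = ?R b")
proof (rule lin_tensor_eqI[of R H H HH ?L ?R])
  fix k h assume [simp]: "k \<in> carrier H" "h \<in> carrier H"
  let ?Q = "\<lambda>h1 h2 c1 c2 k1 k2. pH ((h1 \<otimes> c1) \<otimes> k1) ((h2 \<otimes> c2) \<otimes> k2)"
  have "?L (pH k h) = sw HH (h \<otimes> c \<otimes> k) pH"
    by (simp add: sw_pure)
  also have "\<dots> = sw HH (h \<otimes> c) (\<lambda>x y. sw HH k (\<lambda>k1 k2. pH (x \<otimes> k1) (y \<otimes> k2)))"
    by (rule sw_mult) (simp_all add: bilI)
  also have "\<dots> = sw HH k (\<lambda>k1 k2. sw HH (h \<otimes> c) (\<lambda>x y. pH (x \<otimes> k1) (y \<otimes> k2)))"
    by (rule tsum_swap) simp_all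
  also have "\<dots> = sw HH k (\<lambda>k1 k2. sw HH h (\<lambda>h1 h2. sw HH c (\<lambda>c1 c2. ?Q h1 h2 c1 c2 k1 k2)))"
    by (intro tsum_cong sw_mult) (simp_all add: bilI)
  also have "\<dots> = ?R (pH k h)"
    by (simp add: sw_Henv_pure bilI)
  finally show "?L (pH k h) = ?R (pH k h)" .
qed (use assms in \<open>simp_all add: bilI\<close>)

text \<open>In \<epsilon>(h h' c k' k) the counit is split at h' by the second weak axiom and at k'
  by the first. Thus h meets h'_2 and k meets k'_2, while h'_1 c k'_1 stays together.\<close>

lemma counit_env_act:
  assumes "b \<in> carrier HH" "b' \<in> carrier HH" and [simp]: "c \<in> carrier H"
  shows "\<epsilon> (env_act (b \<otimes>\<^bsub>Henv\<^esub> b') c) = tsum R HH HH K (comult Henv b') (\<lambda>b1 b2. counit Henv (b \<otimes>\<^bsub>Henv\<^esub> b2) \<otimes>\<^bsub>R\<^esub> \<epsilon> (env_act b1 c))"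
    (is "?L b b' = ?R b b'")
proof (rule bil_tensor_eqI[of R H H H H K ?L ?R])
  interpret R: cring R by simp
  fix k h k' h' assume [simp]: "k \<in> carrier H" "h \<in> carrier H" "k' \<in> carrier H" "h' \<in> carrier H"
  have "?L (pH k h) (pH k' h') = \<epsilon> (h \<otimes> h' \<otimes> (c \<otimes> (k' \<otimes> k)))"
    by (simp add: mult_assoc)
  also have "\<dots> = sw K h' (\<lambda>h1 h2. \<epsilon> (h \<otimes> h2) \<otimes>\<^bsub>R\<^esub> \<epsilon> (((h1 \<otimes> c) \<otimes> k') \<otimes> k))"
    by (simp add: counit_mult2[of h h' "c \<otimes> (k' \<otimes> k)"]) (simp add: mult_assoc)
  also have "\<dots> = sw K h' (\<lambda>h1 h2. sw K k' (\<lambda>k1 k2. \<epsilon> (h \<otimes> h2) \<otimes>\<^bsub>R\<^esub> (\<epsilon> ((h1 \<otimes> c) \<otimes> k1) \<otimes>\<^bsub>R\<^esub> \<epsilon> (k2 \<otimes> k))))"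
    by (simp add: counit_mult1[of "_ \<otimes> c" k' k] scalar_mult_tsum)
  also have "\<dots> = sw K k' (\<lambda>k1 k2. sw K h' (\<lambda>h1 h2. (\<epsilon> (k2 \<otimes> k) \<otimes>\<^bsub>R\<^esub> \<epsilon> (h \<otimes> h2)) \<otimes>\<^bsub>R\<^esub> \<epsilon> ((h1 \<otimes> c) \<otimes> k1)))"
    by (subst tsum_swap) (simp_all add: R.m_ac)
  also have "\<dots> = ?R (pH k h) (pH k' h')"
    by (simp add: sw_Henv_pure bilI)
  finally show "?L (pH k h) (pH k' h') = ?R (pH k h) (pH k' h')" .
qed (use assms in \<open>simp_all add: bilI\<close>)

lemma left_module_coalgebra_env_act: "left_module_coalgebra R Henv H env_act"
  unfolding left_module_coalgebra_def
proof (intro conjI ballI)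
  show "counital_coalgebra R H"
    using weak_bialgebra_iff weak_bialg_axioms by (simp add: weak_bialgebra_def)
  show "left_module R Henv H env_act" by (rule left_module_env_act)
next
  fix b c assume [simp]: "b \<in> carrier Henv" "c \<in> carrier H"
  then have b: "b \<in> carrier HH" by simp
  have "sweedler R Henv HH (\<lambda>b1 b2. sweedler R H HH (\<lambda>c1 c2. pH (env_act b1 c1) (env_act b2 c2)) c) b
    = sweedler R Henv HH (\<lambda>b1 b2. sw HH c (\<lambda>c1 c2. pH (env_act b1 c1) (env_act b2 c2))) b"
    by (rule sweedler_cong) (simp add: sweedler_eq_tsum bilI)
  also have "\<dots> = comult H (env_act b c)"
    using b by (subst T.B.sweedler_eq_tsum) (simp_all add: bilI comult_env_act)
  finally show "comult H (env_act b c)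
    = sweedler R Henv HH (\<lambda>b1 b2. sweedler R H HH (\<lambda>c1 c2. pH (env_act b1 c1) (env_act b2 c2)) c) b" by simp
next
  fix b b' c assume "b \<in> carrier Henv" "b' \<in> carrier Henv" "c \<in> carrier H"
  then show "\<epsilon> (env_act (b \<otimes>\<^bsub>Henv\<^esub> b') c)
    = sweedler R Henv R (\<lambda>b1 b2. counit Henv (b \<otimes>\<^bsub>Henv\<^esub> b2) \<otimes>\<^bsub>R\<^esub> \<epsilon> (env_act b1 c)) b'"
    using T.B.sweedler_scalar[of b'] by (simp add: bilI counit_env_act)
qed

lemma weak_doi_hopf_datum_yd: "weak_doi_hopf_datum R Henv H coact H env_act"
  unfolding weak_doi_hopf_datum_def
  using right_comodule_algebra_coact left_module_coalgebra_env_act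
    T.B.weak_bialgebra_iff T.B.weak_bialg_axioms by blast

end

section \<open>Doi-Hopf modules and Yetter-Drinfeld modules\<close>

locale weak_hopf_module = weak_hopf_datum R H S
  for R :: "('k, 'r) ring_scheme" and H :: "('k, 'h) coalgebra" (structure) and S :: "'h \<Rightarrow> 'h" +
  fixes M :: "('k, 'm, 'y) module_scheme" and act :: "'h \<Rightarrow> 'm \<Rightarrow> 'm" and \<rho> :: "'m \<Rightarrow> ('m, 'h) tens"
  assumes action: "left_module R H M act"
    and coaction: "\<rho> \<in> linear_maps R M (tensor R M H)"
begin

abbreviation MH where "MH \<equiv> tensor R M H"
abbreviation pM where "pM \<equiv> pure_tensor R M H"
abbreviation cs where "cs P m F \<equiv> tsum R M H P (\<rho> m) F"

lemma module_M [simp]: "module R M"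
  using action by (simp add: left_module_def)

lemma bil_act: "bil R H M M act"
  using action by (simp add: left_module_def bil_def lin_def)

lemmas act_rules [simp] = bil_compD(1-3)[OF bil_act]

lemma act_mult: "a \<in> carrier H \<Longrightarrow> b \<in> carrier H \<Longrightarrow> m \<in> carrier M \<Longrightarrow> act (a \<otimes> b) m = act a (act b m)"
  and act_one [simp]: "m \<in> carrier M \<Longrightarrow> act \<one> m = m"
  using action by (simp_all add: left_module_def)

lemma lin_coaction: "lin R M MH \<rho>"
  using coaction by (simp add: lin_def)

lemmas coaction_rules [simp] = lin_compD(1,2)[OF lin_coaction]

lemma doi_hopf_rhs_eq:
  assumes [simp]: "a \<in> carrier H" "m \<in> carrier M"
  shows "tensor_lift R H Henv MH (\<lambda>a0 a1. tensor_lift R M H MH (\<lambda>m0 m1. pM (act a0 m0) (env_act a1 m1)) (\<rho> m)) (coact a)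
    = sw MH a (\<lambda>x c. sw MH x (\<lambda>p q. cs MH m (\<lambda>m0 m1. pM (act q m0) (c \<otimes> m1 \<otimes> S' p))))"
proof -
  have "tensor_lift R H Henv MH (\<lambda>a0 a1. tensor_lift R M H MH (\<lambda>m0 m1. pM (act a0 m0) (env_act a1 m1)) (\<rho> m))
    = tensor_lift R H HH MH (\<lambda>a0 a1. cs MH m (\<lambda>m0 m1. pM (act a0 m0) (env_act a1 m1)))"
    unfolding same_mod_rules by (rule tensor_lift_cong) (simp add: tensor_lift_eq_tsum bilI)
  then show ?thesis
    by (simp add: tensor_lift_eq_tsum tsum_coact bilI)
qed

lemma yd_lhs_eq:
  assumes [simp]: "h \<in> carrier H" "t \<in> carrier MH"
  shows "sweedler R H MH (\<lambda>h1 h2. tensor_lift R M H MH (\<lambda>m0 m1. pM (act h1 m0) (h2 \<otimes> m1)) t) h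
    = sw MH h (\<lambda>h1 h2. tsum R M H MH t (\<lambda>m0 m1. pM (act h1 m0) (h2 \<otimes> m1)))"
proof -
  have "sweedler R H MH (\<lambda>h1 h2. tensor_lift R M H MH (\<lambda>m0 m1. pM (act h1 m0) (h2 \<otimes> m1)) t) h
    = sweedler R H MH (\<lambda>h1 h2. tsum R M H MH t (\<lambda>m0 m1. pM (act h1 m0) (h2 \<otimes> m1))) h"
    by (rule sweedler_cong) (simp add: tensor_lift_eq_tsum bilI)
  then show ?thesis by (simp add: sweedler_eq_tsum bilI)
qed

lemma yd_rhs_eq:
  assumes [simp]: "h \<in> carrier H" "m \<in> carrier M"
  shows "sweedler R H MH (\<lambda>h1 h2. tensor_lift R M H MH (\<lambda>n0 n1. pM n0 (n1 \<otimes> h1)) (\<rho> (act h2 m))) h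
    = sw MH h (\<lambda>h1 h2. cs MH (act h2 m) (\<lambda>n0 n1. pM n0 (n1 \<otimes> h1)))"
proof -
  have "sweedler R H MH (\<lambda>h1 h2. tensor_lift R M H MH (\<lambda>n0 n1. pM n0 (n1 \<otimes> h1)) (\<rho> (act h2 m))) h
    = sweedler R H MH (\<lambda>h1 h2. cs MH (act h2 m) (\<lambda>n0 n1. pM n0 (n1 \<otimes> h1))) h"
    by (rule sweedler_cong) (simp add: tensor_lift_eq_tsum bilI)
  then show ?thesis by (simp add: sweedler_eq_tsum bilI)
qed

lemma tensor_t_eq:
  "tensor_t R H M act = (\<lambda>t. sw MH \<one> (\<lambda>x y. tsum R M H MH t (\<lambda>m h. pM (act x m) (y \<otimes> h)))) ` carrier MH"
  unfolding tensor_t_def by (rule image_cong) (simp_all add: yd_lhs_eq)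

section \<open>Equivalence of the two compatibility conditions\<close>

definition doi_hopf_compatible where
  "doi_hopf_compatible \<longleftrightarrow> (\<forall>a\<in>carrier H. \<forall>m\<in>carrier M. \<rho> (act a m)
     = sw MH a (\<lambda>x c. sw MH x (\<lambda>p q. cs MH m (\<lambda>m0 m1. pM (act q m0) (c \<otimes> m1 \<otimes> S' p)))))"

definition yd_compatible where
  "yd_compatible \<longleftrightarrow> (\<forall>h\<in>carrier H. \<forall>m\<in>carrier M.
     sw MH h (\<lambda>h1 h2. cs MH m (\<lambda>m0 m1. pM (act h1 m0) (h2 \<otimes> m1)))
     = sw MH h (\<lambda>h1 h2. cs MH (act h2 m) (\<lambda>n0 n1. pM n0 (n1 \<otimes> h1))))"

lemma doi_hopf_tsum:
  assumes DH: "doi_hopf_compatible" and F: "bil R M H P F" and a: "a \<in> carrier H" and m: "m \<in> carrier M"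
  shows "cs P (act a m) F = sw P a (\<lambda>x c. sw P x (\<lambda>p q. cs P m (\<lambda>m0 m1. F (act q m0) (c \<otimes> m1 \<otimes> S' p))))"
proof -
  note [simp] = bil_compD[OF F] a m
  have "\<rho> (act a m) = sw MH a (\<lambda>x c. sw MH x (\<lambda>p q. cs MH m (\<lambda>m0 m1. pM (act q m0) (c \<otimes> m1 \<otimes> S' p))))"
    using DH by (simp add: doi_hopf_compatible_def)
  then show ?thesis using F by (simp add: tsum_tsum tsum_pure)
qed

lemma doi_hopf_imp_tensor_t:
  assumes DH: "doi_hopf_compatible" and [simp]: "m \<in> carrier M"
  shows "\<rho> m \<in> tensor_t R H M act"
proof -
  \<comment> \<open>The preimage under \<Delta>(1): splitting the iterated coproduct of 1 as 1_1
    \<otimes> 1'_1 1_2 \<otimes> 1'_2 leaves 1_2 m_0 \<otimes> m_1 S^-1(1_1) once \<Delta>(1') is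
    factored out.\<close>
  let ?t = "sw MH \<one> (\<lambda>p y. cs MH m (\<lambda>m0 m1. pM (act y m0) (m1 \<otimes> S' p)))"
  have "\<rho> m = \<rho> (act \<one> m)" by simp
  also have "\<dots> = sw MH \<one> (\<lambda>x c. sw MH x (\<lambda>p q. cs MH m (\<lambda>m0 m1. pM (act q m0) (c \<otimes> m1 \<otimes> S' p))))"
    using DH by (simp add: doi_hopf_compatible_def del: act_one)
  also have "\<dots> = sw MH \<one> (\<lambda>p y. sw MH \<one> (\<lambda>x' y'. cs MH m (\<lambda>m0 m1. pM (act (x' \<otimes> y) m0) (y' \<otimes> m1 \<otimes> S' p))))"
    by (rule sw_one_right) (simp_all add: trilI)
  also have "\<dots> = sw MH \<one> (\<lambda>x' y'. sw MH \<one> (\<lambda>p y. cs MH m (\<lambda>m0 m1. pM (act (x' \<otimes> y) m0) (y' \<otimes> m1 \<otimes> S' p))))"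
    by (rule tsum_swap) simp_all
  also have "\<dots> = sw MH \<one> (\<lambda>x' y'. tsum R M H MH ?t (\<lambda>m h. pM (act x' m) (y' \<otimes> h)))"
    by (simp add: tsum_tsum tsum_pure bilI act_mult mult_assoc)
  finally show ?thesis unfolding tensor_t_eq by (rule image_eqI) simp
qed

lemma doi_hopf_imp_yd:
  assumes DH: "doi_hopf_compatible" shows "yd_compatible"
  unfolding yd_compatible_def
proof (intro ballI)
  fix h m assume [simp]: "h \<in> carrier H" "m \<in> carrier M"
  \<comment> \<open>\<open>V s q c\<close> is qm_0 \<otimes> cm_1s, kept folded so that only the
    three slots matter while legs are regrouped.\<close>
  define V where "V s q c = cs MH m (\<lambda>m0 m1. pM (act q m0) (c \<otimes> (m1 \<otimes> s)))" for s q c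
  have V: "V s q c \<in> carrier MH" "lin R X H f \<Longrightarrow> lin R X MH (\<lambda>x. V (f x) q c)"
     "lin R X H f \<Longrightarrow> lin R X MH (\<lambda>x. V s (f x) c)" "lin R X H f \<Longrightarrow> lin R X MH (\<lambda>x. V s q (f x))"
    if "s \<in> carrier H" "q \<in> carrier H" "c \<in> carrier H" for s q c f and X :: "('k, 'z, 'zz) module_scheme"
    using that lin_module1[of R X H f] by (auto simp: V_def)
  note [simp] = V
  have "sw MH h (\<lambda>h1 h2. cs MH (act h2 m) (\<lambda>n0 n1. pM n0 (n1 \<otimes> h1)))
    = sw MH h (\<lambda>a y. sw MH y (\<lambda>x c. sw MH x (\<lambda>p q. V (S' p \<otimes> a) q c)))"
    by (simp add: doi_hopf_tsum[OF DH] bilI V_def mult_assoc)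
  also have "\<dots> = sw MH h (\<lambda>w c. sw MH w (\<lambda>a x. sw MH x (\<lambda>p q. V (S' p \<otimes> a) q c)))"
    by (rule sw_coassoc[symmetric]) (simp_all add: trilI bilI)
  also have "\<dots> = sw MH h (\<lambda>w c. sw MH w (\<lambda>z q. sw MH z (\<lambda>a p. V (S' p \<otimes> a) q c)))"
    by (rule tsum_cong, rule sw_coassoc[symmetric]) (simp_all add: trilI)
  also have "\<dots> = sw MH h (\<lambda>w c. sw MH w (\<lambda>z q. V (S' (\<epsilon>\<^sub>s z)) q c))"
    by (intro tsum_cong, rule sw_antipode_inv_left) simp_all
  also have "\<dots> = sw MH h (\<lambda>z u. sw MH u (\<lambda>q c. V (S' (\<epsilon>\<^sub>s z)) q c))"
    by (rule sw_coassoc) (simp_all add: trilI)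
  also have "\<dots> = sw MH \<one> (\<lambda>x y. sw MH (h \<otimes> y) (\<lambda>q c. V (S' x) q c))"
    by (rule sw_eps_s_left) (simp_all add: bilI)
  also have "\<dots> = sw MH \<one> (\<lambda>x y. sw MH h (\<lambda>a b. sw MH y (\<lambda>q c. V (S' x) (a \<otimes> q) (b \<otimes> c))))"
    by (intro tsum_cong sw_mult) (simp_all add: bilI)
  also have "\<dots> = sw MH h (\<lambda>a b. sw MH \<one> (\<lambda>x y. sw MH y (\<lambda>q c. V (S' x) (a \<otimes> q) (b \<otimes> c))))"
    by (rule tsum_swap) simp_all
  also have "\<dots> = sw MH h (\<lambda>a b. sw MH \<one> (\<lambda>z c. sw MH z (\<lambda>x q. V (S' x) (a \<otimes> q) (b \<otimes> c))))"
    by (rule tsum_cong, rule sw_coassoc[symmetric]) (simp_all add: trilI)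
  \<comment> \<open>After h is pulled out, 1_2 m_0 \<otimes> 1_3 m_1 S^-1(1_1) is left, which is the
    Doi-Hopf formula for \<rho>(1m) read backwards. The factor 1 is kept visible for that
    reason.\<close>
  also have "\<dots> = sw MH h (\<lambda>a b. cs MH (act \<one> m) (\<lambda>m0 m1. pM (act a m0) (b \<otimes> m1)))"
    by (simp add: doi_hopf_tsum[OF DH] bilI V_def mult_assoc act_mult del: act_one)
  finally show "sw MH h (\<lambda>h1 h2. cs MH m (\<lambda>m0 m1. pM (act h1 m0) (h2 \<otimes> m1)))
     = sw MH h (\<lambda>h1 h2. cs MH (act h2 m) (\<lambda>n0 n1. pM n0 (n1 \<otimes> h1)))" by simp
qed

text \<open>\<Delta>(1)\<Delta>(1) = \<Delta>(1), so multiplication by \<Delta>(1) is a projection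
  and fixes its image.\<close>

lemma tensor_t_fixed:
  assumes "t \<in> tensor_t R H M act"
  shows "sw MH \<one> (\<lambda>x y. tsum R M H MH t (\<lambda>m h. pM (act x m) (y \<otimes> h))) = t"
proof -
  obtain u where [simp]: "u \<in> carrier MH"
    and t: "t = sw MH \<one> (\<lambda>x y. tsum R M H MH u (\<lambda>m h. pM (act x m) (y \<otimes> h)))"
    using assms by (auto simp only: tensor_t_eq)
  have "sw MH \<one> (\<lambda>x y. tsum R M H MH t (\<lambda>m h. pM (act x m) (y \<otimes> h)))
    = sw MH \<one> (\<lambda>x y. sw MH \<one> (\<lambda>x' y'. tsum R M H MH u (\<lambda>m h. pM (act (x \<otimes> x') m) (y \<otimes> y' \<otimes> h))))"
    unfolding t by (simp add: tsum_tsum tsum_pure bilI act_mult mult_assoc)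
  also have "\<dots> = sw MH (\<one> \<otimes> \<one>) (\<lambda>x y. tsum R M H MH u (\<lambda>m h. pM (act x m) (y \<otimes> h)))"
    by (rule sw_mult[symmetric]) (simp_all add: bilI)
  finally show ?thesis by (simp add: t)
qed

lemma yd_imp_doi_hopf:
  assumes YD: "yd_compatible" and t: "\<And>m. m \<in> carrier M \<Longrightarrow> \<rho> m \<in> tensor_t R H M act"
  shows "doi_hopf_compatible"
  unfolding doi_hopf_compatible_def
proof (intro ballI)
  fix a m assume [simp]: "a \<in> carrier H" "m \<in> carrier M"
  \<comment> \<open>The Yetter-Drinfeld condition multiplied on the right of the second leg by a
    fixed element, which will be S^-1 of a leg of a.\<close>
  have YD': "sw MH y (\<lambda>q c. cs MH m (\<lambda>m0 m1. pM (act q m0) (c \<otimes> m1 \<otimes> s)))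
     = sw MH y (\<lambda>h1 h2. cs MH (act h2 m) (\<lambda>n0 n1. pM n0 (n1 \<otimes> h1 \<otimes> s)))"
    if [simp]: "y \<in> carrier H" "s \<in> carrier H" for y s
  proof -
    have "sw MH y (\<lambda>h1 h2. cs MH m (\<lambda>m0 m1. pM (act h1 m0) (h2 \<otimes> m1)))
     = sw MH y (\<lambda>h1 h2. cs MH (act h2 m) (\<lambda>n0 n1. pM n0 (n1 \<otimes> h1)))"
      using YD by (simp add: yd_compatible_def)
    from arg_cong[OF this, of "\<lambda>t. tsum R M H MH t (\<lambda>n0 n1. pM n0 (n1 \<otimes> s))"]
    show ?thesis by (simp add: tsum_tsum tsum_pure bilI)
  qed
  have "sw MH a (\<lambda>x c. sw MH x (\<lambda>p q. cs MH m (\<lambda>m0 m1. pM (act q m0) (c \<otimes> m1 \<otimes> S' p))))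
    = sw MH a (\<lambda>p y. sw MH y (\<lambda>q c. cs MH m (\<lambda>m0 m1. pM (act q m0) (c \<otimes> m1 \<otimes> S' p))))"
    by (rule sw_coassoc) (simp_all add: trilI)
  also have "\<dots> = sw MH a (\<lambda>p y. sw MH y (\<lambda>h1 h2. cs MH (act h2 m) (\<lambda>n0 n1. pM n0 (n1 \<otimes> h1 \<otimes> S' p))))"
    by (intro tsum_cong YD') simp_all
  also have "\<dots> = sw MH a (\<lambda>z h2. sw MH z (\<lambda>p h1. cs MH (act h2 m) (\<lambda>n0 n1. pM n0 (n1 \<otimes> h1 \<otimes> S' p))))"
    by (rule sw_coassoc[symmetric]) (simp_all add: trilI bilI)
  also have "\<dots> = sw MH a (\<lambda>z h2. sw MH z (\<lambda>p h1. cs MH (act h2 m) (\<lambda>n0 n1. pM n0 (n1 \<otimes> (h1 \<otimes> S' p)))))"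
    by (simp add: mult_assoc)
  also have "\<dots> = sw MH a (\<lambda>z h2. cs MH (act h2 m) (\<lambda>n0 n1. pM n0 (n1 \<otimes> S' (\<epsilon>\<^sub>t z))))"
    by (rule tsum_cong, rule sw_antipode_inv_right) simp_all
  also have "\<dots> = sw MH \<one> (\<lambda>x y. cs MH (act (y \<otimes> a) m) (\<lambda>n0 n1. pM n0 (n1 \<otimes> x)))"
    by (rule sw_antipode_inv_eps_t) (simp_all add: bilI)
  also have "\<dots> = sw MH \<one> (\<lambda>x y. cs MH (act y (act a m)) (\<lambda>n0 n1. pM n0 (n1 \<otimes> x)))"
    by (simp add: act_mult)
  \<comment> \<open>The Yetter-Drinfeld condition for the scalar 1 and the module element am, read
    from right to left; it produces \<Delta>(1)\<rho>(am).\<close>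
  also have "\<dots> = sw MH \<one> (\<lambda>x y. cs MH (act a m) (\<lambda>n0 n1. pM (act x n0) (y \<otimes> n1)))"
    using YD by (simp add: yd_compatible_def)
  also have "\<dots> = \<rho> (act a m)"
    by (rule tensor_t_fixed) (rule t, simp)
  finally show "\<rho> (act a m) = sw MH a (\<lambda>x c. sw MH x (\<lambda>p q. cs MH m (\<lambda>m0 m1. pM (act q m0) (c \<otimes> m1 \<otimes> S' p))))"
    by simp
qed

lemma doi_hopf_iff_yd:
  "(\<forall>a\<in>carrier H. \<forall>m\<in>carrier M. \<rho> (act a m)
      = tensor_lift R H Henv MH (\<lambda>a0 a1. tensor_lift R M H MH
          (\<lambda>m0 m1. pM (act a0 m0) (env_act a1 m1)) (\<rho> m)) (coact a))
    \<longleftrightarrow> (\<forall>m\<in>carrier M. \<rho> m \<in> tensor_t R H M act) \<and>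
      (\<forall>h\<in>carrier H. \<forall>m\<in>carrier M.
        sweedler R H MH (\<lambda>h1 h2. tensor_lift R M H MH (\<lambda>m0 m1. pM (act h1 m0) (h2 \<otimes> m1)) (\<rho> m)) h
        = sweedler R H MH (\<lambda>h1 h2. tensor_lift R M H MH (\<lambda>n0 n1. pM n0 (n1 \<otimes> h1)) (\<rho> (act h2 m))) h)"
    (is "?DH \<longleftrightarrow> ?T \<and> ?YD")
proof -
  have "?DH = doi_hopf_compatible" "?YD = yd_compatible"
    by (simp_all only: doi_hopf_compatible_def yd_compatible_def doi_hopf_rhs_eq yd_rhs_eq yd_lhs_eq
        coaction_rules cong: ball_cong)
  then show ?thesis
    using doi_hopf_imp_tensor_t doi_hopf_imp_yd yd_imp_doi_hopf by blast
qed

end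

lemma (in weak_hopf_datum) doi_hopf_modules_eq_yd_modules:
  "doi_hopf_modules R Henv H coact H env_act = (yd_modules R H :: ('k, 'h, 'h, 'm) modcomod set)"
proof -
  have *: "(M, act, \<rho>) \<in> doi_hopf_modules R Henv H coact H env_act \<longleftrightarrow> (M, act, \<rho>) \<in> yd_modules R H"
    for M :: "('k, 'm) module" and act \<rho>
  proof (cases "(M, act, \<rho>) \<in> modcomod R H H")
    case True
    then interpret weak_hopf_module R H S M act \<rho>
      by unfold_locales (simp_all add: modcomod_def right_comodule_def)
    show ?thesis
      using True doi_hopf_iff_yd by (simp only: doi_hopf_modules_def yd_modules_def mem_Collect_eq case_prod_conv)
  qed (simp add: doi_hopf_modules_def yd_modules_def)
  show ?thesis
  proof (rule Set.set_eqI)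
    fix X :: "('k, 'h, 'h, 'm) modcomod"
    show "X \<in> doi_hopf_modules R Henv H coact H env_act \<longleftrightarrow> X \<in> yd_modules R H"
      using * by (cases X rule: prod_cases3) (simp only:)
  qed
qed

section \<open>Categories of modules with a coaction\<close>

text \<open>Morphisms do not refer to \<O>, so one proof serves every full subcategory. They are
  extensional on the carrier, hence restricted identities and composites satisfy the category laws
  as equations of functions.\<close>

lemma category_modcomod:
  assumes C: "module R C" and \<O>: "\<O> \<subseteq> modcomod R A C"
  shows "category (modcomod_category R A C \<O>)"
proof -
  have obj: "module R M" "lin R M (tensor R M C) \<rho>" "\<And>a m. a \<in> carrier A \<Longrightarrow> m \<in> carrier M \<Longrightarrow> act a m \<in> carrier M"
    if "(M, act, \<rho>) \<in> \<O>" for M act \<rho>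
    using subsetD[OF \<O> that] C
    by (auto simp: modcomod_def left_module_def right_comodule_def lin_def linear_maps_def hom_def)
  have tmap: "tensor_map R M C N C f (\<lambda>c. c) t = tsum R M C (tensor R N C) t (\<lambda>m c. pure_tensor R N C (f m) c)"
    if "lin R M N f" "t \<in> carrier (tensor R M C)" for M N f t
    using that C by (simp add: tensor_map_eq)
  have id: "(\<lambda>m\<in>carrier M. m) \<in> modcomod_hom R A C (M, act, \<rho>) (M, act, \<rho>)"
    if "(M, act, \<rho>) \<in> \<O>" for M act \<rho>
  proof -
    note o = obj[OF that]
    have l: "lin R M M (\<lambda>m\<in>carrier M. m)"
      using lin_cong[of M "\<lambda>m\<in>carrier M. m" "\<lambda>m. m" R M] o by simp
    have "tensor_map R M C M C (\<lambda>m\<in>carrier M. m) (\<lambda>c. c) (\<rho> m) = \<rho> m" if m: "m \<in> carrier M" for m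
    proof -
      have "tensor_map R M C M C (\<lambda>m\<in>carrier M. m) (\<lambda>c. c) (\<rho> m)
        = tsum R M C (tensor R M C) (\<rho> m) (pure_tensor R M C)"
        using tmap[OF l lin_closed[OF o(2) m]] by simp
      then show ?thesis using tsum_pure_id[OF o(1) C lin_closed[OF o(2) m]] by simp
    qed
    then show ?thesis using l o by (simp add: modcomod_hom_def lin_def)
  qed
  have comp: "compose (carrier M) g f \<in> modcomod_hom R A C (M, act, \<rho>) (M'', act'', \<rho>'')"
    if X: "(M, act, \<rho>) \<in> \<O>" "(M', act', \<rho>') \<in> \<O>" "(M'', act'', \<rho>'') \<in> \<O>"
      and f: "f \<in> modcomod_hom R A C (M, act, \<rho>) (M', act', \<rho>')"
      and g: "g \<in> modcomod_hom R A C (M', act', \<rho>') (M'', act'', \<rho>'')"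
    for M act \<rho> M' act' \<rho>' M'' act'' \<rho>'' f g
  proof -
    note o = obj[OF X(1)] and o' = obj[OF X(2)] and o'' = obj[OF X(3)]
    have lf: "lin R M M' f" and lg: "lin R M' M'' g"
      using f g o(1) o'(1) o''(1) by (auto simp: modcomod_hom_def lin_def)
    note [simp] = lin_compD[OF lf] lin_compD[OF lg]
    have l: "lin R M M'' (compose (carrier M) g f)"
      using lin_cong[of M "compose (carrier M) g f" "\<lambda>m. g (f m)" R M''] lin_comp[OF lg lf]
      by (simp add: compose_def)
    have "\<rho>'' (g (f m)) = tensor_map R M C M'' C (compose (carrier M) g f) (\<lambda>c. c) (\<rho> m)" if m: "m \<in> carrier M" for m
    proof -
      have \<rho>f: "\<rho>' (f m) = tensor_map R M C M' C f (\<lambda>c. c) (\<rho> m)"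
        using f m by (simp add: modcomod_hom_def)
      have \<rho>g: "\<rho>'' (g (f m)) = tensor_map R M' C M'' C g (\<lambda>c. c) (\<rho>' (f m))"
        using g lin_closed[OF lf m] by (simp add: modcomod_hom_def)
      have "\<rho>'' (g (f m)) = tsum R M' C (tensor R M'' C) (\<rho>' (f m)) (\<lambda>m c. pure_tensor R M'' C (g m) c)"
        unfolding \<rho>g by (rule tmap[OF lg]) (rule lin_closed[OF o'(2) lin_closed[OF lf m]])
      also have "\<dots> = tsum R M C (tensor R M'' C) (\<rho> m) (\<lambda>m c. pure_tensor R M'' C (g (f m)) c)"
        unfolding \<rho>f tmap[OF lf lin_closed[OF o(2) m]]
        using C o(1) o'(1) o''(1) by (simp add: tsum_tsum tsum_pure bilI)
      also have "\<dots> = tensor_map R M C M'' C (compose (carrier M) g f) (\<lambda>c. c) (\<rho> m)"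
        unfolding tmap[OF l lin_closed[OF o(2) m]] by (rule tsum_cong) (simp add: compose_def)
      finally show ?thesis .
    qed
    then show ?thesis
      using l f g o(3) lin_closed[OF lf]
      by (simp add: modcomod_hom_def lin_def compose_def)
  qed
  have dom: "f \<in> extensional (carrier M)" "f \<in> carrier M \<rightarrow> carrier M'"
    if "f \<in> modcomod_hom R A C (M, act, \<rho>) (M', act', \<rho>')" for f M act \<rho> M' act' \<rho>'
    using that by (auto simp: modcomod_hom_def linear_maps_def hom_def)
  show ?thesis
    unfolding category_def modcomod_category_def cat.simps
    by (auto simp: split_paired_all intro: id comp compose_Id[OF dom(2,1)] Id_compose[OF dom(2,1)]
        compose_assoc[OF dom(2), symmetric])
qed

lemma isomorphic_categories_refl: "category \<C> \<Longrightarrow> isomorphic_categories \<C> \<C>"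
  unfolding isomorphic_categories_def is_functor_def
  by (intro conjI exI[of _ "\<lambda>X. X"] exI[of _ "\<lambda>X Y f. f"]) auto

theorem corollary3p3:
  fixes R :: "('k, 'r) ring_scheme"
    and H :: "('k, 'h) coalgebra"
    and S :: "'h \<Rightarrow> 'h"
  assumes "cring R"
    and "weak_hopf_algebra R H S"
    and "bij_betw S (carrier H) (carrier H)"
  shows
    "weak_doi_hopf_datum R (tensor_bialgebra R (opposite H) H)
       H (yd_coaction R H S) H (yd_action R H) \<and>
     isomorphic_categories
       (doi_hopf_category R (tensor_bialgebra R (opposite H) H)
          H (yd_coaction R H S) H (yd_action R H)
        :: (('k, 'h, 'h, 'm) modcomod, 'm \<Rightarrow> 'm) cat)
       (yd_category R H :: (('k, 'h, 'h, 'm) modcomod, 'm \<Rightarrow> 'm) cat)"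
proof -
  interpret weak_hopf R H S
    using assms(2) by (rule weak_hopf_algebra_imp_weak_hopf)
  interpret weak_hopf_datum R H S
    by unfold_locales (rule assms(3))
  have "category (yd_category R H :: (('k, 'h, 'h, 'm) modcomod, 'm \<Rightarrow> 'm) cat)"
    unfolding yd_category_def by (rule category_modcomod) (auto simp: yd_modules_def)
  moreover have "doi_hopf_category R Henv H coact H env_act
    = (yd_category R H :: (('k, 'h, 'h, 'm) modcomod, 'm \<Rightarrow> 'm) cat)"
    by (simp add: doi_hopf_category_def yd_category_def doi_hopf_modules_eq_yd_modules)
  ultimately show ?thesis
    using weak_doi_hopf_datum_yd by (simp add: isomorphic_categories_refl)
qed

end
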